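(* Let $(M,g,\eta)$ be a closed Sasakian manifold with Reeb flow $\mathcal{F}$ and underlying transversely Kähler structure $(\mathcal{F},J,g_\nu)$. Then the basic Euler class of the underlying transversely holomorphic isometric Riemannian flow is of degree $(1,1)$.
   Context: A Sasakian metric on an odd-dimensional manifold $M$ is a pair $(g,\eta)$ of a Riemannian metric and a contact form such that $r^{2}g+dr\otimes dr$ on $M\times\mathbb{R}_{>0}$ is a Kähler metric with Kähler form $d(r^{2}\eta)$. Its Reeb flow is the orbit foliation $\mathcal{F}$ of the Reeb field $\xi$ ($\eta(\xi)=1$, $\iota_\xi d\eta=0$). The underlying transversely Kähler structure $(\mathcal{F},J,g_\nu)$ consists of the metric $g_\nu$ induced by $g$ on $TM/T\mathcal{F}\cong\ker\eta$ and the transverse complex structure $J$ with $d\eta(X,Y)=g_\nu(X,JY)$; both are invariant along $\mathcal{F}$. A Riemannian flow $\mathcal{F}$ (a $1$-dimensional foliation with a metric on $TM/T\mathcal{F}$ invariant along $\mathcal{F}$) is isometric if there is a Killing pair $(g',\xi')$: a Riemannian metric on $M$ and a nowhere vanishing vector field tangent to $\mathcal{F}$ whose flow preserves $g'$, normalized by $g'(\xi',\xi')=1$. Let $\eta'(X)=g'(\xi',X)$. A form $\alpha$ is basic if $\iota_X\alpha=0=\iota_Xd\alpha$ for all $X$ tangent to $\mathcal{F}$; $d\eta'$ is basic, and the basic Euler class is the class of $d\eta'$ in the cohomology of basic forms, up to nonzero real factors. For transversely holomorphic $\mathcal{F}$, complex basic forms decompose by $J$ into basic $(p,q)$-forms,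 $d=\partial+\overline\partial$, and $H^{0,2}_b(M/\mathcal{F})$ is the degree-$2$ cohomology of $(\Omega_b^{0,\bullet}(M/\mathcal{F}),\overline\partial)$. The basic Euler class is of degree $(1,1)$ if $[(d\eta')^{0,2}]=0$ in $H^{0,2}_b(M/\mathcal{F})$ (independent of the Killing pair). *)

theory Defs
  imports "HOL-Analysis.Analysis" "HOL-Combinatorics.Permutations"
begin

section \<open>Smooth manifolds, tangent vectors and vector fields\<close>

text \<open>The set \<open>S\<close> is meant to be open; on a Euclidean space, having all directional derivatives
  of class \<open>C\<^sup>k\<close> amounts to having a derivative of class \<open>C\<^sup>k\<close>.\<close>

primrec Ck_on :: "nat \<Rightarrow> 'b::euclidean_space set \<Rightarrow> ('b \<Rightarrow> 'c::real_normed_vector) \<Rightarrow> bool" where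
  "Ck_on 0 = (\<lambda>S f. continuous_on S f)"
| "Ck_on (Suc k) = (\<lambda>S f. \<exists>f'. (\<forall>x\<in>S. (f has_derivative f' x) (at x)) \<and>
                              (\<forall>v. Ck_on k S (\<lambda>x. f' x v)))"

definition smooth_on :: "'b::euclidean_space set \<Rightarrow> ('b \<Rightarrow> 'c::real_normed_vector) \<Rightarrow> bool" where
  "smooth_on S f \<longleftrightarrow> (\<forall>k. Ck_on k S f)"

text \<open>An atlas is a set of charts \<open>(U, x)\<close>; the underlying set of the manifold is the union of the
  domains, an open subset of the type \<open>'a\<close>. All objects below only matter on that set: functions
  that agree there are not distinguished.\<close>

type_synonym ('a, 'e) atlas = "('a set \<times> ('a \<Rightarrow> 'e)) set"

definition mcarrier :: "('a, 'e) atlas \<Rightarrow> 'a set" where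
  "mcarrier A = \<Union> (fst ` A)"

definition smooth_manifold ::
    "('a::{t2_space,second_countable_topology}, 'e::euclidean_space) atlas \<Rightarrow> bool" where
  "smooth_manifold A \<longleftrightarrow>
     (\<forall>(U, x)\<in>A. open U \<and> open (x ` U) \<and> homeomorphism U (x ` U) x (inv_into U x)) \<and>
     (\<forall>(U, x)\<in>A. \<forall>(V, y)\<in>A. smooth_on (x ` (U \<inter> V)) (y \<circ> inv_into U x))"

definition Cinf :: "('a, 'e::euclidean_space) atlas \<Rightarrow> ('a \<Rightarrow> real) set" where
  "Cinf A = {f. \<forall>(U, x)\<in>A. smooth_on (x ` U) (f \<circ> inv_into U x)}"

definition CinfC :: "('a, 'e::euclidean_space) atlas \<Rightarrow> ('a \<Rightarrow> complex) set" where
  "CinfC A = {f. (\<lambda>p. Re (f p)) \<in> Cinf A \<and> (\<lambda>p. Im (f p)) \<in> Cinf A}"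

definition prod_atlas :: "('a, 'e) atlas \<Rightarrow> ('b, 'f) atlas \<Rightarrow> ('a \<times> 'b, 'e \<times> 'f) atlas" where
  "prod_atlas A B = {(U \<times> V, map_prod x y) | U x V y. (U, x) \<in> A \<and> (V, y) \<in> B}"

definition line_atlas :: "(real, real) atlas" where
  "line_atlas = {(UNIV, id)}"

definition half_line_atlas :: "(real, real) atlas" where
  "half_line_atlas = {({0<..}, id)}"

text \<open>Tangent vectors are derivations of \<open>Cinf A\<close>. They vanish outside \<open>Cinf A\<close>, so that
  equality of tangent vectors is equality of functions.\<close>

type_synonym 'a tvec = "('a \<Rightarrow> real) \<Rightarrow> real"
type_synonym 'a vfield = "'a \<Rightarrow> 'a tvec"

definition tangent :: "('a, 'e::euclidean_space) atlas \<Rightarrow> 'a \<Rightarrow> 'a tvec set" where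
  "tangent A p = {v. (\<forall>f. f \<notin> Cinf A \<longrightarrow> v f = 0) \<and>
     (\<forall>f\<in>Cinf A. \<forall>h\<in>Cinf A. v (\<lambda>q. f q + h q) = v f + v h \<and> v (\<lambda>q. f q * h q) = f p * v h + h p * v f) \<and>
     (\<forall>c. \<forall>f\<in>Cinf A. v (\<lambda>q. c * f q) = c * v f)}"

definition tadd :: "'a tvec \<Rightarrow> 'a tvec \<Rightarrow> 'a tvec" where
  "tadd v w = (\<lambda>f. v f + w f)"

definition tscale :: "real \<Rightarrow> 'a tvec \<Rightarrow> 'a tvec" where
  "tscale c v = (\<lambda>f. c * v f)"

definition tzero :: "'a tvec" where
  "tzero = (\<lambda>f. 0)"

definition vfields :: "('a, 'e::euclidean_space) atlas \<Rightarrow> 'a vfield set" where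
  "vfields A = {X. (\<forall>p\<in>mcarrier A. X p \<in> tangent A p) \<and> (\<forall>f\<in>Cinf A. (\<lambda>p. X p f) \<in> Cinf A)}"

definition bracket :: "'a vfield \<Rightarrow> 'a vfield \<Rightarrow> 'a vfield" where
  "bracket X Y = (\<lambda>p f. X p (\<lambda>q. Y q f) - Y p (\<lambda>q. X q f))"

definition pushforward :: "('b, 'f::euclidean_space) atlas \<Rightarrow> ('a \<Rightarrow> 'b) \<Rightarrow> 'a tvec \<Rightarrow> 'b tvec" where
  "pushforward B \<phi> v = (\<lambda>f. if f \<in> Cinf B then v (f \<circ> \<phi>) else 0)"

definition is_flow :: "('a, 'e::euclidean_space) atlas \<Rightarrow> 'a vfield \<Rightarrow> (real \<Rightarrow> 'a \<Rightarrow> 'a) \<Rightarrow> bool" where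
  "is_flow A X \<phi> \<longleftrightarrow>
     (\<forall>t. \<forall>p\<in>mcarrier A. \<phi> t p \<in> mcarrier A) \<and>
     (\<forall>f\<in>Cinf A. (\<lambda>(p, t). f (\<phi> t p)) \<in> Cinf (prod_atlas A line_atlas)) \<and>
     (\<forall>p\<in>mcarrier A. \<phi> 0 p = p) \<and>
     (\<forall>f\<in>Cinf A. \<forall>p\<in>mcarrier A. \<forall>t.
        ((\<lambda>s. f (\<phi> s p)) has_real_derivative X (\<phi> t p) f) (at t))"


section \<open>Tensors and differential forms\<close>

definition riemannian_metric ::
    "('a, 'e::euclidean_space) atlas \<Rightarrow> ('a \<Rightarrow> 'a tvec \<Rightarrow> 'a tvec \<Rightarrow> real) \<Rightarrow> bool" where
  "riemannian_metric A g \<longleftrightarrow>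
     (\<forall>p\<in>mcarrier A.
        (\<forall>u\<in>tangent A p. \<forall>v\<in>tangent A p. \<forall>w\<in>tangent A p. g p u (tadd v w) = g p u v + g p u w) \<and>
        (\<forall>c. \<forall>v\<in>tangent A p. \<forall>w\<in>tangent A p. g p v (tscale c w) = c * g p v w) \<and>
        (\<forall>v\<in>tangent A p. \<forall>w\<in>tangent A p. g p v w = g p w v) \<and>
        (\<forall>v\<in>tangent A p. v \<noteq> tzero \<longrightarrow> g p v v > 0)) \<and>
     (\<forall>X\<in>vfields A. \<forall>Y\<in>vfields A. (\<lambda>p. g p (X p) (Y p)) \<in> Cinf A)"

definition one_form :: "('a, 'e::euclidean_space) atlas \<Rightarrow> ('a \<Rightarrow> 'a tvec \<Rightarrow> real) \<Rightarrow> bool" where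
  "one_form A \<eta> \<longleftrightarrow>
     (\<forall>p\<in>mcarrier A.
        (\<forall>v\<in>tangent A p. \<forall>w\<in>tangent A p. \<eta> p (tadd v w) = \<eta> p v + \<eta> p w) \<and>
        (\<forall>c. \<forall>v\<in>tangent A p. \<eta> p (tscale c v) = c * \<eta> p v)) \<and>
     (\<forall>X\<in>vfields A. (\<lambda>p. \<eta> p (X p)) \<in> Cinf A)"

definition endo_field :: "('a, 'e::euclidean_space) atlas \<Rightarrow> ('a \<Rightarrow> 'a tvec \<Rightarrow> 'a tvec) \<Rightarrow> bool" where
  "endo_field A J \<longleftrightarrow>
     (\<forall>p\<in>mcarrier A. \<forall>v\<in>tangent A p. J p v \<in> tangent A p \<and>
        (\<forall>w\<in>tangent A p. J p (tadd v w) = tadd (J p v) (J p w)) \<and>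
        (\<forall>c. J p (tscale c v) = tscale c (J p v))) \<and>
     (\<forall>X\<in>vfields A. (\<lambda>p. J p (X p)) \<in> vfields A)"

text \<open>Complex differential \<open>k\<close>-forms are alternating \<open>Cinf A\<close>-multilinear maps on lists of
  \<open>k\<close> vector fields.\<close>

type_synonym 'a form = "'a vfield list \<Rightarrow> 'a \<Rightarrow> complex"

definition diff_form :: "('a, 'e::euclidean_space) atlas \<Rightarrow> nat \<Rightarrow> 'a form \<Rightarrow> bool" where
  "diff_form A k \<omega> \<longleftrightarrow>
     (\<forall>Xs\<in>lists (vfields A). length Xs = k \<longrightarrow>
        \<omega> Xs \<in> CinfC A \<and>
        (\<forall>i<k. \<forall>X\<in>vfields A. \<forall>Y\<in>vfields A. \<forall>p\<in>mcarrier A.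
           \<omega> (Xs[i := (\<lambda>q. tadd (X q) (Y q))]) p = \<omega> (Xs[i := X]) p + \<omega> (Xs[i := Y]) p) \<and>
        (\<forall>i<k. \<forall>f\<in>Cinf A. \<forall>p\<in>mcarrier A.
           \<omega> (Xs[i := (\<lambda>q. tscale (f q) ((Xs ! i) q))]) p = complex_of_real (f p) * \<omega> Xs p) \<and>
        (\<forall>j<k. \<forall>i<j. Xs ! i = Xs ! j \<longrightarrow> (\<forall>p\<in>mcarrier A. \<omega> Xs p = 0)))"

definition form_of :: "('a \<Rightarrow> 'a tvec \<Rightarrow> real) \<Rightarrow> 'a form" where
  "form_of \<eta> = (\<lambda>Xs p. complex_of_real (\<eta> p (hd Xs p)))"

definition dirderiv :: "'a vfield \<Rightarrow> ('a \<Rightarrow> complex) \<Rightarrow> 'a \<Rightarrow> complex" where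
  "dirderiv X f p = Complex (X p (\<lambda>q. Re (f q))) (X p (\<lambda>q. Im (f q)))"

definition del :: "nat \<Rightarrow> 'b list \<Rightarrow> 'b list" where
  "del i xs = take i xs @ drop (Suc i) xs"

text \<open>The invariant (Koszul) formula, with the normalisation
  \<open>d\<alpha>(X, Y) = X \<alpha>(Y) - Y \<alpha>(X) - \<alpha>([X, Y])\<close>.\<close>

definition ext_deriv :: "'a form \<Rightarrow> 'a form" where
  "ext_deriv \<omega> = (\<lambda>Xs p.
     (\<Sum>i<length Xs. (-1) ^ i * dirderiv (Xs ! i) (\<omega> (del i Xs)) p) +
     (\<Sum>j<length Xs. \<Sum>i<j. (-1) ^ (i + j) * \<omega> (bracket (Xs ! i) (Xs ! j) # del i (del j Xs)) p))"

text \<open>Up to a positive combinatorial factor, \<open>contact_volume\<close> is the evaluation of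
  \<open>\<eta> \<and> (d\<eta>)\<^sup>n\<close> on \<open>2 * n + 1\<close> vector fields.\<close>

definition contact_volume :: "('a \<Rightarrow> 'a tvec \<Rightarrow> real) \<Rightarrow> nat \<Rightarrow> 'a vfield list \<Rightarrow> 'a \<Rightarrow> complex" where
  "contact_volume \<eta> n Xs p = (\<Sum>\<sigma> | \<sigma> permutes {..<2 * n + 1}.
     of_int (sign \<sigma>) * form_of \<eta> [Xs ! \<sigma> 0] p *
     (\<Prod>i<n. ext_deriv (form_of \<eta>) [Xs ! \<sigma> (2 * i + 1), Xs ! \<sigma> (2 * i + 2)] p))"

definition contact_form :: "('a, 'e::euclidean_space) atlas \<Rightarrow> ('a \<Rightarrow> 'a tvec \<Rightarrow> real) \<Rightarrow> bool" where
  "contact_form A \<eta> \<longleftrightarrow> one_form A \<eta> \<and> odd DIM('e) \<and>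
     (\<forall>p\<in>mcarrier A. \<exists>Xs\<in>lists (vfields A). length Xs = DIM('e) \<and>
        contact_volume \<eta> (DIM('e) div 2) Xs p \<noteq> 0)"

definition reeb_field ::
    "('a, 'e::euclidean_space) atlas \<Rightarrow> ('a \<Rightarrow> 'a tvec \<Rightarrow> real) \<Rightarrow> 'a vfield \<Rightarrow> bool" where
  "reeb_field A \<eta> \<xi> \<longleftrightarrow> \<xi> \<in> vfields A \<and>
     (\<forall>p\<in>mcarrier A. \<eta> p (\<xi> p) = 1) \<and>
     (\<forall>X\<in>vfields A. \<forall>p\<in>mcarrier A. ext_deriv (form_of \<eta>) [\<xi>, X] p = 0)"


section \<open>Kaehler and Sasakian structures\<close>

definition nijenhuis :: "('a \<Rightarrow> 'a tvec \<Rightarrow> 'a tvec) \<Rightarrow> 'a vfield \<Rightarrow> 'a vfield \<Rightarrow> 'a vfield" where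
  "nijenhuis J X Y = (\<lambda>p f.
     bracket (\<lambda>q. J q (X q)) (\<lambda>q. J q (Y q)) p f - J p (bracket (\<lambda>q. J q (X q)) Y p) f
     - J p (bracket X (\<lambda>q. J q (Y q)) p) f - bracket X Y p f)"

definition complex_structure ::
    "('a, 'e::euclidean_space) atlas \<Rightarrow> ('a \<Rightarrow> 'a tvec \<Rightarrow> 'a tvec) \<Rightarrow> bool" where
  "complex_structure A J \<longleftrightarrow> endo_field A J \<and>
     (\<forall>p\<in>mcarrier A. \<forall>v\<in>tangent A p. J p (J p v) = tscale (-1) v) \<and>
     (\<forall>X\<in>vfields A. \<forall>Y\<in>vfields A. \<forall>p\<in>mcarrier A. nijenhuis J X Y p = tzero)"

text \<open>The sign convention \<open>\<omega>(X, Y) = g(X, J Y)\<close> is the one that restricts to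
  \<open>d\<eta>(X, Y) = g(X, J Y)\<close> on a Sasakian manifold.\<close>

definition kaehler ::
    "('a, 'e::euclidean_space) atlas \<Rightarrow> ('a \<Rightarrow> 'a tvec \<Rightarrow> 'a tvec \<Rightarrow> real) \<Rightarrow>
     ('a \<Rightarrow> 'a tvec \<Rightarrow> 'a tvec) \<Rightarrow> 'a form \<Rightarrow> bool" where
  "kaehler A g J \<omega> \<longleftrightarrow> riemannian_metric A g \<and> complex_structure A J \<and>
     (\<forall>p\<in>mcarrier A. \<forall>v\<in>tangent A p. \<forall>w\<in>tangent A p. g p (J p v) (J p w) = g p v w) \<and>
     (\<forall>X\<in>vfields A. \<forall>Y\<in>vfields A. \<forall>p\<in>mcarrier A.
        \<omega> [X, Y] p = complex_of_real (g p (X p) (J p (Y p)))) \<and>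
     (\<forall>X\<in>vfields A. \<forall>Y\<in>vfields A. \<forall>Z\<in>vfields A. \<forall>p\<in>mcarrier A. ext_deriv \<omega> [X, Y, Z] p = 0)"

definition cone_atlas :: "('a, 'e) atlas \<Rightarrow> ('a \<times> real, 'e \<times> real) atlas" where
  "cone_atlas A = prod_atlas A half_line_atlas"

text \<open>The metric \<open>r\<^sup>2 g + dr \<otimes> dr\<close>; the number \<open>v snd\<close> is \<open>dr(v)\<close>.\<close>

definition cone_metric ::
    "('a, 'e::euclidean_space) atlas \<Rightarrow> ('a \<Rightarrow> 'a tvec \<Rightarrow> 'a tvec \<Rightarrow> real) \<Rightarrow>
     ('a \<times> real \<Rightarrow> ('a \<times> real) tvec \<Rightarrow> ('a \<times> real) tvec \<Rightarrow> real)" where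
  "cone_metric A g = (\<lambda>(p, r) v w. r\<^sup>2 * g p (pushforward A fst v) (pushforward A fst w) + v snd * w snd)"

text \<open>The one-form \<open>r\<^sup>2 \<eta>\<close>.\<close>

definition cone_form ::
    "('a, 'e::euclidean_space) atlas \<Rightarrow> ('a \<Rightarrow> 'a tvec \<Rightarrow> real) \<Rightarrow> ('a \<times> real \<Rightarrow> ('a \<times> real) tvec \<Rightarrow> real)" where
  "cone_form A \<eta> = (\<lambda>(p, r) v. r\<^sup>2 * \<eta> p (pushforward A fst v))"

text \<open>The Kaehler form is exactly \<open>d(r\<^sup>2 \<eta>)\<close>. With the present normalisation of \<open>d\<close> this forces
  the Reeb field of \<open>\<eta>\<close> to have constant \<open>g\<close>-length 2: the pair \<open>(g, \<eta>)\<close> is Sasakian in this sense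
  iff \<open>(g, 2 \<eta>)\<close> is Sasakian in the convention with Kaehler form \<open>d(r\<^sup>2 \<eta>) / 2\<close> and a unit Reeb field.
  The underlying transversely Kaehler structure is the same.\<close>

definition sasakian ::
    "('a, 'e::euclidean_space) atlas \<Rightarrow> ('a \<Rightarrow> 'a tvec \<Rightarrow> 'a tvec \<Rightarrow> real) \<Rightarrow>
     ('a \<Rightarrow> 'a tvec \<Rightarrow> real) \<Rightarrow> bool" where
  "sasakian A g \<eta> \<longleftrightarrow> riemannian_metric A g \<and> contact_form A \<eta> \<and>
     (\<exists>J. kaehler (cone_atlas A) (cone_metric A g) J (ext_deriv (form_of (cone_form A \<eta>))))"


section \<open>Flows, basic forms and the basic Euler class\<close>

text \<open>A one-dimensional foliation is given by its tangent line field.\<close>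

type_synonym 'a linefield = "'a \<Rightarrow> 'a tvec set"

definition orbit_foliation :: "'a vfield \<Rightarrow> 'a linefield" where
  "orbit_foliation \<xi> = (\<lambda>p. range (\<lambda>c. tscale c (\<xi> p)))"

definition tangent_fields :: "('a, 'e::euclidean_space) atlas \<Rightarrow> 'a linefield \<Rightarrow> 'a vfield set" where
  "tangent_fields A F = {X \<in> vfields A. \<forall>p\<in>mcarrier A. X p \<in> F p}"

text \<open>The projection to \<open>ker \<eta>\<close> along \<open>\<xi>\<close>, and the metric on \<open>TM / TF\<close> induced by \<open>g\<close> via
  \<open>TM / TF \<cong> ker \<eta>\<close>, seen as a degenerate symmetric form on \<open>TM\<close>.\<close>

definition horizontal :: "('a \<Rightarrow> 'a tvec \<Rightarrow> real) \<Rightarrow> 'a vfield \<Rightarrow> 'a \<Rightarrow> 'a tvec \<Rightarrow> 'a tvec" where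
  "horizontal \<eta> \<xi> p v = tadd v (tscale (- \<eta> p v) (\<xi> p))"

definition transverse_metric ::
    "('a \<Rightarrow> 'a tvec \<Rightarrow> 'a tvec \<Rightarrow> real) \<Rightarrow> ('a \<Rightarrow> 'a tvec \<Rightarrow> real) \<Rightarrow> 'a vfield \<Rightarrow>
     'a \<Rightarrow> 'a tvec \<Rightarrow> 'a tvec \<Rightarrow> real" where
  "transverse_metric g \<eta> \<xi> p v w = g p (horizontal \<eta> \<xi> p v) (horizontal \<eta> \<xi> p w)"

text \<open>A transverse almost complex structure on \<open>TM / TF\<close> is represented by an endomorphism field of
  \<open>TM\<close> that induces it; only the class of \<open>J p v\<close> modulo \<open>F p\<close> is relevant.\<close>

definition transverse_almost_complex ::
    "('a, 'e::euclidean_space) atlas \<Rightarrow> 'a linefield \<Rightarrow> ('a \<Rightarrow> 'a tvec \<Rightarrow> 'a tvec) \<Rightarrow> bool" where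
  "transverse_almost_complex A F J \<longleftrightarrow> endo_field A J \<and>
     (\<forall>p\<in>mcarrier A. \<forall>v\<in>F p. J p v \<in> F p) \<and>
     (\<forall>p\<in>mcarrier A. \<forall>v\<in>tangent A p. tadd (J p (J p v)) v \<in> F p)"

text \<open>The condition \<open>d\<eta>(X, Y) = g\<^sub>\<nu>(X, J Y)\<close> determines \<open>J\<close> on \<open>TM / TF\<close>. That \<open>J\<close> is invariant
  along the flow and transversely integrable is then a consequence and not assumed.\<close>

definition underlying_transverse_complex ::
    "('a, 'e::euclidean_space) atlas \<Rightarrow> ('a \<Rightarrow> 'a tvec \<Rightarrow> 'a tvec \<Rightarrow> real) \<Rightarrow>
     ('a \<Rightarrow> 'a tvec \<Rightarrow> real) \<Rightarrow> 'a vfield \<Rightarrow> ('a \<Rightarrow> 'a tvec \<Rightarrow> 'a tvec) \<Rightarrow> bool" where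
  "underlying_transverse_complex A g \<eta> \<xi> J \<longleftrightarrow>
     transverse_almost_complex A (orbit_foliation \<xi>) J \<and>
     (\<forall>X\<in>vfields A. \<forall>Y\<in>vfields A. \<forall>p\<in>mcarrier A.
        ext_deriv (form_of \<eta>) [X, Y] p =
        complex_of_real (transverse_metric g \<eta> \<xi> p (X p) (J p (Y p))))"

text \<open>On a closed manifold every vector field has exactly one (global) flow, so that the
  quantifier over \<open>\<phi>\<close> ranges over a singleton.\<close>

definition killing_pair ::
    "('a, 'e::euclidean_space) atlas \<Rightarrow> 'a linefield \<Rightarrow>
     ('a \<Rightarrow> 'a tvec \<Rightarrow> 'a tvec \<Rightarrow> real) \<Rightarrow> 'a vfield \<Rightarrow> bool" where
  "killing_pair A F g \<xi> \<longleftrightarrow> riemannian_metric A g \<and> \<xi> \<in> tangent_fields A F \<and>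
     (\<forall>p\<in>mcarrier A. \<xi> p \<noteq> tzero) \<and>
     (\<forall>\<phi>. is_flow A \<xi> \<phi> \<longrightarrow>
        (\<forall>t. \<forall>p\<in>mcarrier A. \<forall>v\<in>tangent A p. \<forall>w\<in>tangent A p.
           g (\<phi> t p) (pushforward A (\<phi> t) v) (pushforward A (\<phi> t) w) = g p v w)) \<and>
     (\<forall>p\<in>mcarrier A. g p (\<xi> p) (\<xi> p) = 1)"

definition characteristic_form ::
    "('a \<Rightarrow> 'a tvec \<Rightarrow> 'a tvec \<Rightarrow> real) \<Rightarrow> 'a vfield \<Rightarrow> 'a \<Rightarrow> 'a tvec \<Rightarrow> real" where
  "characteristic_form g \<xi> = (\<lambda>p v. g p (\<xi> p) v)"

definition basic_form :: "('a, 'e::euclidean_space) atlas \<Rightarrow> 'a linefield \<Rightarrow> nat \<Rightarrow> 'a form \<Rightarrow> bool" where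
  "basic_form A F k \<omega> \<longleftrightarrow> diff_form A k \<omega> \<and>
     (\<forall>X\<in>tangent_fields A F. \<forall>Ys\<in>lists (vfields A). \<forall>p\<in>mcarrier A.
        (Suc (length Ys) = k \<longrightarrow> \<omega> (X # Ys) p = 0) \<and>
        (length Ys = k \<longrightarrow> ext_deriv \<omega> (X # Ys) p = 0))"

text \<open>For a basic \<open>\<omega>\<close>, the \<open>(0,q)\<close>-part is obtained by inserting into the complex multilinear
  extension of \<open>\<omega>\<close> the \<open>(0,1)\<close>-parts \<open>(X + \<i> J X) / 2\<close> of its arguments, where \<open>q\<close> is the degree.\<close>

definition antiholo_part :: "('a \<Rightarrow> 'a tvec \<Rightarrow> 'a tvec) \<Rightarrow> 'a form \<Rightarrow> 'a form" where
  "antiholo_part J \<omega> = (\<lambda>Xs p. \<Sum>S\<in>Pow {..<length Xs}.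
     \<i> ^ card S / 2 ^ length Xs *
     \<omega> (map (\<lambda>i. if i \<in> S then (\<lambda>q. J q ((Xs ! i) q)) else Xs ! i) [0..<length Xs]) p)"

text \<open>Basic \<open>(0,q)\<close>-forms: those that vanish when an argument is of the form \<open>X - \<i> J X\<close>.\<close>

definition basic_0q_form ::
    "('a, 'e::euclidean_space) atlas \<Rightarrow> 'a linefield \<Rightarrow> ('a \<Rightarrow> 'a tvec \<Rightarrow> 'a tvec) \<Rightarrow>
     nat \<Rightarrow> 'a form \<Rightarrow> bool" where
  "basic_0q_form A F J q \<omega> \<longleftrightarrow> basic_form A F q \<omega> \<and>
     (\<forall>Xs\<in>lists (vfields A). length Xs = q \<longrightarrow>
        (\<forall>i<q. \<forall>p\<in>mcarrier A. \<omega> Xs p - \<i> * \<omega> (Xs[i := (\<lambda>y. J y ((Xs ! i) y))]) p = 0))"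

definition dbar :: "('a \<Rightarrow> 'a tvec \<Rightarrow> 'a tvec) \<Rightarrow> 'a form \<Rightarrow> 'a form" where
  "dbar J \<omega> = antiholo_part J (ext_deriv \<omega>)"

text \<open>The form \<open>\<omega>\<close> is a cocycle of degree 2 in the complex of basic \<open>(0,q)\<close>-forms, and its class
  in the cohomology of that complex is zero.\<close>

definition zero_in_H02b ::
    "('a, 'e::euclidean_space) atlas \<Rightarrow> 'a linefield \<Rightarrow> ('a \<Rightarrow> 'a tvec \<Rightarrow> 'a tvec) \<Rightarrow> 'a form \<Rightarrow> bool" where
  "zero_in_H02b A F J \<omega> \<longleftrightarrow> basic_0q_form A F J 2 \<omega> \<and>
     (\<forall>X\<in>vfields A. \<forall>Y\<in>vfields A. \<forall>Z\<in>vfields A. \<forall>p\<in>mcarrier A. dbar J \<omega> [X, Y, Z] p = 0) \<and>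
     (\<exists>\<beta>. basic_0q_form A F J 1 \<beta> \<and>
        (\<forall>X\<in>vfields A. \<forall>Y\<in>vfields A. \<forall>p\<in>mcarrier A. \<omega> [X, Y] p = dbar J \<beta> [X, Y] p))"

text \<open>The flow \<open>F\<close> is isometric and its basic Euler class, represented by \<open>d\<eta>'\<close> for a Killing
  pair with characteristic form \<open>\<eta>'\<close>, is of degree (1,1). The vanishing of the class of the
  \<open>(0,2)\<close>-part of \<open>d\<eta>'\<close> does not depend on the Killing pair used to represent the Euler class.\<close>

definition basic_Euler_class_degree_11 ::
    "('a, 'e::euclidean_space) atlas \<Rightarrow> 'a linefield \<Rightarrow> ('a \<Rightarrow> 'a tvec \<Rightarrow> 'a tvec) \<Rightarrow> bool" where
  "basic_Euler_class_degree_11 A F J \<longleftrightarrow>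
     (\<exists>g' \<xi>'. killing_pair A F g' \<xi>' \<and>
        basic_form A F 2 (ext_deriv (form_of (characteristic_form g' \<xi>'))) \<and>
        zero_in_H02b A F J
          (antiholo_part J (ext_deriv (form_of (characteristic_form g' \<xi>')))))"

end

(* For the Killing pair (g/4, xi) the characteristic form is eta itself, since g(xi, .) = 4 eta in the
   present normalisation, and d eta (X, Y) = g_nu(X, J Y) forces
   d eta (J X, J Y) = d eta (X, Y), so that the (0,2)-part of d eta vanishes identically.

   That xi is a Killing field is read off the cone. With E = r d/dr and the complex structure I, the
   formula omega = d(r^2 eta) gives I xi = 2 E. Cartan's formula and d omega = 0 yield L_E omega = 2 omega and
   L_xi omega = 0; evaluating the first on I X for a lift X gives [E, I X] = 0, the vanishing of the
   Nijenhuis tensor on (E, X) turns this into [xi, I X] = I [xi, X], and together with L_xi omega = 0 this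
   is L_xi g = 0. *)

theory Submission
  imports Defs
begin

section \<open>Smooth functions on Euclidean spaces\<close>

text \<open>Tangent vectors are derivations of globally defined smooth functions, so before any
  geometry they must be shown to be local and to have coordinates. Cutoff functions give locality,
  Hadamard's lemma gives the expansion in a chart, and charts then give way to global functions and
  fields that are coordinates only near a point.

  The factor 4: at r = 1 the field E has length 1, and I is an isometry with I xi = 2 E, so g(xi,
  xi) = 4.

  The equation L_xi g = 0 concerns vector fields, whereas a Killing pair demands that each flow map
  be an isometry on single tangent vectors. Vectors transported by the flow are not values of a
  fixed field, so the passage is made with components in a local frame, and it needs a time
  derivative to pass under a derivation. That interchange, and the fact that E commutes with lifts,
  both rest on the symmetry of second derivatives.

  All objects are constrained only on the carrier and on genuine vector fields. Hence "equal" and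
  "zero" mean equal or zero there, and every derivative must be shown insensitive to values
  elsewhere. The (0,2)-part is zero in this sense, and its primitive is the zero form.\<close>

lemma Ck_on_Suc_I:
  assumes "\<And>x. x \<in> S \<Longrightarrow> (f has_derivative f' x) (at x)"
    and "\<And>v. Ck_on k S (\<lambda>x. f' x v)"
  shows "Ck_on (Suc k) S f"
  unfolding Ck_on.simps using assms by blast

lemma Ck_on_Suc_E:
  assumes "Ck_on (Suc k) S f"
  obtains f' where "\<And>x. x \<in> S \<Longrightarrow> (f has_derivative f' x) (at x)"
    "\<And>v. Ck_on k S (\<lambda>x. f' x v)"
  using assms unfolding Ck_on.simps by blast

declare Ck_on.simps(2) [simp del]

lemma Ck_on_differentiable: "Ck_on (Suc k) S f \<Longrightarrow> x \<in> S \<Longrightarrow> f differentiable (at x)"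
  unfolding Ck_on.simps differentiable_def by blast

lemma Ck_on_subset: "Ck_on k S f \<Longrightarrow> T \<subseteq> S \<Longrightarrow> Ck_on k T f"
proof (induction k arbitrary: f)
  case 0
  then show ?case by (auto intro: continuous_on_subset)
next
  case (Suc k)
  obtain f' where "\<And>x. x \<in> S \<Longrightarrow> (f has_derivative f' x) (at x)" "\<And>v. Ck_on k S (\<lambda>x. f' x v)"
    using Suc.prems(1) by (rule Ck_on_Suc_E) blast
  with Suc.IH Suc.prems(2) show ?case by (intro Ck_on_Suc_I[where f'=f']) blast+
qed

lemma Ck_on_lower: "Ck_on (Suc k) S f \<Longrightarrow> Ck_on k S f"
proof (induction k arbitrary: f)
  case 0
  then show ?case
    by (auto elim!: Ck_on_Suc_E intro!: continuous_at_imp_continuous_on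
        dest: has_derivative_continuous)
next
  case (Suc k)
  obtain f' where "\<And>x. x \<in> S \<Longrightarrow> (f has_derivative f' x) (at x)" "\<And>v. Ck_on (Suc k) S (\<lambda>x. f' x v)"
    using Suc.prems by (rule Ck_on_Suc_E) blast
  with Suc.IH show ?case by (intro Ck_on_Suc_I[where f'=f']) blast+
qed

lemma Ck_on_cong:
  assumes "open S" "\<And>x. x \<in> S \<Longrightarrow> f x = g x" "Ck_on k S f"
  shows "Ck_on k S g"
proof (cases k)
  case 0
  with assms show ?thesis using continuous_on_cong[of S S f g] by auto
next
  case (Suc l)
  have "Ck_on (Suc l) S f" using assms(3) Suc by simp
  then obtain f' where f': "\<And>x. x \<in> S \<Longrightarrow> (f has_derivative f' x) (at x)" "\<And>v. Ck_on l S (\<lambda>x. f' x v)"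
    by (rule Ck_on_Suc_E) blast
  show ?thesis unfolding Suc
  proof (rule Ck_on_Suc_I[where f'=f'])
    fix x assume "x \<in> S"
    with f' assms(1,2) show "(g has_derivative f' x) (at x)"
      by (blast intro: has_derivative_transform_within_open)
  qed (use f' in auto)
qed

text \<open>The witness \<open>f'\<close> in \<open>Ck_on\<close> is arbitrary off \<open>S\<close>,
  but at points of \<open>S\<close> it is the unique derivative, so the canonical choice can replace
  it and the existential disappears.\<close>

lemma Ck_on_frechet:
  assumes "open S" "Ck_on (Suc k) S f"
  shows "Ck_on k S (\<lambda>x. frechet_derivative f (at x) v)"
proof -
  obtain f' where f': "\<And>x. x \<in> S \<Longrightarrow> (f has_derivative f' x) (at x)" "\<And>v. Ck_on k S (\<lambda>x. f' x v)"
    using assms(2) by (rule Ck_on_Suc_E) blast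
  show ?thesis
    by (rule Ck_on_cong[OF assms(1) _ f'(2)[of v]])
      (use f'(1) frechet_derivative_at in metis)
qed

text \<open>Derivatives found on different neighbourhoods need not come from one function;
  \<open>frechet_derivative\<close> is a global choice that agrees with all of them, so the
  induction can pass to derivatives.\<close>

lemma Ck_on_local:
  assumes "\<And>x. x \<in> S \<Longrightarrow> \<exists>T. open T \<and> x \<in> T \<and> Ck_on k T f"
  shows "Ck_on k S f"
  using assms
proof (induction k arbitrary: f)
  case 0
  show ?case
  proof (simp, rule continuous_at_imp_continuous_on, rule ballI)
    fix x assume "x \<in> S"
    with 0[of x] obtain T where "open T" "x \<in> T" "continuous_on T f" by (auto simp only: Ck_on.simps)
    then show "continuous (at x) f" using continuous_on_eq_continuous_at by blast
  qed
next
  case (Suc k)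
  show ?case
  proof (rule Ck_on_Suc_I[where f'="\<lambda>x. frechet_derivative f (at x)"])
    fix x assume "x \<in> S"
    with Suc.prems obtain T where "open T" "x \<in> T" "Ck_on (Suc k) T f" by blast
    then have "f differentiable (at x)" using Ck_on_differentiable by blast
    then show "(f has_derivative frechet_derivative f (at x)) (at x)"
      using frechet_derivative_works by blast
  next
    fix v show "Ck_on k S (\<lambda>x. frechet_derivative f (at x) v)"
    proof (rule Suc.IH)
      fix x assume "x \<in> S"
      with Suc.prems obtain T where "open T" "x \<in> T" "Ck_on (Suc k) T f" by blast
      then show "\<exists>T. open T \<and> x \<in> T \<and> Ck_on k T (\<lambda>x. frechet_derivative f (at x) v)"
        using Ck_on_frechet[of T k f v] by (intro exI[of _ T]) simp
    qed
  qed
qed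

lemma smooth_on_subset: "smooth_on S f \<Longrightarrow> T \<subseteq> S \<Longrightarrow> smooth_on T f"
  unfolding smooth_on_def using Ck_on_subset by blast

lemma smooth_on_cong:
  "smooth_on S f \<Longrightarrow> open S \<Longrightarrow> (\<And>x. x \<in> S \<Longrightarrow> f x = g x) \<Longrightarrow> smooth_on S g"
  unfolding smooth_on_def using Ck_on_cong[of S f g] by blast

lemma smooth_on_local:
  assumes "\<And>x. x \<in> S \<Longrightarrow> \<exists>T. open T \<and> x \<in> T \<and> smooth_on T f"
  shows "smooth_on S f"
  unfolding smooth_on_def
proof
  fix k show "Ck_on k S f"
    by (rule Ck_on_local) (use assms[unfolded smooth_on_def] in blast)
qed

lemma smooth_on_frechet:
  "smooth_on S f \<Longrightarrow> open S \<Longrightarrow> smooth_on S (\<lambda>x. frechet_derivative f (at x) v)"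
  unfolding smooth_on_def using Ck_on_frechet by blast

lemma smooth_on_has_derivative:
  assumes "smooth_on S f" "x \<in> S"
  shows "(f has_derivative frechet_derivative f (at x)) (at x)"
proof -
  have "Ck_on (Suc 0) S f" using assms unfolding smooth_on_def by blast
  then have "f differentiable (at x)" using assms(2) Ck_on_differentiable by blast
  then show ?thesis using frechet_derivative_works by blast
qed

lemma smooth_on_imp_continuous_on: "smooth_on S f \<Longrightarrow> continuous_on S f"
  unfolding smooth_on_def by (drule spec[of _ 0]) simp

section \<open>Closure properties of smooth functions\<close>

lemma Ck_on_const: "Ck_on k S (\<lambda>x. c)"
proof (induction k arbitrary: c)
  case (Suc k)
  show ?case by (rule Ck_on_Suc_I[where f'="\<lambda>x v. 0"]) (auto simp: Suc)
qed simp

lemma Ck_on_add: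
  "Ck_on k S f \<Longrightarrow> Ck_on k S g \<Longrightarrow> Ck_on k S (\<lambda>x. f x + g x)"
proof (induction k arbitrary: f g)
  case 0
  then show ?case by (simp add: continuous_on_add)
next
  case (Suc k)
  obtain f' where f': "\<And>x. x \<in> S \<Longrightarrow> (f has_derivative f' x) (at x)" "\<And>v. Ck_on k S (\<lambda>x. f' x v)"
    using Suc.prems(1) by (rule Ck_on_Suc_E) blast
  obtain g' where g': "\<And>x. x \<in> S \<Longrightarrow> (g has_derivative g' x) (at x)" "\<And>v. Ck_on k S (\<lambda>x. g' x v)"
    using Suc.prems(2) by (rule Ck_on_Suc_E) blast
  show ?case
    by (rule Ck_on_Suc_I[where f'="\<lambda>x v. f' x v + g' x v"])
      (intro has_derivative_add Suc.IH f' g' | assumption)+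
qed

lemma Ck_on_linear:
  assumes "bounded_linear L"
  shows "Ck_on k S f \<Longrightarrow> Ck_on k S (\<lambda>x. L (f x))"
proof (induction k arbitrary: f)
  case 0
  then show ?case using bounded_linear.continuous_on[OF assms] by auto
next
  case (Suc k)
  obtain f' where f': "\<And>x. x \<in> S \<Longrightarrow> (f has_derivative f' x) (at x)" "\<And>v. Ck_on k S (\<lambda>x. f' x v)"
    using Suc.prems(1) by (rule Ck_on_Suc_E) blast
  show ?case
    by (rule Ck_on_Suc_I[where f'="\<lambda>x v. L (f' x v)"])
      (intro bounded_linear.has_derivative[OF assms] Suc.IH f' | assumption)+
qed

lemma Ck_on_bilinear:
  assumes "bounded_bilinear B"
  shows "Ck_on k S f \<Longrightarrow> Ck_on k S g \<Longrightarrow> Ck_on k S (\<lambda>x. B (f x) (g x))"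
proof (induction k arbitrary: f g)
  case 0
  then show ?case using bounded_bilinear.continuous_on[OF assms] by auto
next
  case (Suc k)
  obtain f' where f': "\<And>x. x \<in> S \<Longrightarrow> (f has_derivative f' x) (at x)" "\<And>v. Ck_on k S (\<lambda>x. f' x v)"
    using Suc.prems(1) by (rule Ck_on_Suc_E) blast
  obtain g' where g': "\<And>x. x \<in> S \<Longrightarrow> (g has_derivative g' x) (at x)" "\<And>v. Ck_on k S (\<lambda>x. g' x v)"
    using Suc.prems(2) by (rule Ck_on_Suc_E) blast
  have fg: "Ck_on k S f" "Ck_on k S g" using Suc.prems Ck_on_lower by blast+
  show ?case
    by (rule Ck_on_Suc_I[where f'="\<lambda>x v. B (f x) (g' x v) + B (f' x v) (g x)"])
      (intro bounded_bilinear.FDERIV[OF assms] Ck_on_add Suc.IH f' g' fg | assumption)+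
qed

lemma Ck_on_sum:
  "(\<And>i. i \<in> I \<Longrightarrow> Ck_on k S (f i)) \<Longrightarrow> Ck_on k S (\<lambda>x. \<Sum>i\<in>I. f i x)"
  by (induction I rule: infinite_finite_induct) (auto simp: Ck_on_const Ck_on_add)

lemma Ck_on_compose:
  fixes g :: "'b::euclidean_space \<Rightarrow> 'd::euclidean_space"
  shows "Ck_on k T f \<Longrightarrow> Ck_on k S g \<Longrightarrow> g ` S \<subseteq> T \<Longrightarrow> Ck_on k S (\<lambda>x. f (g x))"
proof (induction k arbitrary: f)
  case 0
  then show ?case using continuous_on_compose2[of T f S g] by auto
next
  case (Suc k)
  obtain f' where f': "\<And>x. x \<in> T \<Longrightarrow> (f has_derivative f' x) (at x)"
      "\<And>v. Ck_on k T (\<lambda>x. f' x v)"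
    using Suc.prems(1) by (rule Ck_on_Suc_E) blast
  obtain g' where g': "\<And>x. x \<in> S \<Longrightarrow> (g has_derivative g' x) (at x)"
      "\<And>v. Ck_on k S (\<lambda>x. g' x v)"
    using Suc.prems(2) by (rule Ck_on_Suc_E) blast
  have gk: "Ck_on k S g" using Suc.prems Ck_on_lower by blast
  show ?case
  \<comment> \<open>The chain rule gives \<open>f' (g x) (g' x v)\<close>, whose direction moves
    with \<open>x\<close>, while \<open>Ck_on\<close> controls \<open>f'\<close> in fixed directions
    only; hence the expansion over \<open>Basis\<close>.\<close>
  proof (rule Ck_on_Suc_I[where f'="\<lambda>x v. \<Sum>b\<in>Basis. (g' x v \<bullet> b) *\<^sub>R f' (g x) b"])
    fix x assume x: "x \<in> S"
    then have "g x \<in> T" using Suc.prems by auto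
    from has_derivative_compose[OF g'(1)[OF x] f'(1)[OF this]]
    have "((\<lambda>x. f (g x)) has_derivative (\<lambda>v. f' (g x) (g' x v))) (at x)" .
    moreover have "f' (g x) (g' x v) = (\<Sum>b\<in>Basis. (g' x v \<bullet> b) *\<^sub>R f' (g x) b)" for v
    proof -
      have l: "linear (f' (g x))"
        using f'(1)[OF \<open>g x \<in> T\<close>] has_derivative_linear by blast
      have "f' (g x) (g' x v) = f' (g x) (\<Sum>b\<in>Basis. (g' x v \<bullet> b) *\<^sub>R b)"
        by (simp add: euclidean_representation)
      also have "\<dots> = (\<Sum>b\<in>Basis. (g' x v \<bullet> b) *\<^sub>R f' (g x) b)"
        using l by (simp add: linear_sum linear_cmul)
      finally show ?thesis .
    qed
    ultimately show "((\<lambda>x. f (g x)) has_derivative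
        (\<lambda>v. \<Sum>b\<in>Basis. (g' x v \<bullet> b) *\<^sub>R f' (g x) b)) (at x)" by simp
  next
    fix v
    show "Ck_on k S (\<lambda>x. \<Sum>b\<in>Basis. (g' x v \<bullet> b) *\<^sub>R f' (g x) b)"
      by (intro Ck_on_sum Ck_on_bilinear[OF bounded_bilinear_scaleR]
          Ck_on_linear[OF bounded_linear_inner_left] g' Suc.IH f' gk Suc.prems)
  qed
qed

lemma smooth_on_const: "smooth_on S (\<lambda>x. c)"
  unfolding smooth_on_def using Ck_on_const by blast

lemma smooth_on_add: "smooth_on S f \<Longrightarrow> smooth_on S g \<Longrightarrow> smooth_on S (\<lambda>x. f x + g x)"
  unfolding smooth_on_def using Ck_on_add by blast

lemma smooth_on_linear: "bounded_linear L \<Longrightarrow> smooth_on S f \<Longrightarrow> smooth_on S (\<lambda>x. L (f x))"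
  unfolding smooth_on_def using Ck_on_linear by blast

lemma smooth_on_mult:
  fixes f g :: "'b::euclidean_space \<Rightarrow> real"
  shows "smooth_on S f \<Longrightarrow> smooth_on S g \<Longrightarrow> smooth_on S (\<lambda>x. f x * g x)"
  unfolding smooth_on_def using Ck_on_bilinear[OF bounded_bilinear_mult] by blast

lemma smooth_on_inner:
  "smooth_on S f \<Longrightarrow> smooth_on S g \<Longrightarrow> smooth_on S (\<lambda>x. f x \<bullet> g x)"
  unfolding smooth_on_def using Ck_on_bilinear[OF bounded_bilinear_inner] by blast

lemma smooth_on_sum:
  "(\<And>i. i \<in> I \<Longrightarrow> smooth_on S (f i)) \<Longrightarrow> smooth_on S (\<lambda>x. \<Sum>i\<in>I. f i x)"
  unfolding smooth_on_def by (intro allI Ck_on_sum) blast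

lemma smooth_on_compose:
  fixes g :: "'b::euclidean_space \<Rightarrow> 'd::euclidean_space"
  shows "smooth_on T f \<Longrightarrow> smooth_on S g \<Longrightarrow> g ` S \<subseteq> T \<Longrightarrow> smooth_on S (\<lambda>x. f (g x))"
  unfolding smooth_on_def using Ck_on_compose by blast

lemma smooth_on_id: "smooth_on S (\<lambda>x. x)"
  unfolding smooth_on_def
proof
  fix k show "Ck_on k S (\<lambda>x. x)"
  proof (cases k)
    case (Suc l)
    show ?thesis unfolding Suc by (rule Ck_on_Suc_I[where f'="\<lambda>x v. v"]) (auto simp: Ck_on_const)
  qed simp
qed

lemma smooth_on_diff:
  "smooth_on S f \<Longrightarrow> smooth_on S g \<Longrightarrow> smooth_on S (\<lambda>x. f x - g x)"
  using smooth_on_add[of S f "\<lambda>x. - g x"] smooth_on_linear[OF bounded_linear_minus[OF bounded_linear_ident], of S g]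
  by simp

lemma smooth_on_fst: "smooth_on S f \<Longrightarrow> smooth_on S (\<lambda>x. fst (f x))"
  by (rule smooth_on_linear[OF bounded_linear_fst])

lemma smooth_on_snd: "smooth_on S f \<Longrightarrow> smooth_on S (\<lambda>x. snd (f x))"
  by (rule smooth_on_linear[OF bounded_linear_snd])

lemma smooth_on_Pair:
  assumes "smooth_on S f" "smooth_on S g"
  shows "smooth_on S (\<lambda>x. (f x, g x))"
proof -
  have "smooth_on S (\<lambda>x. (f x, 0) + (0, g x))"
    by (intro smooth_on_add
        smooth_on_linear[OF bounded_linear_Pair[OF bounded_linear_ident bounded_linear_zero]]
        smooth_on_linear[OF bounded_linear_Pair[OF bounded_linear_zero bounded_linear_ident]] assms)
  then show ?thesis by simp
qed

lemma smooth_on_inverse: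
  "smooth_on {0<..} (inverse :: real \<Rightarrow> real)"
  unfolding smooth_on_def
proof
  fix k show "Ck_on k {0<..} (inverse :: real \<Rightarrow> real)"
  proof (induction k)
    case 0
    show ?case by (auto intro!: continuous_intros)
  next
    case (Suc k)
    show ?case
    \<comment> \<open>The derivative of \<open>inverse\<close> is written as a polynomial in
      \<open>inverse\<close>, so that the induction hypothesis applies to it.\<close>
    proof (rule Ck_on_Suc_I[where f'="\<lambda>x v. (- 1 * v) * (inverse x * inverse x)"])
      fix x :: real assume "x \<in> {0<..}"
      then show "(inverse has_derivative (\<lambda>v. (- 1 * v) * (inverse x * inverse x))) (at x)"
        by (auto intro!: derivative_eq_intros simp: fun_eq_iff)
    qed (intro Ck_on_bilinear[OF bounded_bilinear_mult] Suc Ck_on_const)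
  qed
qed

lemma smooth_on_divide:
  fixes f g :: "'b::euclidean_space \<Rightarrow> real"
  assumes "smooth_on S f" "smooth_on S g" "\<And>x. x \<in> S \<Longrightarrow> g x > 0"
  shows "smooth_on S (\<lambda>x. f x / g x)"
  unfolding divide_inverse
  by (intro smooth_on_mult assms smooth_on_compose[OF smooth_on_inverse]) (use assms in auto)

text \<open>The closure of the family under differentiation, \<open>f\<^sub>n' = f\<^sub>n\<^sub>+\<^sub>2 - n f\<^sub>n\<^sub>+\<^sub>1\<close>, gives smoothness.\<close>

definition flat :: "nat \<Rightarrow> real \<Rightarrow> real" where
  "flat n t = (if t \<le> 0 then 0 else (1 / t) ^ n * exp (- (1 / t)))"

text \<open>From the right, \<open>t = 1 / s\<close> turns this into \<open>s ^ n / exp s\<close>,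
  where the exponential wins at infinity; from the left \<open>flat n\<close> is zero.\<close>

lemma flat_tendsto_0: "((\<lambda>t. flat n t) \<longlongrightarrow> 0) (at 0)"
proof -
  have "((\<lambda>t::real. t ^ n / exp t) \<longlongrightarrow> 0) at_top" by (rule tendsto_power_div_exp_0)
  then have "((\<lambda>t::real. inverse t ^ n / exp (inverse t)) \<longlongrightarrow> 0) (at_right 0)"
    using filterlim_compose[OF _ filterlim_inverse_at_top_right] by blast
  then have "(flat n \<longlongrightarrow> 0) (at_right 0)"
    by (rule Lim_transform_eventually)
      (auto simp: eventually_at_right_field flat_def exp_minus field_simps intro!: exI[of _ 1])
  moreover have "(flat n \<longlongrightarrow> 0) (at_left 0)"
    by (rule Lim_transform_eventually[OF tendsto_const])
      (auto simp: eventually_at_left_field flat_def intro!: exI[of _ "-1"])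
  ultimately show ?thesis by (simp add: filterlim_split_at)
qed

lemma flat_has_derivative:
  "(flat n has_real_derivative (flat (n + 2) t - real n * flat (n + 1) t)) (at t)"
proof -
  consider "t < 0" | "t = 0" | "t > 0" by linarith
  then show ?thesis
  proof cases
    case 1
    have "((\<lambda>t. 0) has_real_derivative 0) (at t)" by simp
    then have "(flat n has_real_derivative 0) (at t)"
      by (rule has_field_derivative_transform_within_open[where S="{..<0}"])
        (use 1 in \<open>auto simp: flat_def\<close>)
    then show ?thesis using 1 by (simp add: flat_def)
  next
    case 2
    \<comment> \<open>For \<open>h > 0\<close> the difference quotient at 0 is
      \<open>flat n h / h\<close>, which is \<open>flat (n + 1) h\<close>; for \<open>h < 0\<close>
      both are 0.\<close>
    have "((\<lambda>h. (flat n (0 + h) - flat n 0) / h) \<longlongrightarrow> 0) (at 0)"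
      by (rule Lim_transform_eventually[OF flat_tendsto_0[of "n + 1"]])
        (auto simp: eventually_at flat_def field_simps intro!: exI[of _ 1])
    then show ?thesis using 2 by (simp add: DERIV_def flat_def)
  next
    case 3
    have inv: "((\<lambda>t. 1 / t) has_real_derivative - (1 / t)\<^sup>2) (at t)"
      using 3 by (auto intro!: derivative_eq_intros simp: power2_eq_square)
    have "((\<lambda>t. (1 / t) ^ n * exp (- (1 / t))) has_real_derivative
        (1 / t) ^ n * (exp (- (1 / t)) * - (- (1 / t)\<^sup>2)) +
        real n * (- (1 / t)\<^sup>2 * (1 / t) ^ (n - Suc 0)) * exp (- (1 / t))) (at t)"
      by (intro DERIV_mult' DERIV_power inv DERIV_fun_exp DERIV_minus)
    also have "(1 / t) ^ n * (exp (- (1 / t)) * - (- (1 / t)\<^sup>2)) +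
        real n * (- (1 / t)\<^sup>2 * (1 / t) ^ (n - Suc 0)) * exp (- (1 / t)) =
        flat (n + 2) t - real n * flat (n + 1) t"
      using 3 by (cases n) (auto simp: flat_def power2_eq_square algebra_simps)
    finally have "((\<lambda>t. (1 / t) ^ n * exp (- (1 / t))) has_real_derivative
        (flat (n + 2) t - real n * flat (n + 1) t)) (at t)" .
    then show ?thesis
      by (rule has_field_derivative_transform_within_open[where S="{0<..}"])
        (use 3 in \<open>auto simp: flat_def\<close>)
  qed
qed

lemma smooth_on_flat: "smooth_on S (flat n)"
  unfolding smooth_on_def
proof
  fix k show "Ck_on k S (flat n)"
  proof (induction k arbitrary: n)
    case 0
    show ?case using flat_has_derivative
      by (auto intro!: continuous_at_imp_continuous_on DERIV_isCont)
  next
    case (Suc k)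
    show ?case
    proof (rule Ck_on_Suc_I[where f'="\<lambda>x v. flat (n + 2) x * v + (- real n * v) * flat (n + 1) x"])
      fix x
      show "(flat n has_derivative (\<lambda>v. flat (n + 2) x * v + (- real n * v) * flat (n + 1) x)) (at x)"
        using flat_has_derivative[of n x] unfolding has_field_derivative_def
        by (rule has_derivative_eq_rhs) (auto simp: fun_eq_iff algebra_simps)
    qed (intro Ck_on_add Ck_on_bilinear[OF bounded_bilinear_mult] Suc Ck_on_const)
  qed
qed

text \<open>Here \<open>u y > 0\<close> says that \<open>y\<close> is closer to \<open>a\<close>
  than \<open>2 * e\<close>, and \<open>w y > 0\<close> that it is farther than \<open>e\<close>.
  One of the two always holds, so the quotient of flat functions has a positive denominator; it is 1
  where \<open>w\<close> is not positive and 0 where \<open>u\<close> is not positive.\<close>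

lemma smooth_plateau:
  fixes a :: "'b::euclidean_space"
  assumes "0 < e"
  obtains \<rho> :: "'b \<Rightarrow> real" where "smooth_on UNIV \<rho>" "\<And>y. y \<in> ball a e \<Longrightarrow> \<rho> y = 1"
    "\<And>y. y \<notin> cball a (2 * e) \<Longrightarrow> \<rho> y = 0"
proof
  define u where "u y = (2 * e)\<^sup>2 - (y - a) \<bullet> (y - a)" for y
  define w where "w y = (y - a) \<bullet> (y - a) - e\<^sup>2" for y
  have uw: "u y > 0 \<or> w y > 0" for y
    using assms unfolding u_def w_def by (simp add: power_mult_distrib)
      (smt (verit, best) zero_less_power)
  have nn: "flat 0 t \<ge> 0" "flat 0 t > 0 \<longleftrightarrow> t > 0" for t by (auto simp: flat_def)
  have pos: "flat 0 (u y) + flat 0 (w y) > 0" for y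
    using uw[of y] nn by (meson add_nonneg_pos add_pos_nonneg)
  show "smooth_on UNIV (\<lambda>y. flat 0 (u y) / (flat 0 (u y) + flat 0 (w y)))"
    unfolding u_def w_def
    by (intro smooth_on_divide smooth_on_add smooth_on_compose[OF smooth_on_flat[of UNIV]]
        smooth_on_diff smooth_on_const smooth_on_inner smooth_on_id)
      (use pos in \<open>auto simp: u_def w_def\<close>)
  show "flat 0 (u y) / (flat 0 (u y) + flat 0 (w y)) = 1" if "y \<in> ball a e" for y
  proof -
    have "(y - a) \<bullet> (y - a) \<le> e\<^sup>2"
      using that unfolding mem_ball dist_norm power2_norm_eq_inner[symmetric]
      by (intro power_mono) (auto simp: norm_minus_commute)
    then have "flat 0 (w y) = 0" by (simp add: flat_def w_def)
    then show ?thesis using pos[of y] by simp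
  qed
  show "flat 0 (u y) / (flat 0 (u y) + flat 0 (w y)) = 0" if "y \<notin> cball a (2 * e)" for y
  proof -
    have "(2 * e)\<^sup>2 \<le> (y - a) \<bullet> (y - a)"
      using that assms unfolding mem_cball dist_norm power2_norm_eq_inner[symmetric]
      by (intro power_mono) (auto simp: norm_minus_commute)
    then have "flat 0 (u y) = 0" by (simp add: flat_def u_def)
    then show ?thesis by simp
  qed
qed

section \<open>Integrals with parameters, Hadamard's lemma and symmetry of second derivatives\<close>

text \<open>Differentiation under the integral sign yields an integral of the same kind, with
  integrand \<open>F' (x, s) (v, 0)\<close>, so the induction on \<open>k\<close> closes.\<close>

lemma Ck_on_integral_param:
  fixes F :: "'b::euclidean_space \<times> real \<Rightarrow> real"
  assumes "open S" "\<And>x s. x \<in> S \<Longrightarrow> s \<in> {0..1} \<Longrightarrow> (x, s) \<in> W"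
  shows "Ck_on k W F \<Longrightarrow> Ck_on k S (\<lambda>x. integral {0..1} (\<lambda>s. F (x, s)))"
proof (induction k arbitrary: F)
  case 0
  have "continuous_on (S \<times> cbox 0 1) F"
    by (rule continuous_on_subset[of W]) (use 0 assms in auto)
  then have "continuous_on (S \<times> cbox 0 1) (\<lambda>(x, s). F (x, s))" by simp
  from integral_continuous_on_param[OF this] show ?case by simp
next
  case (Suc k)
  obtain F' where F': "\<And>z. z \<in> W \<Longrightarrow> (F has_derivative F' z) (at z)"
      "\<And>v. Ck_on k W (\<lambda>z. F' z v)"
    using Suc.prems by (rule Ck_on_Suc_E) blast
  have cF: "continuous_on W F"
    using F'(1) by (meson continuous_at_imp_continuous_on has_derivative_continuous)
  have cF': "continuous_on W (\<lambda>z. F' z v)" for v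
  proof (cases k)
    case (Suc l)
    with F'(2) have "Ck_on (Suc l) W (\<lambda>z. F' z v)" by simp
    then show ?thesis
      by (meson Ck_on_differentiable continuous_at_imp_continuous_on differentiable_imp_continuous_within)
  qed (use F'(2)[of v] in simp)
  \<comment> \<open>The Leibniz rule wants the derivative as a continuous map into the bounded
    linear maps; in finite dimension continuity can be checked on basis vectors.\<close>
  define fx where "fx x s = Blinfun (\<lambda>v. F' (x, s) (v, 0))" for x s
  have fx: "blinfun_apply (fx x s) = (\<lambda>v. F' (x, s) (v, 0))" if "(x, s) \<in> W" for x s
  proof -
    have "bounded_linear (F' (x, s))" using F'(1)[OF that] has_derivative_bounded_linear by blast
    then have "bounded_linear (\<lambda>v. F' (x, s) (v, 0))"
      by (rule bounded_linear_compose)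
        (rule bounded_linear_Pair[OF bounded_linear_ident bounded_linear_zero])
    then show ?thesis unfolding fx_def by (rule bounded_linear_Blinfun_apply)
  qed
  show ?case
  proof (rule Ck_on_Suc_I[where f'="\<lambda>x v. integral {0..1} (\<lambda>s. F' (x, s) (v, 0))"])
    fix x0 assume x0: "x0 \<in> S"
    then obtain e where e: "e > 0" "ball x0 e \<subseteq> S" using assms(1) openE by blast
    let ?U = "ball x0 e"
    have W: "(x, s) \<in> W" if "x \<in> ?U" "s \<in> cbox 0 1" for x s
      using that assms(2) e by (auto simp: subset_iff)
    have c: "continuous_on (?U \<times> cbox 0 1) (\<lambda>z. fx (fst z) (snd z))"
    proof (rule continuous_on_blinfun_componentwise)
      fix i :: 'b
      have "continuous_on (?U \<times> cbox 0 1) (\<lambda>z. F' z (i, 0))"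
        by (rule continuous_on_subset[OF cF']) (use W in auto)
      then show "continuous_on (?U \<times> cbox 0 1) (\<lambda>z. blinfun_apply (fx (fst z) (snd z)) i)"
        by (rule continuous_on_eq) (use W fx in auto)
    qed
    have "((\<lambda>x. integral (cbox 0 1) (\<lambda>s. F (x, s))) has_derivative integral (cbox 0 1) (fx x0))
        (at x0 within ?U)"
    proof (rule leibniz_rule)
      fix x and s :: real assume xs: "x \<in> ?U" "s \<in> cbox 0 1"
      have "((\<lambda>x. F (x, s)) has_derivative (\<lambda>v. F' (x, s) (v, 0))) (at x within ?U)"
        by (rule has_derivative_compose[where f="\<lambda>x. (x, s)" and g=F and g'="F' (x, s)"])
          (auto intro!: derivative_eq_intros F' W xs)
      then show "((\<lambda>x. F (x, s)) has_derivative blinfun_apply (fx x s)) (at x within ?U)"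
        using fx W xs by simp
    next
      fix x assume x: "x \<in> ?U"
      have "continuous_on (cbox 0 1) (\<lambda>s. F (x, s))"
        by (rule continuous_on_compose2[OF cF]) (auto intro!: continuous_intros W x)
      then show "(\<lambda>s. F (x, s)) integrable_on cbox 0 1" by (rule integrable_continuous)
    next
      show "continuous_on (?U \<times> cbox 0 1) (\<lambda>(x, s). fx x s)"
        using c by (simp add: case_prod_beta)
    qed (use e in auto)
    then have d: "((\<lambda>x. integral (cbox 0 1) (\<lambda>s. F (x, s))) has_derivative
        blinfun_apply (integral (cbox 0 1) (fx x0))) (at x0)"
      using at_within_open[of x0 ?U] e by simp
    have "continuous_on (cbox 0 1) (\<lambda>s. fx x0 s)"
    proof -
      have "continuous_on (cbox 0 1) (\<lambda>s. (x0, s::real))" by (intro continuous_intros)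
      from continuous_on_compose2[OF c this] e show ?thesis by (simp add: image_subset_iff)
    qed
    then have "fx x0 integrable_on cbox 0 1" by (rule integrable_continuous)
    then have "blinfun_apply (integral (cbox 0 1) (fx x0)) v = integral {0..1} (\<lambda>s. F' (x0, s) (v, 0))" for v
      using fx assms(2) x0 by (subst blinfun_apply_integral) (auto intro!: Henstock_Kurzweil_Integration.integral_cong)
    with d show "((\<lambda>x. integral {0..1} (\<lambda>s. F (x, s))) has_derivative
        (\<lambda>v. integral {0..1} (\<lambda>s. F' (x0, s) (v, 0)))) (at x0)"
      by (auto simp: fun_eq_iff elim: has_derivative_eq_rhs)
  qed (intro Suc.IH F')
qed

section \<open>Directional derivatives\<close>

definition dirD :: "'b::euclidean_space \<Rightarrow> ('b \<Rightarrow> real) \<Rightarrow> 'b \<Rightarrow> real" where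
  "dirD v f x = frechet_derivative f (at x) v"

lemma smooth_on_dirD: "smooth_on S f \<Longrightarrow> open S \<Longrightarrow> smooth_on S (dirD v f)"
  unfolding dirD_def[abs_def] by (rule smooth_on_frechet)

lemma dirD_unique: "(f has_derivative f') (at x) \<Longrightarrow> dirD v f x = f' v"
  unfolding dirD_def using frechet_derivative_at by metis

lemma dirD_cong:
  assumes "open S" "x \<in> S" "smooth_on S f" "\<And>y. y \<in> S \<Longrightarrow> f y = g y"
  shows "dirD v f x = dirD v g x"
proof -
  note d = smooth_on_has_derivative[OF assms(3,2)]
  have "(g has_derivative frechet_derivative f (at x)) (at x)"
    by (rule has_derivative_transform_within_open[OF d assms(1,2)]) (use assms in auto)
  then show ?thesis using dirD_unique dirD_def by metis
qed

lemma dirD_add: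
  "smooth_on S f \<Longrightarrow> smooth_on S g \<Longrightarrow> x \<in> S \<Longrightarrow> dirD v (\<lambda>y. f y + g y) x = dirD v f x + dirD v g x"
  using dirD_unique[OF has_derivative_add[OF smooth_on_has_derivative smooth_on_has_derivative]]
  by (simp add: dirD_def)

lemma dirD_mult:
  "smooth_on S f \<Longrightarrow> smooth_on S g \<Longrightarrow> x \<in> S \<Longrightarrow>
    dirD v (\<lambda>y. f y * g y) x = f x * dirD v g x + g x * dirD v f x"
  using dirD_unique[OF has_derivative_mult[OF smooth_on_has_derivative smooth_on_has_derivative]]
  by (simp add: dirD_def mult.commute)

lemma dirD_const: "dirD v (\<lambda>y. c) x = 0"
  by (rule dirD_unique) simp

lemma dirD_linear: "bounded_linear L \<Longrightarrow> dirD v L x = L v"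
  by (rule dirD_unique) (rule bounded_linear_imp_has_derivative)

lemma dirD_line:
  assumes "smooth_on S f" "x + t *\<^sub>R v \<in> S"
  shows "((\<lambda>t. f (x + t *\<^sub>R v)) has_real_derivative dirD v f (x + t *\<^sub>R v)) (at t)"
proof -
  note d = smooth_on_has_derivative[OF assms]
  have "((\<lambda>t. f (x + t *\<^sub>R v)) has_derivative
      (\<lambda>h. frechet_derivative f (at (x + t *\<^sub>R v)) (h *\<^sub>R v))) (at t)"
    by (rule has_derivative_compose[where f="\<lambda>t. x + t *\<^sub>R v", OF _ d])
      (auto intro!: derivative_eq_intros)
  moreover have "(\<lambda>h. frechet_derivative f (at (x + t *\<^sub>R v)) (h *\<^sub>R v)) = (*) (dirD v f (x + t *\<^sub>R v))"
    using linear_cmul[OF has_derivative_linear[OF d]] by (auto simp: dirD_def fun_eq_iff)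
  ultimately show ?thesis unfolding has_field_derivative_def by simp
qed

lemma dirD_expand:
  assumes "smooth_on S f" "x \<in> S"
  shows "dirD v f x = (\<Sum>b\<in>Basis. (v \<bullet> b) * dirD b f x)"
proof -
  have l: "linear (frechet_derivative f (at x))"
    by (rule has_derivative_linear[OF smooth_on_has_derivative[OF assms]])
  have "dirD v f x = frechet_derivative f (at x) (\<Sum>b\<in>Basis. (v \<bullet> b) *\<^sub>R b)"
    by (simp add: euclidean_representation dirD_def)
  also have "\<dots> = (\<Sum>b\<in>Basis. (v \<bullet> b) * dirD b f x)"
    using l by (simp add: linear_sum linear_cmul dirD_def)
  finally show ?thesis .
qed

text \<open>The fundamental theorem of calculus along the segment from \<open>a\<close> to
  \<open>y\<close> expresses \<open>f y - f a\<close> by the derivative of \<open>f\<close> in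
  direction \<open>y - a\<close>; expanding this direction over \<open>Basis\<close> leaves as
  \<open>h b y\<close> the average of the \<open>b\<close>-derivative over the segment. At
  \<open>y = a\<close> the integrand is constant. This is what will force a derivation to be
  determined by its values on coordinates.\<close>

lemma Hadamard:
  fixes f :: "'b::euclidean_space \<Rightarrow> real"
  assumes "smooth_on (ball a e) f" "e > 0"
  obtains h where "\<And>b. smooth_on (ball a e) (h b)" "\<And>b. h b a = dirD b f a"
    "\<And>y. y \<in> ball a e \<Longrightarrow> f y = f a + (\<Sum>b\<in>Basis. ((y - a) \<bullet> b) * h b y)"
proof
  let ?h = "\<lambda>b y. integral {0..1} (\<lambda>s. dirD b f (a + s *\<^sub>R (y - a)))"
  let ?p = "\<lambda>z :: 'b \<times> real. a + snd z *\<^sub>R (fst z - a)"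
  have mem: "a + s *\<^sub>R (y - a) \<in> ball a e" if "y \<in> ball a e" "s \<in> {0..1}" for y s
  proof -
    have "norm (s *\<^sub>R (y - a)) \<le> 1 * norm (y - a)"
      using that unfolding norm_scaleR by (intro mult_right_mono) auto
    then show ?thesis using that by (simp add: dist_norm norm_minus_commute)
  qed
  have sp: "smooth_on S ?p" for S
    unfolding smooth_on_def
    by (intro allI Ck_on_add Ck_on_const Ck_on_bilinear[OF bounded_bilinear_scaleR])
      (use smooth_on_snd[OF smooth_on_id, of S] smooth_on_diff[OF smooth_on_fst[OF smooth_on_id, of S] smooth_on_const[of S a]]
        in \<open>auto simp: smooth_on_def\<close>)
  have s: "smooth_on (?p -` ball a e) (\<lambda>z. dirD b f (?p z))" for b
    by (rule smooth_on_compose[OF smooth_on_dirD[OF assms(1)] sp]) auto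
  show "smooth_on (ball a e) (?h b)" for b
    unfolding smooth_on_def
  proof
    fix k
    show "Ck_on k (ball a e) (?h b)"
      using Ck_on_integral_param[OF open_ball, of a e "?p -` ball a e" k "\<lambda>z. dirD b f (?p z)"]
        s[of b] mem unfolding smooth_on_def by auto
  qed
  show "?h b a = dirD b f a" for b by simp
  show "f y = f a + (\<Sum>b\<in>Basis. ((y - a) \<bullet> b) * ?h b y)" if y: "y \<in> ball a e" for y
  proof -
    have "((\<lambda>s. dirD (y - a) f (a + s *\<^sub>R (y - a))) has_integral
        f (a + 1 *\<^sub>R (y - a)) - f (a + 0 *\<^sub>R (y - a))) {0..1}"
    proof (rule fundamental_theorem_of_calculus)
      fix s :: real assume "s \<in> {0..1}"
      then show "((\<lambda>s. f (a + s *\<^sub>R (y - a))) has_vector_derivative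
          dirD (y - a) f (a + s *\<^sub>R (y - a))) (at s within {0..1})"
        using dirD_line[OF assms(1) mem[OF y]] has_vector_derivative_at_within
          has_real_derivative_iff_has_vector_derivative by blast
    qed simp
    then have *: "f y - f a = integral {0..1} (\<lambda>s. dirD (y - a) f (a + s *\<^sub>R (y - a)))"
      by (simp add: integral_unique)
    have int: "(\<lambda>s. ((y - a) \<bullet> b) * dirD b f (a + s *\<^sub>R (y - a))) integrable_on {0..1}" for b
    proof (rule integrable_continuous_real, intro continuous_intros)
      show "continuous_on {0..1} (\<lambda>s. dirD b f (a + s *\<^sub>R (y - a)))"
        by (rule continuous_on_compose2[OF smooth_on_imp_continuous_on[OF smooth_on_dirD[OF assms(1)]]])
          (use mem[OF y] in \<open>auto intro!: continuous_intros\<close>)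
    qed
    have "integral {0..1} (\<lambda>s. dirD (y - a) f (a + s *\<^sub>R (y - a))) =
        integral {0..1} (\<lambda>s. \<Sum>b\<in>Basis. ((y - a) \<bullet> b) * dirD b f (a + s *\<^sub>R (y - a)))"
      by (rule Henstock_Kurzweil_Integration.integral_cong) (rule dirD_expand[OF assms(1) mem[OF y]])
    also have "\<dots> = (\<Sum>b\<in>Basis. ((y - a) \<bullet> b) * ?h b y)"
      using int by (simp add: Henstock_Kurzweil_Integration.integral_sum)
    finally show ?thesis using * by simp
  qed
qed

text \<open>The mean value theorem is used twice: in direction \<open>v\<close> on the difference of
  \<open>f\<close> along the two sides parallel to \<open>v\<close>, then in direction
  \<open>w\<close>. The second difference is symmetric in \<open>v\<close> and \<open>w\<close>,
  while the right-hand side is not visibly so.\<close>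

lemma mixed_second_difference:
  fixes f :: "'b::euclidean_space \<Rightarrow> real"
  assumes "open S" "smooth_on S f" "0 < h"
    and mem: "\<And>s t. s \<in> {0..h} \<Longrightarrow> t \<in> {0..h} \<Longrightarrow> x + s *\<^sub>R v + t *\<^sub>R w \<in> S"
  obtains s t where "s \<in> {0..h}" "t \<in> {0..h}"
    "f (x + h *\<^sub>R v + h *\<^sub>R w) - f (x + h *\<^sub>R v) - f (x + h *\<^sub>R w) + f x
      = h * h * dirD w (dirD v f) (x + s *\<^sub>R v + t *\<^sub>R w)"
proof -
  have d1: "((\<lambda>s. f (x + s *\<^sub>R v + c *\<^sub>R w)) has_real_derivative dirD v f (x + s *\<^sub>R v + c *\<^sub>R w)) (at s)"
    if "s \<in> {0..h}" "c \<in> {0..h}" for s c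
    using dirD_line[OF assms(2), of "x + c *\<^sub>R w" s v] mem[OF that] by (simp add: algebra_simps)
  have "\<exists>s>0. s < h \<and> (f (x + h *\<^sub>R v + h *\<^sub>R w) - f (x + h *\<^sub>R v + 0 *\<^sub>R w)) - (f (x + 0 *\<^sub>R v + h *\<^sub>R w) - f (x + 0 *\<^sub>R v + 0 *\<^sub>R w))
      = (h - 0) * (dirD v f (x + s *\<^sub>R v + h *\<^sub>R w) - dirD v f (x + s *\<^sub>R v + 0 *\<^sub>R w))"
    by (rule MVT2[OF assms(3), where f="\<lambda>s. f (x + s *\<^sub>R v + h *\<^sub>R w) - f (x + s *\<^sub>R v + 0 *\<^sub>R w)"
          and f'="\<lambda>s. dirD v f (x + s *\<^sub>R v + h *\<^sub>R w) - dirD v f (x + s *\<^sub>R v + 0 *\<^sub>R w)"])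
      (intro DERIV_diff d1; use assms(3) in auto)
  then obtain s where s: "0 < s" "s < h"
    "f (x + h *\<^sub>R v + h *\<^sub>R w) - f (x + h *\<^sub>R v) - f (x + h *\<^sub>R w) + f x
      = h * (dirD v f (x + s *\<^sub>R v + h *\<^sub>R w) - dirD v f (x + s *\<^sub>R v))"
    by (auto simp: algebra_simps)
  have "\<exists>t>0. t < h \<and> dirD v f (x + s *\<^sub>R v + h *\<^sub>R w) - dirD v f (x + s *\<^sub>R v + 0 *\<^sub>R w)
      = (h - 0) * dirD w (dirD v f) (x + s *\<^sub>R v + t *\<^sub>R w)"
    by (rule MVT2[OF assms(3), where f="\<lambda>t. dirD v f (x + s *\<^sub>R v + t *\<^sub>R w)"
          and f'="\<lambda>t. dirD w (dirD v f) (x + s *\<^sub>R v + t *\<^sub>R w)"])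
      (rule dirD_line[OF smooth_on_dirD[OF assms(2,1)]], use mem s in auto)
  then obtain t where "0 < t" "t < h"
     "dirD v f (x + s *\<^sub>R v + h *\<^sub>R w) - dirD v f (x + s *\<^sub>R v)
      = h * dirD w (dirD v f) (x + s *\<^sub>R v + t *\<^sub>R w)"
    by auto
  then show ?thesis using s by (intro that[of s t]) auto
qed

lemma dirD_commute:
  fixes f :: "'b::euclidean_space \<Rightarrow> real"
  assumes "open S" "smooth_on S f" "x \<in> S"
  shows "dirD w (dirD v f) x = dirD v (dirD w f) x"
proof (rule ccontr)
  assume ne: "\<not> ?thesis"
  \<comment> \<open>Half the gap: two values, each less than \<open>E\<close> away from its own
    limit, cannot coincide.\<close>
  define E where "E = \<bar>dirD w (dirD v f) x - dirD v (dirD w f) x\<bar> / 2"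
  have "E > 0" using ne by (simp add: E_def)
  have "isCont (dirD u (dirD u' f)) x" for u u'
    using smooth_on_imp_continuous_on[OF smooth_on_dirD[OF smooth_on_dirD[OF assms(2,1)] assms(1)]]
      assms continuous_on_eq_continuous_at by blast
  then have ev: "\<forall>\<^sub>F y in nhds x. dist (dirD u (dirD u' f) y) (dirD u (dirD u' f) x) < E" for u u'
    using \<open>E > 0\<close> isCont_def tendsto_at_iff_tendsto_nhds tendstoD by blast
  have "\<forall>\<^sub>F y in nhds x. y \<in> S \<and> dist (dirD w (dirD v f) y) (dirD w (dirD v f) x) < E
      \<and> dist (dirD v (dirD w f) y) (dirD v (dirD w f) x) < E"
    using eventually_nhds_in_open[OF assms(1,3)] ev by (auto intro!: eventually_conj)
  then obtain d where d: "d > 0" "\<And>y. dist y x < d \<Longrightarrow> y \<in> S \<and> dist (dirD w (dirD v f) y) (dirD w (dirD v f) x) < E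
      \<and> dist (dirD v (dirD w f) y) (dirD v (dirD w f) x) < E"
    unfolding eventually_nhds_metric by auto
  \<comment> \<open>Small enough that the parallelogram at \<open>x\<close> with sides
    \<open>h v\<close> and \<open>h w\<close> stays within \<open>d / 2\<close> of \<open>x\<close>;
    the summand 1 excludes division by zero.\<close>
  define h where "h = d / (norm v + norm w + 1) / 2"
  have n: "norm v + norm w + 1 > 0" by (simp add: add_nonneg_pos)
  then have "h > 0" using d by (simp add: h_def)
  have hd: "h * (norm v + norm w) < d"
  proof -
    have "h * (norm v + norm w) \<le> h * (norm v + norm w + 1)" using \<open>h > 0\<close> by simp
    also have "\<dots> = d / 2" using n unfolding h_def times_divide_eq_left
      by (metis nonzero_mult_div_cancel_right order_less_irrefl times_divide_eq_right mult.commute)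
    finally show ?thesis using d by simp
  qed
  have near: "dist (x + s *\<^sub>R v + t *\<^sub>R w) x < d" if "s \<in> {0..h}" "t \<in> {0..h}" for s t
  proof -
    have "norm (s *\<^sub>R v + t *\<^sub>R w) \<le> norm (s *\<^sub>R v) + norm (t *\<^sub>R w)" by (rule norm_triangle_ineq)
    also have "\<dots> \<le> h * norm v + h * norm w"
      using that by (auto intro!: add_mono mult_right_mono)
    finally show ?thesis using hd by (simp add: dist_norm algebra_simps)
  qed
  have near': "dist (x + s *\<^sub>R w + t *\<^sub>R v) x < d" if "s \<in> {0..h}" "t \<in> {0..h}" for s t
    using near[OF that(2,1)] by (simp add: algebra_simps)
  obtain s t where 1: "s \<in> {0..h}" "t \<in> {0..h}"
    "f (x + h *\<^sub>R v + h *\<^sub>R w) - f (x + h *\<^sub>R v) - f (x + h *\<^sub>R w) + f x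
      = h * h * dirD w (dirD v f) (x + s *\<^sub>R v + t *\<^sub>R w)"
    by (rule mixed_second_difference[OF assms(1,2) \<open>h > 0\<close>, of x v w]) (use near d in auto)
  obtain s' t' where 2: "s' \<in> {0..h}" "t' \<in> {0..h}"
    "f (x + h *\<^sub>R w + h *\<^sub>R v) - f (x + h *\<^sub>R w) - f (x + h *\<^sub>R v) + f x
      = h * h * dirD v (dirD w f) (x + s' *\<^sub>R w + t' *\<^sub>R v)"
    by (rule mixed_second_difference[OF assms(1,2) \<open>h > 0\<close>, of x w v]) (use near' d in auto)
  have "f (x + h *\<^sub>R w + h *\<^sub>R v) = f (x + h *\<^sub>R v + h *\<^sub>R w)" by (simp add: algebra_simps)
  then have "h * h * dirD w (dirD v f) (x + s *\<^sub>R v + t *\<^sub>R w) = h * h * dirD v (dirD w f) (x + s' *\<^sub>R w + t' *\<^sub>R v)"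
    using 1(3) 2(3) by argo
  then have "dirD w (dirD v f) (x + s *\<^sub>R v + t *\<^sub>R w) = dirD v (dirD w f) (x + s' *\<^sub>R w + t' *\<^sub>R v)"
    using \<open>h > 0\<close> by simp
  moreover have "\<bar>dirD w (dirD v f) (x + s *\<^sub>R v + t *\<^sub>R w) - dirD w (dirD v f) x\<bar> < E"
    using d(2)[OF near[OF 1(1,2)]] by (simp add: dist_real_def)
  moreover have "\<bar>dirD v (dirD w f) (x + s' *\<^sub>R w + t' *\<^sub>R v) - dirD v (dirD w f) x\<bar> < E"
    using d(2)[OF near'[OF 2(1,2)]] by (simp add: dist_real_def)
  moreover have "\<bar>dirD w (dirD v f) x - dirD v (dirD w f) x\<bar> = E + E" by (simp add: E_def)
  ultimately show False by linarith
qed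

section \<open>Charts, cutoff functions and local frames\<close>

lemma chart_open: "smooth_manifold A \<Longrightarrow> (U, x) \<in> A \<Longrightarrow> open U"
  and chart_open_image: "smooth_manifold A \<Longrightarrow> (U, x) \<in> A \<Longrightarrow> open (x ` U)"
  and chart_homeomorphism:
    "smooth_manifold A \<Longrightarrow> (U, x) \<in> A \<Longrightarrow> homeomorphism U (x ` U) x (inv_into U x)"
  unfolding smooth_manifold_def by blast+

lemma chart_transition:
  "smooth_manifold A \<Longrightarrow> (U, x) \<in> A \<Longrightarrow> (V, y) \<in> A \<Longrightarrow>
    smooth_on (x ` (U \<inter> V)) (\<lambda>z. y (inv_into U x z))"
  unfolding smooth_manifold_def comp_def by blast

lemma chart_inv: "smooth_manifold A \<Longrightarrow> (U, x) \<in> A \<Longrightarrow> q \<in> U \<Longrightarrow> inv_into U x (x q) = q"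
  using chart_homeomorphism unfolding homeomorphism_def by blast

lemma chart_open_map:
  assumes "smooth_manifold A" "(U, x) \<in> A" "open W" "W \<subseteq> U"
  shows "open (x ` W)"
proof -
  have "openin (top_of_set U) W" using assms by (simp add: openin_open_eq chart_open)
  then have "openin (top_of_set (x ` U)) (x ` W)"
    using homeomorphism_imp_open_map[OF chart_homeomorphism[OF assms(1,2)]] by blast
  then show ?thesis using chart_open_image[OF assms(1,2)] openin_open_eq by blast
qed

lemma chart_open_preimage:
  assumes "smooth_manifold A" "(U, x) \<in> A" "open N"
  shows "open {q \<in> U. x q \<in> N}"
proof -
  have "open (U \<inter> x -` N)"
    by (rule continuous_open_preimage)
      (use chart_homeomorphism[OF assms(1,2)] chart_open[OF assms(1,2)] assms(3)
        in \<open>auto simp: homeomorphism_def\<close>)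
  then show ?thesis by (simp add: Int_def vimage_def)
qed

lemma mcarrier_I: "(U, x) \<in> A \<Longrightarrow> p \<in> U \<Longrightarrow> p \<in> mcarrier A"
  unfolding mcarrier_def by force

lemma mcarrier_E:
  assumes "p \<in> mcarrier A"
  obtains U x where "(U, x) \<in> A" "p \<in> U"
  using assms unfolding mcarrier_def by force

lemma open_mcarrier: "smooth_manifold A \<Longrightarrow> open (mcarrier A)"
  unfolding mcarrier_def by (auto intro!: open_Union dest: chart_open)

lemma Cinf_chart: "f \<in> Cinf A \<Longrightarrow> (U, x) \<in> A \<Longrightarrow> smooth_on (x ` U) (\<lambda>z. f (inv_into U x z))"
  unfolding Cinf_def comp_def by blast

lemma Cinf_I:
  "(\<And>U x. (U, x) \<in> A \<Longrightarrow> smooth_on (x ` U) (\<lambda>z. f (inv_into U x z))) \<Longrightarrow> f \<in> Cinf A"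
  unfolding Cinf_def comp_def by blast

text \<open>Smoothness near a point may be tested in one chart: composition with the transition map
  carries it to every other chart.\<close>

lemma Cinf_I_local:
  assumes M: "smooth_manifold A"
    and loc: "\<And>p. p \<in> mcarrier A \<Longrightarrow> \<exists>U x W. (U, x) \<in> A \<and> open W \<and> p \<in> W \<and> W \<subseteq> U \<and>
      smooth_on (x ` W) (\<lambda>z. f (inv_into U x z))"
  shows "f \<in> Cinf A"
proof (rule Cinf_I)
  fix V y assume V: "(V, y) \<in> A"
  show "smooth_on (y ` V) (\<lambda>z. f (inv_into V y z))"
  proof (rule smooth_on_local)
    fix z assume "z \<in> y ` V"
    then obtain q where q: "q \<in> V" "z = y q" by blast
    then have "q \<in> mcarrier A" using mcarrier_I[OF V] by simp
    from loc[OF this] obtain U x W where U: "(U, x) \<in> A" "open W" "q \<in> W" "W \<subseteq> U"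
      "smooth_on (x ` W) (\<lambda>z. f (inv_into U x z))" by blast
    let ?T = "y ` (V \<inter> W)"
    have o: "open ?T"
      by (rule chart_open_map[OF M V]) (use U(2) chart_open[OF M V] in auto)
    have t: "smooth_on ?T (\<lambda>z. x (inv_into V y z))"
      by (rule smooth_on_subset[OF chart_transition[OF M V U(1)]]) (use U(4) in auto)
    have "smooth_on ?T (\<lambda>z. f (inv_into U x (x (inv_into V y z))))"
      by (rule smooth_on_compose[OF U(5) t]) (use chart_inv[OF M V] in auto)
    then have "smooth_on ?T (\<lambda>z. f (inv_into V y z))"
      by (rule smooth_on_cong[OF _ o]) (use chart_inv[OF M V] chart_inv[OF M U(1)] U(4) in auto)
    then show "\<exists>T. open T \<and> z \<in> T \<and> smooth_on T (\<lambda>z. f (inv_into V y z))"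
      using o q U(3) by blast
  qed
qed

lemma Cinf_cong:
  assumes "smooth_manifold A" "f \<in> Cinf A" "\<And>q. q \<in> mcarrier A \<Longrightarrow> f q = h q"
  shows "h \<in> Cinf A"
proof (rule Cinf_I)
  fix U x assume U: "(U, x) \<in> A"
  show "smooth_on (x ` U) (\<lambda>z. h (inv_into U x z))"
    by (rule smooth_on_cong[OF Cinf_chart[OF assms(2) U] chart_open_image[OF assms(1) U]])
      (use mcarrier_I[OF U] chart_inv[OF assms(1) U] assms(3) in auto)
qed

lemma Cinf_const: "(\<lambda>q. c) \<in> Cinf A"
  by (rule Cinf_I) (rule smooth_on_const)

lemma Cinf_add: "f \<in> Cinf A \<Longrightarrow> h \<in> Cinf A \<Longrightarrow> (\<lambda>q. f q + h q) \<in> Cinf A"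
  by (rule Cinf_I) (intro smooth_on_add Cinf_chart)

lemma Cinf_mult: "f \<in> Cinf A \<Longrightarrow> h \<in> Cinf A \<Longrightarrow> (\<lambda>q. f q * h q) \<in> Cinf A"
  by (rule Cinf_I) (intro smooth_on_mult Cinf_chart)

lemma Cinf_diff: "f \<in> Cinf A \<Longrightarrow> h \<in> Cinf A \<Longrightarrow> (\<lambda>q. f q - h q) \<in> Cinf A"
  by (rule Cinf_I) (intro smooth_on_diff Cinf_chart)

lemma Cinf_scale: "f \<in> Cinf A \<Longrightarrow> (\<lambda>q. c * f q) \<in> Cinf A"
  by (intro Cinf_mult Cinf_const)

lemma Cinf_sum: "(\<And>i. i \<in> I \<Longrightarrow> f i \<in> Cinf A) \<Longrightarrow> (\<lambda>q. \<Sum>i\<in>I. f i q) \<in> Cinf A"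
  by (rule Cinf_I) (intro smooth_on_sum Cinf_chart)

section \<open>Derivations at a point\<close>

lemma tangent_add:
  "v \<in> tangent A p \<Longrightarrow> f \<in> Cinf A \<Longrightarrow> h \<in> Cinf A \<Longrightarrow> v (\<lambda>q. f q + h q) = v f + v h"
  and tangent_mult:
  "v \<in> tangent A p \<Longrightarrow> f \<in> Cinf A \<Longrightarrow> h \<in> Cinf A \<Longrightarrow> v (\<lambda>q. f q * h q) = f p * v h + h p * v f"
  and tangent_scale:
  "v \<in> tangent A p \<Longrightarrow> f \<in> Cinf A \<Longrightarrow> v (\<lambda>q. c * f q) = c * v f"
  and tangent_notin: "v \<in> tangent A p \<Longrightarrow> f \<notin> Cinf A \<Longrightarrow> v f = 0"
  unfolding tangent_def by blast+

lemma tangent_diff: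
  assumes "v \<in> tangent A p" "f \<in> Cinf A" "h \<in> Cinf A"
  shows "v (\<lambda>q. f q - h q) = v f - v h"
  using tangent_add[OF assms(1,2) Cinf_scale[OF assms(3), of "-1"]] tangent_scale[OF assms(1,3), of "-1"]
  by simp

text \<open>The Leibniz rule for \<open>1 = 1 * 1\<close> reads \<open>v 1 = 2 * v 1\<close>; other
  constants are multiples of 1.\<close>

lemma tangent_const: 
  assumes "v \<in> tangent A p"
  shows "v (\<lambda>q. c) = 0"
  using tangent_mult[OF assms Cinf_const[of 1] Cinf_const[of 1]]
    tangent_scale[OF assms Cinf_const[of 1], of c] by simp

lemma tangent_sum:
  assumes "v \<in> tangent A p"
  shows "(\<And>i. i \<in> I \<Longrightarrow> f i \<in> Cinf A) \<Longrightarrow> v (\<lambda>q. \<Sum>i\<in>I. f i q) = (\<Sum>i\<in>I. v (f i))"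
proof (induction I rule: infinite_finite_induct)
  case (insert j I)
  then have "v (\<lambda>q. f j q + (\<Sum>i\<in>I. f i q)) = v (f j) + v (\<lambda>q. \<Sum>i\<in>I. f i q)"
    by (intro tangent_add[OF assms] Cinf_sum) auto
  with insert show ?case by simp
qed (use tangent_const[OF assms] in auto)

lemma tangent_tadd: "v \<in> tangent A p \<Longrightarrow> w \<in> tangent A p \<Longrightarrow> tadd v w \<in> tangent A p"
  unfolding tangent_def tadd_def by (simp add: algebra_simps)

lemma tangent_tscale: "v \<in> tangent A p \<Longrightarrow> tscale c v \<in> tangent A p"
  unfolding tangent_def tscale_def by (simp add: algebra_simps)

lemma tangent_tzero: "tzero \<in> tangent A p"
  unfolding tangent_def tzero_def by simp

lemma vfields_tangent: "X \<in> vfields A \<Longrightarrow> p \<in> mcarrier A \<Longrightarrow> X p \<in> tangent A p"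
  unfolding vfields_def by blast

lemma vfields_Cinf: "X \<in> vfields A \<Longrightarrow> f \<in> Cinf A \<Longrightarrow> (\<lambda>p. X p f) \<in> Cinf A"
  unfolding vfields_def by blast

text \<open>Multiplying by the cutoff \<open>\<rho>\<close> extends local functions, given in the chart, by zero.\<close>

lemma chart_cutoff:
  assumes M: "smooth_manifold A" and U: "(U, x) \<in> A" and N: "open N" and p: "p \<in> U" "p \<in> N"
  obtains e W \<rho> where "e > 0" "ball (x p) e \<subseteq> x ` U" "open W" "p \<in> W" "W \<subseteq> U" "W \<subseteq> N" "x ` W \<subseteq> ball (x p) e"
    "\<forall>q\<in>W. \<rho> q = 1" "\<forall>q. q \<notin> U \<inter> N \<longrightarrow> \<rho> q = 0"
    "\<forall>\<phi>. smooth_on (ball (x p) e) \<phi> \<longrightarrow> (\<lambda>q. \<rho> q * \<phi> (x q)) \<in> Cinf A"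
proof -
  have "open (x ` (U \<inter> N))" by (rule chart_open_map[OF M U]) (use N chart_open[OF M U] in auto)
  then obtain e0 where e0: "e0 > 0" "ball (x p) e0 \<subseteq> x ` (U \<inter> N)" using p openE by blast
  \<comment> \<open>The plateau of radius \<open>e\<close> vanishes beyond radius
    \<open>2 * e\<close>, which leaves room inside the ball of radius \<open>3 * e\<close> in the
    image of \<open>U \<inter> N\<close>.\<close>
  define e where "e = e0 / 3"
  have e: "e > 0" "e0 = 3 * e" using e0 by (auto simp: e_def)
  obtain r :: "'b \<Rightarrow> real" where r: "smooth_on UNIV r" "\<And>y. y \<in> ball (x p) e \<Longrightarrow> r y = 1"
    "\<And>y. y \<notin> cball (x p) (2 * e) \<Longrightarrow> r y = 0"
    using smooth_plateau[OF e(1), where a="x p"] by metis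
  define \<rho> where "\<rho> q = (if q \<in> U then r (x q) else 0)" for q
  define W where "W = {q \<in> U. x q \<in> ball (x p) e}"
  \<comment> \<open>\<open>K\<close> contains the support of the cutoff. It is compact as a
    continuous image, hence closed because the space is Hausdorff, so smoothness of the extension by
    zero can be checked on the open complement of \<open>K\<close>.\<close>
  define K where "K = inv_into U x ` cball (x p) (2 * e)"
  have cb: "cball (x p) (2 * e) \<subseteq> x ` (U \<inter> N)" using e0 e by (auto simp: subset_iff)
  have hom: "homeomorphism U (x ` U) x (inv_into U x)" by (rule chart_homeomorphism[OF M U])
  have "continuous_on (cball (x p) (2 * e)) (inv_into U x)"
    by (rule continuous_on_subset[of "x ` U"]) (use hom cb in \<open>auto simp: homeomorphism_def\<close>)
  then have "compact K" unfolding K_def by (intro compact_continuous_image) auto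
  then have K: "closed K" by (rule compact_imp_closed)
  have KI: "q \<in> K \<longleftrightarrow> x q \<in> cball (x p) (2 * e)" if "q \<in> U" for q
  proof
    assume "q \<in> K"
    then obtain y where "y \<in> cball (x p) (2 * e)" "q = inv_into U x y" unfolding K_def by blast
    moreover then have "x q = y" using cb f_inv_into_f[of y x U] by blast
    ultimately show "x q \<in> cball (x p) (2 * e)" by simp
  next
    assume "x q \<in> cball (x p) (2 * e)"
    then show "q \<in> K" unfolding K_def using chart_inv[OF M U that] by (metis image_eqI)
  qed
  have KN: "K \<subseteq> U \<inter> N" using cb chart_inv[OF M U] unfolding K_def by fastforce
  have z: "\<rho> q = 0" if "q \<notin> K" for q
    using that KI r(3) unfolding \<rho>_def by auto
  have zN: "\<forall>q. q \<notin> U \<inter> N \<longrightarrow> \<rho> q = 0" using z KN by blast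
  have b: "ball (x p) e0 \<subseteq> x ` U" using e0 by auto
  show ?thesis
  proof (rule that[of e0 W \<rho>])
    show "open W" unfolding W_def by (rule chart_open_preimage[OF M U]) simp
    show "W \<subseteq> N"
    proof
      fix q assume "q \<in> W"
      then have "q \<in> U" "x q \<in> cball (x p) (2 * e)" using e unfolding W_def by auto
      then show "q \<in> N" using KI KN by blast
    qed
    show "\<forall>\<phi>. smooth_on (ball (x p) e0) \<phi> \<longrightarrow> (\<lambda>q. \<rho> q * \<phi> (x q)) \<in> Cinf A"
    proof (intro allI impI, rule Cinf_I_local[OF M])
      fix \<phi> :: "'b \<Rightarrow> real" assume \<phi>: "smooth_on (ball (x p) e0) \<phi>"
      fix q assume q: "q \<in> mcarrier A"
      show "\<exists>V y W'. (V, y) \<in> A \<and> open W' \<and> q \<in> W' \<and> W' \<subseteq> V \<and>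
        smooth_on (y ` W') (\<lambda>z. \<rho> (inv_into V y z) * \<phi> (x (inv_into V y z)))"
      proof (cases "q \<in> K")
        case True
        let ?W = "{q \<in> U. x q \<in> ball (x p) e0}"
        have W: "open ?W" by (rule chart_open_preimage[OF M U]) simp
        have "smooth_on (x ` ?W) (\<lambda>y. r y * \<phi> y)"
          by (intro smooth_on_mult smooth_on_subset[OF r(1)] smooth_on_subset[OF \<phi>]) auto
        then have "smooth_on (x ` ?W) (\<lambda>z. \<rho> (inv_into U x z) * \<phi> (x (inv_into U x z)))"
          by (rule smooth_on_cong)
            (use chart_open_map[OF M U W] chart_inv[OF M U] in \<open>auto simp: \<rho>_def\<close>)
        then show ?thesis using U W True KN KI e
          by (intro exI[of _ U] exI[of _ x] exI[of _ ?W]) auto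
      next
        case False
        from q obtain V y where V: "(V, y) \<in> A" "q \<in> V" by (rule mcarrier_E)
        let ?W = "V - K"
        have W: "open ?W" using chart_open[OF M V(1)] K by (rule open_Diff)
        have "smooth_on (y ` ?W) (\<lambda>z. \<rho> (inv_into V y z) * \<phi> (x (inv_into V y z)))"
          by (rule smooth_on_cong[OF smooth_on_const[of _ 0]])
            (use chart_open_map[OF M V(1) W] chart_inv[OF M V(1)] z in auto)
        then show ?thesis using V W False
          by (intro exI[of _ V] exI[of _ y] exI[of _ ?W]) auto
      qed
    qed
  qed (use e0 e p b zN in \<open>auto simp: W_def \<rho>_def r\<close>)
qed

lemma bump:
  assumes M: "smooth_manifold A" and p: "p \<in> mcarrier A" "open N" "p \<in> N"
  obtains \<rho> W where "\<rho> \<in> Cinf A" "open W" "p \<in> W" "\<And>q. q \<in> W \<Longrightarrow> \<rho> q = 1"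
    "\<And>q. q \<notin> N \<Longrightarrow> \<rho> q = 0" "\<And>q. q \<notin> mcarrier A \<Longrightarrow> \<rho> q = 0"
proof -
  obtain U x where U: "(U, x) \<in> A" "p \<in> U" using p by (auto elim: mcarrier_E)
  have "U \<subseteq> mcarrier A" using mcarrier_I[OF U(1)] by auto
  obtain e W \<rho> where e: "e > 0" "ball (x p) e \<subseteq> x ` U" "open W" "p \<in> W" "W \<subseteq> U" "W \<subseteq> N" "x ` W \<subseteq> ball (x p) e"
    "\<forall>q\<in>W. \<rho> q = 1" "\<forall>q. q \<notin> U \<inter> N \<longrightarrow> \<rho> q = 0"
    "\<forall>\<phi>. smooth_on (ball (x p) e) \<phi> \<longrightarrow> (\<lambda>q. \<rho> q * \<phi> (x q)) \<in> Cinf A"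
    by (rule chart_cutoff[OF M U(1) p(2) U(2) p(3)]) (rule that; assumption)
  note e = e(1-7) e(8-10)[rule_format]
  have "\<rho> \<in> Cinf A" using e(10)[OF smooth_on_const[of _ 1]] by simp
  moreover have "\<rho> q = 0" if "q \<notin> N \<or> q \<notin> U" for q
    using that e(9)[of q] by blast
  ultimately show ?thesis using that[of \<rho> W] e(3,4,8) \<open>U \<subseteq> mcarrier A\<close> by blast
qed

text \<open>For a cutoff \<open>\<rho>\<close> vanishing off \<open>W\<close>, the product
  \<open>\<rho> * (f - h)\<close> is the zero function, and the Leibniz rule at \<open>p\<close>
  isolates \<open>v (f - h)\<close>, since \<open>\<rho> p = 1\<close> and \<open>f p = h p\<close>.
  The cutoff also vanishes off the carrier, where nothing is known of \<open>f - h\<close>.\<close>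

lemma tangent_local:
  assumes M: "smooth_manifold A" and p: "p \<in> mcarrier A" and v: "v \<in> tangent A p"
    and fh: "f \<in> Cinf A" "h \<in> Cinf A"
    and W: "open W" "p \<in> W" "\<And>q. q \<in> W \<Longrightarrow> q \<in> mcarrier A \<Longrightarrow> f q = h q"
  shows "v f = v h"
proof -
  obtain \<rho> W' where r: "\<rho> \<in> Cinf A" "p \<in> W'" "\<And>q. q \<in> W' \<Longrightarrow> \<rho> q = 1"
    "\<And>q. q \<notin> W \<Longrightarrow> \<rho> q = 0" "\<And>q. q \<notin> mcarrier A \<Longrightarrow> \<rho> q = 0"
    using bump[OF M p W(1,2)] by metis
  have "(\<lambda>q. \<rho> q * (f q - h q)) = (\<lambda>q. 0)" using r W by (auto simp: fun_eq_iff)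
  then have "0 = \<rho> p * v (\<lambda>q. f q - h q) + (f p - h p) * v \<rho>"
    using tangent_mult[OF v r(1) Cinf_diff[OF fh]] tangent_const[OF v, of 0] by metis
  then show ?thesis using r W p tangent_diff[OF v fh] by simp
qed

text \<open>Membership in \<open>Cinf\<close> depends only on values on the carrier, so either both
  functions are smooth and locality applies, or neither is and \<open>v\<close> is 0 on both by
  convention. This permits rewriting under a derivative by identities valid on the carrier
  only.\<close>

lemma tangent_cong:
  assumes M: "smooth_manifold A" and p: "p \<in> mcarrier A" and v: "v \<in> tangent A p"
    and fh: "\<And>q. q \<in> mcarrier A \<Longrightarrow> f q = h q"
  shows "v f = v h"
proof (cases "f \<in> Cinf A")
  case True
  then have "h \<in> Cinf A" using Cinf_cong[OF M] fh by blast
  then show ?thesis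
    using tangent_local[OF M p v True _ open_mcarrier[OF M] p] fh by blast
next
  case False
  then have "h \<notin> Cinf A" using Cinf_cong[OF M, of h f] fh by metis
  then show ?thesis using False tangent_notin[OF v] by simp
qed

text \<open>Near \<open>p\<close>, Hadamard's lemma writes \<open>f\<close> as a constant plus the
  sum of the products \<open>(c b - c b p) * H b\<close>, with \<open>H b p\<close> the partial
  derivative. The constant is killed by \<open>v\<close>, and in each product the Leibniz rule keeps
  only the term in which the factor vanishing at \<open>p\<close> is differentiated.\<close>

lemma tangent_coords:
  fixes A :: "('a::{t2_space,second_countable_topology}, 'e::euclidean_space) atlas"
  assumes M: "smooth_manifold A" and U: "(U, x) \<in> A" "p \<in> U" and v: "v \<in> tangent A p"
    and f: "f \<in> Cinf A"
    and c: "\<And>b. b \<in> Basis \<Longrightarrow> c b \<in> Cinf A" "open N" "p \<in> N" "\<And>b q. b \<in> Basis \<Longrightarrow> q \<in> N \<Longrightarrow> q \<in> U \<Longrightarrow> c b q = x q \<bullet> b"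
  shows "v f = (\<Sum>b\<in>Basis. v (c b) * dirD b (\<lambda>z. f (inv_into U x z)) (x p))"
proof -
  let ?f = "\<lambda>z. f (inv_into U x z)"
  have pM: "p \<in> mcarrier A" using mcarrier_I[OF U] .
  obtain e W \<rho> where e: "e > 0" "ball (x p) e \<subseteq> x ` U" "open W" "p \<in> W" "W \<subseteq> U" "W \<subseteq> N" "x ` W \<subseteq> ball (x p) e"
    "\<forall>q\<in>W. \<rho> q = 1" "\<forall>q. q \<notin> U \<inter> N \<longrightarrow> \<rho> q = 0"
    "\<forall>\<phi>. smooth_on (ball (x p) e) \<phi> \<longrightarrow> (\<lambda>q. \<rho> q * \<phi> (x q)) \<in> Cinf A"
    by (rule chart_cutoff[OF M U(1) c(2) U(2) c(3)]) (rule that; assumption)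
  note e = e(1-7) e(8-10)[rule_format]
  have "smooth_on (ball (x p) e) ?f"
    by (rule smooth_on_subset[OF Cinf_chart[OF f U(1)] e(2)])
  then obtain h where h: "\<And>b. smooth_on (ball (x p) e) (h b)" "\<And>b. h b (x p) = dirD b ?f (x p)"
    "\<And>y. y \<in> ball (x p) e \<Longrightarrow> ?f y = ?f (x p) + (\<Sum>b\<in>Basis. ((y - x p) \<bullet> b) * h b y)"
    using Hadamard e(1) by blast
  define H where "H b = (\<lambda>q. \<rho> q * h b (x q))" for b
  have H: "H b \<in> Cinf A" for b unfolding H_def by (rule e(10)[OF h(1)])
  let ?g = "\<lambda>q. f p + (\<Sum>b\<in>Basis. (c b q - c b p) * H b q)"
  have d: "(\<lambda>q. c b q - c b p) \<in> Cinf A" if "b \<in> Basis" for b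
    by (intro Cinf_diff c Cinf_const that)
  have dH: "(\<lambda>q. (c b q - c b p) * H b q) \<in> Cinf A" if "b \<in> Basis" for b
    by (intro Cinf_mult d H that)
  have s: "(\<lambda>q. \<Sum>b\<in>Basis. (c b q - c b p) * H b q) \<in> Cinf A"
    by (intro Cinf_sum dH)
  have "v f = v ?g"
  proof (rule tangent_local[OF M pM v f _ e(3,4)])
    show "?g \<in> Cinf A" by (intro Cinf_add Cinf_const s)
    fix q assume q: "q \<in> W"
    then have "x q \<in> ball (x p) e" "q \<in> U" using e by auto
    with h(3)[of "x q"] show "f q = ?g q"
      using q U e c(3,4) chart_inv[OF M U(1)] by (auto simp: H_def inner_diff_left subset_iff)
  qed
  also have "\<dots> = v (\<lambda>q. \<Sum>b\<in>Basis. (c b q - c b p) * H b q)"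
    using tangent_add[OF v Cinf_const s] tangent_const[OF v] by simp
  also have "\<dots> = (\<Sum>b\<in>Basis. v (\<lambda>q. (c b q - c b p) * H b q))"
    by (rule tangent_sum[OF v dH])
  also have "\<dots> = (\<Sum>b\<in>Basis. v (c b) * dirD b ?f (x p))"
  proof (rule sum.cong)
    fix b :: 'e assume b: "b \<in> Basis"
    have "v (\<lambda>q. c b q - c b p) = v (c b)"
      using tangent_diff[OF v c(1)[OF b] Cinf_const] tangent_const[OF v] by simp
    then show "v (\<lambda>q. (c b q - c b p) * H b q) = v (c b) * dirD b ?f (x p)"
      using tangent_mult[OF v d[OF b] H] e(4,8) h(2) by (simp add: H_def)
  qed simp
  finally show ?thesis .
qed

text \<open>The factor \<open>k\<close> leaves room for the value at \<open>q\<close> of the cutoff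
  by which a coordinate field is extended to the whole manifold.\<close>

lemma chart_derivation:
  assumes M: "smooth_manifold A" and U: "(U, x) \<in> A" "q \<in> U"
  shows "(\<lambda>f. if f \<in> Cinf A then k * dirD b (\<lambda>z. f (inv_into U x z)) (x q) else 0) \<in> tangent A q"
proof -
  have "x q \<in> x ` U" using U by blast
  then show ?thesis
    unfolding tangent_def using chart_inv[OF M U]
    by (auto simp: Cinf_add Cinf_mult Cinf_scale dirD_add[OF Cinf_chart Cinf_chart, OF _ U(1) _ U(1)]
        dirD_mult[OF Cinf_chart Cinf_chart, OF _ U(1) _ U(1)]
        dirD_mult[OF smooth_on_const Cinf_chart, OF _ U(1)] dirD_const algebra_simps)
qed

text \<open>Coordinates and coordinate fields live on a chart, whereas derivations and
  \<open>vfields\<close> know only global objects. Both are multiplied by a cutoff that is 1 on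
  \<open>W\<close>, where they keep their usual properties. Later local computations use this
  frame.\<close>

lemma chart_frame:
  fixes A :: "('a::{t2_space,second_countable_topology}, 'e::euclidean_space) atlas"
  assumes M: "smooth_manifold A" and U: "(U, x) \<in> A" and p: "p \<in> U"
  obtains W c D where "open W" "p \<in> W" "W \<subseteq> U"
    "\<forall>b. c b \<in> Cinf A" "\<forall>b. \<forall>q\<in>W. c b q = x q \<bullet> b" "\<forall>b. D b \<in> vfields A"
    "\<forall>b. \<forall>q\<in>W. \<forall>f\<in>Cinf A. D b q f = dirD b (\<lambda>z. f (inv_into U x z)) (x q)"
    "\<forall>q\<in>W. \<forall>v\<in>tangent A q. \<forall>f. v f = (\<Sum>b\<in>Basis. v (c b) * D b q f)"
    "\<forall>q\<in>W. \<forall>b\<in>Basis. \<forall>b'\<in>Basis. D b q (c b') = (if b = b' then 1 else 0)"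
proof -
  obtain e W \<rho> where e: "e > 0" "ball (x p) e \<subseteq> x ` U" "open W" "p \<in> W" "W \<subseteq> U" "W \<subseteq> UNIV" "x ` W \<subseteq> ball (x p) e"
    "\<forall>q\<in>W. \<rho> q = 1" "\<forall>q. q \<notin> U \<inter> UNIV \<longrightarrow> \<rho> q = 0"
    "\<forall>\<phi>. smooth_on (ball (x p) e) \<phi> \<longrightarrow> (\<lambda>q. \<rho> q * \<phi> (x q)) \<in> Cinf A"
    by (rule chart_cutoff[OF M U open_UNIV p UNIV_I]) (rule that; assumption)
  note e = e(1-7) e(8-10)[rule_format]
  define c where "c b = (\<lambda>q. \<rho> q * (x q \<bullet> b))" for b
  define D where "D b q = (\<lambda>f. if f \<in> Cinf A then \<rho> q * dirD b (\<lambda>z. f (inv_into U x z)) (x q) else 0)" for b q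
  have c: "c b \<in> Cinf A" for b unfolding c_def
    by (rule e(10)) (intro smooth_on_inner smooth_on_id smooth_on_const)
  have cW: "c b q = x q \<bullet> b" if "q \<in> W" for b q using that e(8) by (simp add: c_def)
  have Dt: "D b q \<in> tangent A q" for b q
  proof (cases "q \<in> U")
    case True
    then show ?thesis unfolding D_def by (rule chart_derivation[OF M U])
  next
    case False
    then have "D b q = tzero" using e(9) by (simp add: D_def tzero_def fun_eq_iff)
    then show ?thesis by (simp add: tangent_tzero)
  qed
  have DW: "D b q f = dirD b (\<lambda>z. f (inv_into U x z)) (x q)" if "q \<in> W" "f \<in> Cinf A" for b q f
    using that e(8) by (simp add: D_def)
  have xW: "open (x ` W)" by (rule chart_open_map[OF M U e(3,5)])
  have 1: "D b \<in> vfields A" for b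
    unfolding vfields_def
    proof (intro CollectI conjI ballI)
      fix f assume f: "f \<in> Cinf A"
      have "smooth_on (ball (x p) e) (dirD b (\<lambda>z. f (inv_into U x z)))"
        by (rule smooth_on_subset[OF smooth_on_dirD e(2)])
          (use Cinf_chart[OF f U] chart_open_image[OF M U] in auto)
      from e(10)[OF this] show "(\<lambda>q. D b q f) \<in> Cinf A" using f by (simp add: D_def)
    qed (rule Dt)
  have 2: "v f = (\<Sum>b\<in>Basis. v (c b) * D b q f)" if q: "q \<in> W" and v: "v \<in> tangent A q" for q v f
    proof (cases "f \<in> Cinf A")
      case True
      have "v f = (\<Sum>b\<in>Basis. v (c b) * dirD b (\<lambda>z. f (inv_into U x z)) (x q))"
        by (rule tangent_coords[OF M U _ v True c e(3) q]) (use q e cW in auto)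
      then show ?thesis using DW[OF q True] by simp
    next
      case False
      then show ?thesis using tangent_notin[OF v] by (simp add: D_def)
    qed
  have 3: "D b q (c b') = (if b = b' then 1 else 0)" if q: "q \<in> W" and b: "b \<in> Basis" "b' \<in> Basis" for q b b'
    proof -
      have "D b q (c b') = dirD b (\<lambda>z. c b' (inv_into U x z)) (x q)" by (rule DW[OF q c])
      also have "\<dots> = dirD b (\<lambda>z. z \<bullet> b') (x q)"
        by (rule dirD_cong[OF xW, symmetric])
          (use q e cW chart_inv[OF M U] in \<open>auto intro!: smooth_on_inner smooth_on_id smooth_on_const\<close>)
      also have "\<dots> = b \<bullet> b'" by (rule dirD_linear[OF bounded_linear_inner_left])
      finally show ?thesis using b by (simp add: inner_Basis)
    qed
  show ?thesis
    by (rule that[of W c D]) (intro ballI allI e c cW 1 DW 2 3; assumption)+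
qed

lemma vfields_add: "X \<in> vfields A \<Longrightarrow> Y \<in> vfields A \<Longrightarrow> (\<lambda>q. tadd (X q) (Y q)) \<in> vfields A"
  unfolding vfields_def by (auto simp: tangent_tadd) (simp add: tadd_def Cinf_add)

lemma vfields_scale: "X \<in> vfields A \<Longrightarrow> f \<in> Cinf A \<Longrightarrow> (\<lambda>q. tscale (f q) (X q)) \<in> vfields A"
  unfolding vfields_def by (auto simp: tangent_tscale) (simp add: tscale_def Cinf_mult)

lemma vfields_sum:
  assumes "\<And>i. i \<in> I \<Longrightarrow> X i \<in> vfields A"
  shows "(\<lambda>q f. \<Sum>i\<in>I. k i * X i q f) \<in> vfields A"
  using assms
proof (induction I rule: infinite_finite_induct)
  case (insert j I)
  then have "(\<lambda>q. tadd (tscale (k j) (X j q)) (\<lambda>f. \<Sum>i\<in>I. k i * X i q f)) \<in> vfields A"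
    using vfields_scale[OF _ Cinf_const] by (intro vfields_add) auto
  with insert show ?case by (simp add: tadd_def tscale_def)
qed (simp_all add: vfields_def Cinf_const tangent_tzero[unfolded tzero_def])

text \<open>The frame fields are combined with the components of \<open>v\<close> as constant
  coefficients. The lemma turns facts on vector fields into facts on single tangent vectors.\<close>

lemma tangent_extend:
  fixes A :: "('a::{t2_space,second_countable_topology}, 'e::euclidean_space) atlas"
  assumes M: "smooth_manifold A" and p: "p \<in> mcarrier A" and v: "v \<in> tangent A p"
  obtains X where "X \<in> vfields A" "X p = v"
proof -
  obtain U x where U: "(U, x) \<in> A" "p \<in> U" using p by (auto elim: mcarrier_E)
  obtain W c D where W: "p \<in> W" "\<forall>b. D b \<in> vfields A"
    "\<forall>q\<in>W. \<forall>v\<in>tangent A q. \<forall>f. v f = (\<Sum>b\<in>(Basis :: 'e set). v (c b) * D b q f)"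
    by (rule chart_frame[OF M U]) (rule that; assumption)
  show ?thesis
  proof (rule that)
    show "(\<lambda>q f. \<Sum>b\<in>(Basis :: 'e set). v (c b) * D b q f) \<in> vfields A"
      using W(2) by (intro vfields_sum) blast
  qed (use W v in \<open>auto simp: fun_eq_iff\<close>)
qed

section \<open>The product of a manifold with an open set of reals\<close>

text \<open>The set \<open>I\<close> is a parameter because two cases occur: \<open>{0<..}\<close>
  for the cone and the whole line for the domain of a flow.\<close>

definition cyl :: "('a, 'e) atlas \<Rightarrow> real set \<Rightarrow> ('a \<times> real, 'e \<times> real) atlas" where
  "cyl A I = prod_atlas A {(I, id)}"

lemma cyl_I: "(U, x) \<in> A \<Longrightarrow> (U \<times> I, map_prod x id) \<in> cyl A I"
  unfolding cyl_def prod_atlas_def by blast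

lemma cyl_E:
  assumes "(W, z) \<in> cyl A I"
  obtains U x where "(U, x) \<in> A" "W = U \<times> I" "z = map_prod x id"
  using assms unfolding cyl_def prod_atlas_def by blast

lemma mcarrier_cyl: "mcarrier (cyl A I) = mcarrier A \<times> I"
proof -
  have "fst ` cyl A I = (\<lambda>U. U \<times> I) ` fst ` A"
    unfolding cyl_def prod_atlas_def by (force simp: image_iff)
  then show ?thesis unfolding mcarrier_def by auto
qed

lemma cyl_image: "map_prod x id ` (U \<times> I) = x ` U \<times> I"
  by (rule map_prod_surj_on) auto

lemma cyl_inv:
  assumes "smooth_manifold A" "(U, x) \<in> A" "z \<in> x ` U \<times> I"
  shows "inv_into (U \<times> I) (map_prod x id) z = (inv_into U x (fst z), snd z)"
proof -
  have inj: "inj_on x U" using chart_inv[OF assms(1,2)] by (metis inj_on_inverseI)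
  have "inj_on (map_prod x id) (U \<times> I)" by (rule map_prod_inj_on[OF inj]) simp
  moreover obtain q where "q \<in> U" "fst z = x q" "snd z \<in> I" using assms(3) by auto
  ultimately have "inv_into (U \<times> I) (map_prod x id) (map_prod x id (q, snd z)) = (q, snd z)"
    by (intro inv_into_f_f) auto
  then show ?thesis using \<open>q \<in> U\<close> \<open>fst z = x q\<close> chart_inv[OF assms(1,2)] by (cases z) auto
qed

lemma smooth_on_cyl_inv:
  assumes "smooth_manifold A" "(U, x) \<in> A" "open T" "T \<subseteq> x ` U \<times> I"
  shows "smooth_on T (\<lambda>z. F (inv_into (U \<times> I) (map_prod x id) z)) \<longleftrightarrow>
    smooth_on T (\<lambda>z. F (inv_into U x (fst z), snd z))"
proof -
  have "F (inv_into (U \<times> I) (map_prod x id) z) = F (inv_into U x (fst z), snd z)" if "z \<in> T" for z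
    using cyl_inv[OF assms(1,2) subsetD[OF assms(4) that]] by simp
  then show ?thesis using smooth_on_cong[OF _ assms(3)] by (metis (no_types, lifting))
qed

lemma smooth_manifold_cyl:
  assumes M: "smooth_manifold A" and I: "open I"
  shows "smooth_manifold (cyl A I)"
  unfolding smooth_manifold_def
proof (intro conjI ballI; clarify)
  fix W :: "('a \<times> real) set" and z :: "'a \<times> real \<Rightarrow> 'b \<times> real" assume "(W, z) \<in> cyl A I"
  then obtain U x where U: "(U, x) \<in> A" "W = U \<times> I" "z = map_prod x id" by (rule cyl_E)
  have c1: "continuous_on U x" and c2: "continuous_on (x ` U) (inv_into U x)"
    using chart_homeomorphism[OF M U(1)] unfolding homeomorphism_def by blast+
  have "homeomorphism W (z ` W) z (inv_into W z)"
    unfolding U(2,3) cyl_image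
  proof (rule homeomorphismI)
    show "continuous_on (U \<times> I) (map_prod x id)"
      unfolding map_prod_def case_prod_beta id_apply
      by (intro continuous_on_Pair continuous_on_snd continuous_on_id
          continuous_on_compose2[OF c1 continuous_on_fst[OF continuous_on_id]]) auto
    have "continuous_on (x ` U \<times> I) (\<lambda>z. (inv_into U x (fst z), snd z))"
      by (intro continuous_on_Pair continuous_on_snd continuous_on_id
          continuous_on_compose2[OF c2 continuous_on_fst[OF continuous_on_id]]) auto
    then show "continuous_on (x ` U \<times> I) (inv_into (U \<times> I) (map_prod x id))"
      by (rule continuous_on_eq) (rule cyl_inv[OF M U(1), symmetric])
  qed (use cyl_inv[OF M U(1)] chart_inv[OF M U(1)] in \<open>auto simp: cyl_inv[OF M U(1)]\<close>)
  then show "open W \<and> open (z ` W) \<and> homeomorphism W (z ` W) z (inv_into W z)"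
    unfolding U(2,3) cyl_image using I chart_open[OF M U(1)] chart_open_image[OF M U(1)]
    by (auto intro: open_Times)
next
  fix W W' :: "('a \<times> real) set" and z z' :: "'a \<times> real \<Rightarrow> 'b \<times> real"
  assume "(W, z) \<in> cyl A I" "(W', z') \<in> cyl A I"
  obtain U x where U: "(U, x) \<in> A" "W = U \<times> I" "z = map_prod x id"
    using \<open>(W, z) \<in> cyl A I\<close> by (rule cyl_E)
  obtain V y where V: "(V, y) \<in> A" "W' = V \<times> I" "z' = map_prod y id"
    using \<open>(W', z') \<in> cyl A I\<close> by (rule cyl_E)
  have WW: "z ` (W \<inter> W') = x ` (U \<inter> V) \<times> I"
    unfolding U(2,3) V(2) by (simp add: Times_Int_Times cyl_image)
  have o: "open (x ` (U \<inter> V) \<times> I)"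
    by (intro open_Times I chart_open_map[OF M U(1)])
      (use chart_open[OF M U(1)] chart_open[OF M V(1)] in auto)
  have "smooth_on (x ` (U \<inter> V) \<times> I) (\<lambda>z. (y (inv_into U x (fst z)), snd z))"
    by (intro smooth_on_Pair smooth_on_snd smooth_on_id
        smooth_on_compose[OF chart_transition[OF M U(1) V(1)] smooth_on_fst[OF smooth_on_id]]) auto
  then have "smooth_on (z ` (W \<inter> W')) (\<lambda>p. z' (inv_into W z p))"
    unfolding WW by (rule smooth_on_cong[OF _ o])
      (use cyl_inv[OF M U(1)] in \<open>auto simp: U V cyl_inv[OF M U(1)]\<close>)
  then show "smooth_on (z ` (W \<inter> W')) (z' \<circ> inv_into W z)" by (simp add: comp_def)
qed

lemma Cinf_cyl_chart:
  assumes "smooth_manifold A" "open I" "F \<in> Cinf (cyl A I)" "(U, x) \<in> A"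
  shows "smooth_on (x ` U \<times> I) (\<lambda>z. F (inv_into U x (fst z), snd z))"
  using Cinf_chart[OF assms(3) cyl_I[OF assms(4)]]
    smooth_on_cyl_inv[OF assms(1,4), of "x ` U \<times> I" I F] chart_open_image[OF assms(1,4)] assms(2)
  by (simp add: cyl_image open_Times)

lemma Cinf_cyl_I:
  assumes "smooth_manifold A" "open I"
    and "\<And>U x. (U, x) \<in> A \<Longrightarrow> smooth_on (x ` U \<times> I) (\<lambda>z. F (inv_into U x (fst z), snd z))"
  shows "F \<in> Cinf (cyl A I)"
proof (rule Cinf_I)
  fix W :: "('a \<times> real) set" and z :: "'a \<times> real \<Rightarrow> 'b \<times> real" assume "(W, z) \<in> cyl A I"
  then obtain U x where U: "(U, x) \<in> A" "W = U \<times> I" "z = map_prod x id" by (rule cyl_E)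
  show "smooth_on (z ` W) (\<lambda>p. F (inv_into W z p))"
    unfolding U(2,3) cyl_image
    by (subst smooth_on_cyl_inv[OF assms(1) U(1)])
      (use chart_open_image[OF assms(1) U(1)] assms(2) assms(3)[OF U(1)] in \<open>auto intro: open_Times\<close>)
qed

lemma Cinf_slice:
  assumes "smooth_manifold A" "open I" "F \<in> Cinf (cyl A I)" "t \<in> I"
  shows "(\<lambda>q. F (q, t)) \<in> Cinf A"
proof (rule Cinf_I)
  fix U x assume U: "(U, x) \<in> A"
  have "smooth_on (x ` U) (\<lambda>y. (\<lambda>z. F (inv_into U x (fst z), snd z)) (y, t))"
    by (rule smooth_on_compose[OF Cinf_cyl_chart[OF assms(1-3) U]])
      (use assms(4) in \<open>auto intro!: smooth_on_Pair smooth_on_id smooth_on_const\<close>)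
  then show "smooth_on (x ` U) (\<lambda>y. F (inv_into U x y, t))" by simp
qed

lemma Cinf_fst:
  assumes "smooth_manifold A" "open I" "f \<in> Cinf A"
  shows "(\<lambda>z. f (fst z)) \<in> Cinf (cyl A I)"
proof (rule Cinf_cyl_I[OF assms(1,2)])
  fix U x assume U: "(U, x) \<in> A"
  show "smooth_on (x ` U \<times> I) (\<lambda>z. f (fst (inv_into U x (fst z), snd z)))"
    unfolding fst_conv
    by (rule smooth_on_compose[OF Cinf_chart[OF assms(3) U] smooth_on_fst[OF smooth_on_id]]) auto
qed

lemma Cinf_snd:
  assumes "smooth_manifold A" "open I"
  shows "snd \<in> Cinf (cyl A I)"
  by (rule Cinf_cyl_I[OF assms]) (simp add: smooth_on_snd smooth_on_id)

lemma dirD_slice: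
  assumes "smooth_on S F" "(y, t) \<in> S"
  shows "dirD b (\<lambda>y. F (y, t)) y = dirD (b, 0) F (y, t)"
proof -
  have "((\<lambda>y. F (y, t)) has_derivative (\<lambda>h. frechet_derivative F (at (y, t)) (h, 0))) (at y)"
    by (rule has_derivative_compose[where f="\<lambda>y. (y, t)", OF _ smooth_on_has_derivative[OF assms]])
      (auto intro!: derivative_eq_intros)
  from dirD_unique[OF this] show ?thesis by (simp add: dirD_def)
qed

lemma dirD_slice_snd:
  assumes "smooth_on S F" "(y, t) \<in> S"
  shows "((\<lambda>s. F (y, s)) has_real_derivative dirD (0, 1) F (y, t)) (at t)"
  using dirD_line[OF assms(1), of "(y, 0)" t "(0, 1)"] assms(2) by simp

section \<open>The derivative along the real factor\<close>

definition dt :: "('a \<times> real \<Rightarrow> real) \<Rightarrow> 'a \<times> real \<Rightarrow> real" where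
  "dt F z = deriv (\<lambda>s. F (fst z, s)) (snd z)"

lemma dt_chart:
  assumes "smooth_manifold A" "open I" "F \<in> Cinf (cyl A I)" "(U, x) \<in> A" "p \<in> U" "t \<in> I"
  shows "((\<lambda>s. F (p, s)) has_real_derivative dirD (0, 1) (\<lambda>z. F (inv_into U x (fst z), snd z)) (x p, t)) (at t)"
    and "dt F (p, t) = dirD (0, 1) (\<lambda>z. F (inv_into U x (fst z), snd z)) (x p, t)"
proof -
  show d: "((\<lambda>s. F (p, s)) has_real_derivative dirD (0, 1) (\<lambda>z. F (inv_into U x (fst z), snd z)) (x p, t)) (at t)"
    using dirD_slice_snd[OF Cinf_cyl_chart[OF assms(1-4)], of "x p" t] assms(5,6)
      chart_inv[OF assms(1,4,5)] by simp
  show "dt F (p, t) = dirD (0, 1) (\<lambda>z. F (inv_into U x (fst z), snd z)) (x p, t)"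
    unfolding dt_def using DERIV_imp_deriv[OF d] by simp
qed

lemma dt_has_derivative:
  assumes "smooth_manifold A" "open I" "F \<in> Cinf (cyl A I)" "p \<in> mcarrier A" "t \<in> I"
  shows "((\<lambda>s. F (p, s)) has_real_derivative dt F (p, t)) (at t)"
proof -
  obtain U x where "(U, x) \<in> A" "p \<in> U" using assms(4) by (rule mcarrier_E)
  then show ?thesis using dt_chart[OF assms(1-3) _ _ assms(5)] by simp
qed

lemma Cinf_dt:
  assumes "smooth_manifold A" "open I" "F \<in> Cinf (cyl A I)"
  shows "dt F \<in> Cinf (cyl A I)"
proof (rule Cinf_cyl_I[OF assms(1,2)])
  fix U x assume U: "(U, x) \<in> A"
  have o: "open (x ` U \<times> I)" using chart_open_image[OF assms(1) U] assms(2) by (rule open_Times)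
  show "smooth_on (x ` U \<times> I) (\<lambda>z. dt F (inv_into U x (fst z), snd z))"
    by (rule smooth_on_cong[OF smooth_on_dirD[OF Cinf_cyl_chart[OF assms U] o] o])
      (use dt_chart(2)[OF assms U] chart_inv[OF assms(1) U] in auto)
qed

text \<open>The field acts on each slice of \<open>F\<close>; joint smoothness is seen in the local
  frame, where the result is the sum of the components \<open>X q (c b)\<close> times the
  derivatives of \<open>F\<close> in the directions \<open>(b, 0)\<close>.\<close>

lemma Cinf_lift:
  assumes M: "smooth_manifold A" and I: "open I" and X: "X \<in> vfields A" and F: "F \<in> Cinf (cyl A I)"
  shows "(\<lambda>z. X (fst z) (\<lambda>q. F (q, snd z))) \<in> Cinf (cyl A I)"
proof (rule Cinf_I_local[OF smooth_manifold_cyl[OF M I]])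
  fix z assume "z \<in> mcarrier (cyl A I)"
  then have z: "fst z \<in> mcarrier A" "snd z \<in> I" by (auto simp: mcarrier_cyl)
  obtain U x where U: "(U, x) \<in> A" "fst z \<in> U" using z(1) by (rule mcarrier_E)
  obtain W c D where W: "open W" "fst z \<in> W" "W \<subseteq> U"
    "\<forall>b. c b \<in> Cinf A"
    "\<forall>b. \<forall>q\<in>W. \<forall>f\<in>Cinf A. D b q f = dirD b (\<lambda>z. f (inv_into U x z)) (x q)"
    "\<forall>q\<in>W. \<forall>v\<in>tangent A q. \<forall>f. v f = (\<Sum>b\<in>(Basis :: 'b set). v (c b) * D b q f)"
    by (rule chart_frame[OF M U]) (rule that; assumption)
  let ?F = "\<lambda>z. F (inv_into U x (fst z), snd z)"
  note sF = Cinf_cyl_chart[OF M I F U(1)]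
  have oU: "open (x ` U \<times> I)" using chart_open_image[OF M U(1)] I by (rule open_Times)
  have o: "open (x ` W \<times> I)" using chart_open_map[OF M U(1) W(1,3)] I by (rule open_Times)
  have sub: "x ` W \<times> I \<subseteq> x ` U \<times> I" using W(3) by auto
  have "smooth_on (x ` W \<times> I) (\<lambda>z. \<Sum>b\<in>(Basis :: 'b set). (\<lambda>q. X q (c b)) (inv_into U x (fst z)) * dirD (b, 0) ?F z)"
  proof (intro smooth_on_sum smooth_on_mult)
    fix b :: 'b
    have "smooth_on (x ` U) (\<lambda>y. X (inv_into U x y) (c b))"
      using Cinf_chart[OF vfields_Cinf[OF X] U(1)] W(4) by blast
    then show "smooth_on (x ` W \<times> I) (\<lambda>z. X (inv_into U x (fst z)) (c b))"
      by (rule smooth_on_compose[OF _ smooth_on_fst[OF smooth_on_id]]) (use sub in auto)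
    show "smooth_on (x ` W \<times> I) (dirD (b, 0) ?F)"
      by (rule smooth_on_subset[OF smooth_on_dirD[OF sF oU] sub])
  qed
  then have "smooth_on (x ` W \<times> I) (\<lambda>z. (\<lambda>z. X (fst z) (\<lambda>q. F (q, snd z))) (inv_into (U \<times> I) (map_prod x id) z))"
  proof (rule smooth_on_cong[OF _ o])
    fix y assume y: "y \<in> x ` W \<times> I"
    then obtain q t where q: "q \<in> W" "y = (x q, t)" "t \<in> I" by auto
    then have qU: "q \<in> U" using W(3) by auto
    then have iq: "inv_into U x (x q) = q" by (rule chart_inv[OF M U(1)])
    have "X q \<in> tangent A q" using vfields_tangent[OF X mcarrier_I[OF U(1) qU]] .
    then have "X q (\<lambda>q. F (q, t)) = (\<Sum>b\<in>(Basis :: 'b set). X q (c b) * D b q (\<lambda>q. F (q, t)))"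
      using W(6) q(1) by blast
    also have "\<dots> = (\<Sum>b\<in>(Basis :: 'b set). X q (c b) * dirD (b, 0) ?F (x q, t))"
      using W(5) q(1) Cinf_slice[OF M I F q(3)] dirD_slice[OF sF, of "x q" t] qU q(3) by simp
    finally show "(\<Sum>b\<in>(Basis :: 'b set). X (inv_into U x (fst y)) (c b) * dirD (b, 0) ?F y) =
        (\<lambda>z. X (fst z) (\<lambda>q. F (q, snd z))) (inv_into (U \<times> I) (map_prod x id) y)"
      using cyl_inv[OF M U(1), of "(x q, t)" I] qU iq q by simp
  qed
  then show "\<exists>V y W'. (V, y) \<in> cyl A I \<and> open W' \<and> z \<in> W' \<and> W' \<subseteq> V \<and>
      smooth_on (y ` W') (\<lambda>p. X (fst (inv_into V y p)) (\<lambda>q. F (q, snd (inv_into V y p))))"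
    using cyl_I[OF U(1), of I] W(1-3) I z
    by (intro exI[of _ "U \<times> I"] exI[of _ "map_prod x id"] exI[of _ "W \<times> I"])
      (auto simp: cyl_image open_Times mem_Times_iff)
qed

text \<open>At a fixed point \<open>v\<close> is a fixed linear combination of derivatives in the
  directions \<open>(b, 0)\<close>, and these commute with the derivative in direction
  \<open>(0, 1)\<close>. This serves both for the bracket of the Euler field with a lift and for
  differentiating a pushforward along a flow.\<close>

lemma tangent_dt_commute:
  assumes M: "smooth_manifold A" and I: "open I" and p: "p \<in> mcarrier A" and v: "v \<in> tangent A p"
    and F: "F \<in> Cinf (cyl A I)" and t: "t \<in> I"
  shows "((\<lambda>s. v (\<lambda>q. F (q, s))) has_real_derivative v (\<lambda>q. dt F (q, t))) (at t)"
proof -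
  obtain U x where U: "(U, x) \<in> A" "p \<in> U" using p by (rule mcarrier_E)
  obtain W c D where W: "p \<in> W"
    "\<forall>b. \<forall>q\<in>W. \<forall>f\<in>Cinf A. D b q f = dirD b (\<lambda>z. f (inv_into U x z)) (x q)"
    "\<forall>q\<in>W. \<forall>v\<in>tangent A q. \<forall>f. v f = (\<Sum>b\<in>(Basis :: 'b set). v (c b) * D b q f)"
    by (rule chart_frame[OF M U]) (rule that; assumption)
  let ?F = "\<lambda>z. F (inv_into U x (fst z), snd z)"
  note sF = Cinf_cyl_chart[OF M I F U(1)]
  have oU: "open (x ` U \<times> I)" using chart_open_image[OF M U(1)] I by (rule open_Times)
  have mem: "(x p, s) \<in> x ` U \<times> I" if "s \<in> I" for s using that U by auto
  have e: "v (\<lambda>q. G (q, s)) = (\<Sum>b\<in>(Basis :: 'b set). v (c b) * dirD (b, 0) (\<lambda>z. G (inv_into U x (fst z), snd z)) (x p, s))"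
    if s: "s \<in> I" and G: "G \<in> Cinf (cyl A I)" for s G
  proof -
    have "v (\<lambda>q. G (q, s)) = (\<Sum>b\<in>(Basis :: 'b set). v (c b) * D b p (\<lambda>q. G (q, s)))"
      using W(1,3) v by blast
    also have "\<dots> = (\<Sum>b\<in>(Basis :: 'b set). v (c b) * dirD (b, 0) (\<lambda>z. G (inv_into U x (fst z), snd z)) (x p, s))"
      using W(1,2) Cinf_slice[OF M I G s] dirD_slice[OF Cinf_cyl_chart[OF M I G U(1)] mem[OF s]] by simp
    finally show ?thesis .
  qed
  have "((\<lambda>s. \<Sum>b\<in>(Basis :: 'b set). v (c b) * dirD (b, 0) ?F (x p, s)) has_real_derivative
      (\<Sum>b\<in>(Basis :: 'b set). v (c b) * dirD (0, 1) (dirD (b, 0) ?F) (x p, t))) (at t)"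
    by (intro DERIV_sum DERIV_cmult dirD_slice_snd[OF smooth_on_dirD[OF sF oU] mem[OF t]])
  then have "((\<lambda>s. v (\<lambda>q. F (q, s))) has_real_derivative
      (\<Sum>b\<in>(Basis :: 'b set). v (c b) * dirD (0, 1) (dirD (b, 0) ?F) (x p, t))) (at t)"
    by (rule has_field_derivative_transform_within_open[OF _ I t]) (simp add: e F)
  also have "(\<Sum>b\<in>(Basis :: 'b set). v (c b) * dirD (0, 1) (dirD (b, 0) ?F) (x p, t)) =
      (\<Sum>b\<in>(Basis :: 'b set). v (c b) * dirD (b, 0) (dirD (0, 1) ?F) (x p, t))"
    using dirD_commute[OF oU sF mem[OF t]] by simp
  also have "\<dots> = (\<Sum>b\<in>(Basis :: 'b set). v (c b) * dirD (b, 0) (\<lambda>z. dt F (inv_into U x (fst z), snd z)) (x p, t))"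
  proof (rule sum.cong)
    fix b :: 'b
    have "dirD (b, 0) (dirD (0, 1) ?F) (x p, t) = dirD (b, 0) (\<lambda>z. dt F (inv_into U x (fst z), snd z)) (x p, t)"
      by (rule dirD_cong[OF oU mem[OF t] smooth_on_dirD[OF sF oU]])
        (use dt_chart(2)[OF M I F U(1)] chart_inv[OF M U(1)] in auto)
    then show "v (c b) * dirD (b, 0) (dirD (0, 1) ?F) (x p, t) =
        v (c b) * dirD (b, 0) (\<lambda>z. dt F (inv_into U x (fst z), snd z)) (x p, t)" by simp
  qed simp
  also have "\<dots> = v (\<lambda>q. dt F (q, t))" using e[OF t Cinf_dt[OF M I F]] by simp
  finally show ?thesis .
qed

lemma pushforward_fst_tangent:
  assumes "smooth_manifold A" "open I" "v \<in> tangent (cyl A I) (p, t)"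
  shows "pushforward A fst v \<in> tangent A p"
  unfolding tangent_def pushforward_def comp_def
  using tangent_add[OF assms(3) Cinf_fst[OF assms(1,2)] Cinf_fst[OF assms(1,2)]]
    tangent_mult[OF assms(3) Cinf_fst[OF assms(1,2)] Cinf_fst[OF assms(1,2)]]
    tangent_scale[OF assms(3) Cinf_fst[OF assms(1,2)]]
  by (auto simp: Cinf_add Cinf_mult Cinf_scale)

text \<open>The expansion of \<open>v\<close> in the product chart is sorted by directions: those of
  the form \<open>(b, 0)\<close> reassemble to the pushforward to \<open>A\<close>, and
  \<open>(0, 1)\<close> contributes the derivative in the real variable.\<close>

lemma tangent_cyl_split:
  fixes A :: "('a::{t2_space,second_countable_topology}, 'e::euclidean_space) atlas"
  assumes M: "smooth_manifold A" and I: "open I" and p: "p \<in> mcarrier A" "t \<in> I"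
    and v: "v \<in> tangent (cyl A I) (p, t)" and F: "F \<in> Cinf (cyl A I)"
  shows "v F = pushforward A fst v (\<lambda>q. F (q, t)) + v snd * dt F (p, t)"
proof -
  obtain U x where U: "(U, x) \<in> A" "p \<in> U" using p(1) by (rule mcarrier_E)
  obtain W c D where W: "open W" "p \<in> W" "W \<subseteq> U"
    "\<forall>b. c b \<in> Cinf A" "\<forall>b. \<forall>q\<in>W. c b q = x q \<bullet> b"
    "\<forall>b. \<forall>q\<in>W. \<forall>f\<in>Cinf A. D b q f = dirD b (\<lambda>z. f (inv_into U x z)) (x q)"
    "\<forall>q\<in>W. \<forall>v\<in>tangent A q. \<forall>f. v f = (\<Sum>b\<in>(Basis :: 'e set). v (c b) * D b q f)"
    by (rule chart_frame[OF M U]) (rule that; assumption)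
  let ?F = "\<lambda>z. F (inv_into U x (fst z), snd z)"
  note sF = Cinf_cyl_chart[OF M I F U(1)]
  have oU: "open (x ` U \<times> I)" using chart_open_image[OF M U(1)] I by (rule open_Times)
  have mem: "(x p, t) \<in> x ` U \<times> I" using U p by auto
  \<comment> \<open>The basis of the product consists of the \<open>(b, 0)\<close> and of
    \<open>(0, 1)\<close>; the test \<open>snd \<beta> = 0\<close> tells them apart, and
    \<open>C \<beta>\<close> is the coordinate belonging to \<open>\<beta>\<close>.\<close>
  define C where "C \<beta> = (if snd \<beta> = 0 then (\<lambda>z. c (fst \<beta>) (fst z)) else snd)" for \<beta> :: "'e \<times> real"
  have B: "sum f (Basis :: ('e \<times> real) set) = (\<Sum>b\<in>Basis. f (b, 0)) + f (0, 1)" for f :: "'e \<times> real \<Rightarrow> real"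
  proof -
    have "inj_on (\<lambda>u. (u, 0 :: real)) (Basis :: 'e set)" by (auto intro: inj_onI)
    then show ?thesis unfolding Basis_prod_def
      by (subst sum.union_disjoint) (auto simp: sum.reindex)
  qed
  have "v F = (\<Sum>\<beta>\<in>Basis. v (C \<beta>) * dirD \<beta> (\<lambda>z. F (inv_into (U \<times> I) (map_prod x id) z)) (map_prod x id (p, t)))"
  proof (rule tangent_coords[OF smooth_manifold_cyl[OF M I] cyl_I[OF U(1)] _ v F])
    show "C \<beta> \<in> Cinf (cyl A I)" for \<beta>
      using Cinf_fst[OF M I, of "c (fst \<beta>)"] Cinf_snd[OF M I] W(4) by (simp add: C_def)
    show "open (W \<times> I)" using W(1) I by (rule open_Times)
    show "C \<beta> z = map_prod x id z \<bullet> \<beta>" if "\<beta> \<in> Basis" "z \<in> W \<times> I" for \<beta> z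
      using that W(5) unfolding C_def Basis_prod_def by (auto simp: inner_prod_def)
  qed (use U p W in auto)
  also have "\<dots> = (\<Sum>\<beta>\<in>Basis. v (C \<beta>) * dirD \<beta> ?F (x p, t))"
  proof (rule sum.cong)
    fix \<beta> :: "'e \<times> real"
    have "dirD \<beta> ?F (x p, t) = dirD \<beta> (\<lambda>z. F (inv_into (U \<times> I) (map_prod x id) z)) (x p, t)"
      by (rule dirD_cong[OF oU mem sF]) (simp only: cyl_inv[OF M U(1)])
    then show "v (C \<beta>) * dirD \<beta> (\<lambda>z. F (inv_into (U \<times> I) (map_prod x id) z)) (map_prod x id (p, t)) =
        v (C \<beta>) * dirD \<beta> ?F (x p, t)" by simp
  qed simp
  also have "\<dots> = (\<Sum>b\<in>Basis. v (\<lambda>z. c b (fst z)) * dirD (b, 0) ?F (x p, t)) + v snd * dirD (0, 1) ?F (x p, t)"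
    by (simp add: B C_def)
  also have "dirD (0, 1) ?F (x p, t) = dt F (p, t)"
    using dt_chart(2)[OF M I F U p(2)] by simp
  also have "(\<Sum>b\<in>Basis. v (\<lambda>z. c b (fst z)) * dirD (b, 0) ?F (x p, t)) = pushforward A fst v (\<lambda>q. F (q, t))"
  proof -
    have "pushforward A fst v (\<lambda>q. F (q, t)) =
        (\<Sum>b\<in>(Basis :: 'e set). pushforward A fst v (c b) * D b p (\<lambda>q. F (q, t)))"
      using W(2,7) pushforward_fst_tangent[OF M I v] by blast
    also have "\<dots> = (\<Sum>b\<in>(Basis :: 'e set). v (\<lambda>z. c b (fst z)) * dirD (b, 0) ?F (x p, t))"
      using W(2,4,6) Cinf_slice[OF M I F p(2)] dirD_slice[OF sF mem]
      by (simp add: pushforward_def comp_def)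
    finally show ?thesis ..
  qed
  finally show ?thesis .
qed

section \<open>Exterior derivatives and vanishing forms\<close>

lemma tangent_eqI:
  assumes "v \<in> tangent A p" "w \<in> tangent A p" "\<And>f. f \<in> Cinf A \<Longrightarrow> v f = w f"
  shows "v = w"
proof
  fix f show "v f = w f"
    using assms tangent_notin[of v A p f] tangent_notin[of w A p f] by (cases "f \<in> Cinf A") auto
qed

lemma bracket_vfields:
  assumes M: "smooth_manifold A" and X: "X \<in> vfields A" and Y: "Y \<in> vfields A"
  shows "bracket X Y \<in> vfields A"
proof -
  note Xt = vfields_tangent[OF X] and Yt = vfields_tangent[OF Y]
  note Xc = vfields_Cinf[OF X] and Yc = vfields_Cinf[OF Y]
  have "bracket X Y p \<in> tangent A p" if p: "p \<in> mcarrier A" for p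
    unfolding tangent_def bracket_def
  proof (intro CollectI conjI ballI allI impI)
    note Xg = tangent_cong[OF M p Xt[OF p]] and Yg = tangent_cong[OF M p Yt[OF p]]
    fix f :: "'a \<Rightarrow> real"
    \<comment> \<open>For a non-smooth \<open>f\<close> the function \<open>Y q f\<close> vanishes
      on the carrier but is arbitrary elsewhere; \<open>tangent_cong\<close> replaces it by the zero
      function.\<close>
    show "X p (\<lambda>q. Y q f) - Y p (\<lambda>q. X q f) = 0" if "f \<notin> Cinf A"
      using Xg[of "\<lambda>q. Y q f" "\<lambda>q. 0"] Yg[of "\<lambda>q. X q f" "\<lambda>q. 0"]
        tangent_notin[OF Xt that] tangent_notin[OF Yt that]
        tangent_const[OF Xt[OF p]] tangent_const[OF Yt[OF p]] by simp
    assume f: "f \<in> Cinf A"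
    show "X p (\<lambda>q. Y q (\<lambda>q. c * f q)) - Y p (\<lambda>q. X q (\<lambda>q. c * f q)) =
        c * (X p (\<lambda>q. Y q f) - Y p (\<lambda>q. X q f))" for c
      using Xg[OF tangent_scale[OF Yt f]] Yg[OF tangent_scale[OF Xt f]]
        tangent_scale[OF Xt[OF p] Yc[OF f]] tangent_scale[OF Yt[OF p] Xc[OF f]]
      by (simp add: algebra_simps)
    fix h assume h: "h \<in> Cinf A"
    show "X p (\<lambda>q. Y q (\<lambda>q. f q + h q)) - Y p (\<lambda>q. X q (\<lambda>q. f q + h q)) =
        X p (\<lambda>q. Y q f) - Y p (\<lambda>q. X q f) + (X p (\<lambda>q. Y q h) - Y p (\<lambda>q. X q h))"
      using Xg[OF tangent_add[OF Yt f h]] Yg[OF tangent_add[OF Xt f h]]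
        tangent_add[OF Xt[OF p] Yc[OF f] Yc[OF h]] tangent_add[OF Yt[OF p] Xc[OF f] Xc[OF h]]
      by (simp add: algebra_simps)
    have "X p (\<lambda>q. f q * Y q h + h q * Y q f) = X p (\<lambda>q. f q * Y q h) + X p (\<lambda>q. h q * Y q f)"
      by (intro tangent_add[OF Xt[OF p]] Cinf_mult f h Yc)
    moreover have "Y p (\<lambda>q. f q * X q h + h q * X q f) = Y p (\<lambda>q. f q * X q h) + Y p (\<lambda>q. h q * X q f)"
      by (intro tangent_add[OF Yt[OF p]] Cinf_mult f h Xc)
    ultimately show "X p (\<lambda>q. Y q (\<lambda>q. f q * h q)) - Y p (\<lambda>q. X q (\<lambda>q. f q * h q)) =
        f p * (X p (\<lambda>q. Y q h) - Y p (\<lambda>q. X q h)) + h p * (X p (\<lambda>q. Y q f) - Y p (\<lambda>q. X q f))"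
      using Xg[OF tangent_mult[OF Yt f h]] Yg[OF tangent_mult[OF Xt f h]]
        tangent_mult[OF Xt[OF p] f Yc[OF h]] tangent_mult[OF Xt[OF p] h Yc[OF f]]
        tangent_mult[OF Yt[OF p] f Xc[OF h]] tangent_mult[OF Yt[OF p] h Xc[OF f]]
      by (simp add: algebra_simps)
  qed
  moreover have "(\<lambda>p. bracket X Y p f) \<in> Cinf A" if "f \<in> Cinf A" for f
    unfolding bracket_def by (intro Cinf_diff vfields_Cinf[OF X] vfields_Cinf[OF Y] that)
  ultimately show ?thesis unfolding vfields_def by blast
qed

lemma bracket_skew: "bracket Y X p = tscale (- 1) (bracket X Y p)"
  by (simp add: bracket_def tscale_def fun_eq_iff)

lemma bracket_add:
  assumes M: "smooth_manifold A" and X: "X \<in> vfields A" "X' \<in> vfields A" and Y: "Y \<in> vfields A" and p: "p \<in> mcarrier A"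
  shows "bracket (\<lambda>q. tadd (X q) (X' q)) Y p = tadd (bracket X Y p) (bracket X' Y p)"
proof (rule tangent_eqI)
  note b = bracket_vfields[OF M _ Y]
  show "bracket (\<lambda>q. tadd (X q) (X' q)) Y p \<in> tangent A p"
    by (rule vfields_tangent[OF b[OF vfields_add[OF X]] p])
  show "tadd (bracket X Y p) (bracket X' Y p) \<in> tangent A p"
    by (intro tangent_tadd vfields_tangent[OF b] X p)
  fix f assume f: "f \<in> Cinf A"
  show "bracket (\<lambda>q. tadd (X q) (X' q)) Y p f = tadd (bracket X Y p) (bracket X' Y p) f"
    using tangent_add[OF vfields_tangent[OF Y p] vfields_Cinf[OF X(1) f] vfields_Cinf[OF X(2) f]]
    by (simp add: bracket_def tadd_def)
qed

lemma bracket_scale: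
  assumes M: "smooth_manifold A" and X: "X \<in> vfields A" and h: "h \<in> Cinf A" and Y: "Y \<in> vfields A" and p: "p \<in> mcarrier A"
  shows "bracket (\<lambda>q. tscale (h q) (X q)) Y p =
    tadd (tscale (h p) (bracket X Y p)) (tscale (- Y p h) (X p))"
proof (rule tangent_eqI)
  note b = bracket_vfields[OF M _ Y]
  show "bracket (\<lambda>q. tscale (h q) (X q)) Y p \<in> tangent A p"
    by (rule vfields_tangent[OF b[OF vfields_scale[OF X h]] p])
  show "tadd (tscale (h p) (bracket X Y p)) (tscale (- Y p h) (X p)) \<in> tangent A p"
    by (intro tangent_tadd tangent_tscale vfields_tangent[OF b] vfields_tangent X p)
  fix f assume f: "f \<in> Cinf A"
  show "bracket (\<lambda>q. tscale (h q) (X q)) Y p f = tadd (tscale (h p) (bracket X Y p)) (tscale (- Y p h) (X p)) f"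
    using tangent_mult[OF vfields_tangent[OF Y p] h vfields_Cinf[OF X f]]
    by (simp add: bracket_def tadd_def tscale_def algebra_simps)
qed

text \<open>The Jacobi identity in the shape needed for \<open>d2 (d1 \<alpha>)\<close>: its three
  double brackets are those of the Koszul formula.\<close>

lemma Jacobi:
  assumes M: "smooth_manifold A" and X: "X \<in> vfields A" and Y: "Y \<in> vfields A" and Z: "Z \<in> vfields A" and p: "p \<in> mcarrier A"
  shows "bracket (bracket X Z) Y p = tadd (bracket (bracket X Y) Z p) (bracket (bracket Y Z) X p)"
proof (rule tangent_eqI)
  note b = bracket_vfields[OF M]
  show "bracket (bracket X Z) Y p \<in> tangent A p"
    by (intro vfields_tangent b X Y Z p)
  show "tadd (bracket (bracket X Y) Z p) (bracket (bracket Y Z) X p) \<in> tangent A p"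
    by (intro tangent_tadd vfields_tangent b X Y Z p)
  fix f assume f: "f \<in> Cinf A"
  note c = vfields_Cinf[OF _ vfields_Cinf[OF _ f]]
  show "bracket (bracket X Z) Y p f = tadd (bracket (bracket X Y) Z p) (bracket (bracket Y Z) X p) f"
    using tangent_diff[OF vfields_tangent[OF Y p] c[OF X Z] c[OF Z X]]
      tangent_diff[OF vfields_tangent[OF Z p] c[OF X Y] c[OF Y X]]
      tangent_diff[OF vfields_tangent[OF X p] c[OF Y Z] c[OF Z Y]]
    by (simp add: bracket_def tadd_def)
qed

text \<open>The Koszul formula computed in the reals: \<open>form_of \<alpha>\<close> has real
  values only, so the complex \<open>dirderiv\<close> can be left behind.\<close>

definition d1 :: "('a \<Rightarrow> 'a tvec \<Rightarrow> real) \<Rightarrow> 'a vfield \<Rightarrow> 'a vfield \<Rightarrow> 'a \<Rightarrow> real" where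
  "d1 \<alpha> X Y p = X p (\<lambda>q. \<alpha> q (Y q)) - Y p (\<lambda>q. \<alpha> q (X q)) - \<alpha> p (bracket X Y p)"

lemma dirderiv_of_real:
  assumes "X \<in> vfields A" "p \<in> mcarrier A"
  shows "dirderiv X (\<lambda>q. complex_of_real (h q)) p = complex_of_real (X p h)"
  unfolding dirderiv_def using tangent_const[OF vfields_tangent[OF assms], of 0]
  by (simp add: complex_eq_iff)

lemma dirderiv_cong:
  assumes M: "smooth_manifold A" and X: "X \<in> vfields A" and p: "p \<in> mcarrier A"
    and "\<And>q. q \<in> mcarrier A \<Longrightarrow> f q = h q"
  shows "dirderiv X f p = dirderiv X h p"
  unfolding dirderiv_def
  using tangent_cong[OF M p vfields_tangent[OF X p]] assms(4) by (metis (mono_tags, lifting))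

lemma ext_deriv_one_form:
  assumes "X \<in> vfields A" "Y \<in> vfields A" "p \<in> mcarrier A"
  shows "ext_deriv (form_of \<alpha>) [X, Y] p = complex_of_real (d1 \<alpha> X Y p)"
  using dirderiv_of_real[OF assms(1,3)]
    dirderiv_of_real[OF assms(2,3)]
  by (simp add: ext_deriv_def lessThan_Suc del_def form_of_def d1_def)

lemma ext_deriv_3:
  "ext_deriv \<omega> [X, Y, Z] p = dirderiv X (\<omega> [Y, Z]) p - dirderiv Y (\<omega> [X, Z]) p + dirderiv Z (\<omega> [X, Y]) p
    - \<omega> [bracket X Y, Z] p + \<omega> [bracket X Z, Y] p - \<omega> [bracket Y Z, X] p"
  by (simp add: ext_deriv_def lessThan_Suc del_def)

text \<open>The argument \<open>w\<close> takes fields, not vectors, so that both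
  \<open>d1 \<alpha>\<close> and a pointwise tensor can be inserted.\<close>

definition d2 :: "('a vfield \<Rightarrow> 'a vfield \<Rightarrow> 'a \<Rightarrow> real) \<Rightarrow> 'a vfield \<Rightarrow> 'a vfield \<Rightarrow> 'a vfield \<Rightarrow> 'a \<Rightarrow> real" where
  "d2 w X Y Z p = X p (w Y Z) - Y p (w X Z) + Z p (w X Y)
    - w (bracket X Y) Z p + w (bracket X Z) Y p - w (bracket Y Z) X p"

lemma ext_deriv_two_form:
  assumes M: "smooth_manifold A"
    and w: "\<And>X Y p. X \<in> vfields A \<Longrightarrow> Y \<in> vfields A \<Longrightarrow> p \<in> mcarrier A \<Longrightarrow> \<omega> [X, Y] p = complex_of_real (w X Y p)"
    and X: "X \<in> vfields A" and Y: "Y \<in> vfields A" and Z: "Z \<in> vfields A" and p: "p \<in> mcarrier A"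
  shows "ext_deriv \<omega> [X, Y, Z] p = complex_of_real (d2 w X Y Z p)"
proof -
  have "dirderiv X (\<omega> [Y, Z]) p = complex_of_real (X p (w Y Z))"
    if X: "X \<in> vfields A" and Y: "Y \<in> vfields A" and Z: "Z \<in> vfields A" for X Y Z
    using dirderiv_cong[OF M X p, of "\<omega> [Y, Z]" "\<lambda>q. complex_of_real (w Y Z q)"] w[OF Y Z]
      dirderiv_of_real[OF X p] by simp
  then show ?thesis using X Y Z p w bracket_vfields[OF M]
    by (simp add: ext_deriv_3 d2_def)
qed

lemma one_form_add:
  "one_form A \<alpha> \<Longrightarrow> p \<in> mcarrier A \<Longrightarrow> v \<in> tangent A p \<Longrightarrow> w \<in> tangent A p \<Longrightarrow> \<alpha> p (tadd v w) = \<alpha> p v + \<alpha> p w"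
  and one_form_scale:
  "one_form A \<alpha> \<Longrightarrow> p \<in> mcarrier A \<Longrightarrow> v \<in> tangent A p \<Longrightarrow> \<alpha> p (tscale c v) = c * \<alpha> p v"
  and one_form_Cinf: "one_form A \<alpha> \<Longrightarrow> X \<in> vfields A \<Longrightarrow> (\<lambda>p. \<alpha> p (X p)) \<in> Cinf A"
  unfolding one_form_def by blast+

lemma d1_Cinf:
  assumes M: "smooth_manifold A" and \<alpha>: "one_form A \<alpha>" and X: "X \<in> vfields A" and Y: "Y \<in> vfields A"
  shows "d1 \<alpha> X Y \<in> Cinf A"
proof -
  have "(\<lambda>p. X p (\<lambda>q. \<alpha> q (Y q)) - Y p (\<lambda>q. \<alpha> q (X q)) - \<alpha> p (bracket X Y p)) \<in> Cinf A"
    by (intro Cinf_diff vfields_Cinf[OF X one_form_Cinf[OF \<alpha> Y]]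
        vfields_Cinf[OF Y one_form_Cinf[OF \<alpha> X]] one_form_Cinf[OF \<alpha> bracket_vfields[OF M X Y]])
  then show ?thesis by (simp add: d1_def[abs_def])
qed

lemma d1_skew:
  assumes M: "smooth_manifold A" and \<alpha>: "one_form A \<alpha>" and X: "X \<in> vfields A" and Y: "Y \<in> vfields A" and p: "p \<in> mcarrier A"
  shows "d1 \<alpha> Y X p = - d1 \<alpha> X Y p"
  using one_form_scale[OF \<alpha> p vfields_tangent[OF bracket_vfields[OF M X Y] p], of "-1"]
  by (simp add: d1_def bracket_skew[of Y X])

lemma d1_add:
  assumes M: "smooth_manifold A" and \<alpha>: "one_form A \<alpha>" and X: "X \<in> vfields A" "X' \<in> vfields A" and Y: "Y \<in> vfields A" and p: "p \<in> mcarrier A"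
  shows "d1 \<alpha> (\<lambda>q. tadd (X q) (X' q)) Y p = d1 \<alpha> X Y p + d1 \<alpha> X' Y p"
proof -
  note t = vfields_tangent
  have "Y p (\<lambda>q. \<alpha> q (tadd (X q) (X' q))) = Y p (\<lambda>q. \<alpha> q (X q) + \<alpha> q (X' q))"
    by (rule tangent_cong[OF M p t[OF Y p]]) (intro one_form_add[OF \<alpha>] t X)
  also have "\<dots> = Y p (\<lambda>q. \<alpha> q (X q)) + Y p (\<lambda>q. \<alpha> q (X' q))"
    by (intro tangent_add[OF t[OF Y p]] one_form_Cinf[OF \<alpha>] X)
  finally show ?thesis
    using one_form_add[OF \<alpha> p t[OF bracket_vfields[OF M X(1) Y] p] t[OF bracket_vfields[OF M X(2) Y] p]]
    by (simp add: d1_def bracket_add[OF M X Y p]) (simp add: tadd_def)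
qed

text \<open>Tensoriality: \<open>Y\<close> differentiates \<open>h\<close> once in the product of
  \<open>h\<close> with \<open>\<alpha>\<close> on \<open>X\<close> and once through the bracket,
  and these two terms cancel.\<close>

lemma d1_scale:
  assumes M: "smooth_manifold A" and \<alpha>: "one_form A \<alpha>" and X: "X \<in> vfields A" and h: "h \<in> Cinf A" and Y: "Y \<in> vfields A" and p: "p \<in> mcarrier A"
  shows "d1 \<alpha> (\<lambda>q. tscale (h q) (X q)) Y p = h p * d1 \<alpha> X Y p"
proof -
  note t = vfields_tangent
  have "Y p (\<lambda>q. \<alpha> q (tscale (h q) (X q))) = Y p (\<lambda>q. h q * \<alpha> q (X q))"
    by (rule tangent_cong[OF M p t[OF Y p]]) (intro one_form_scale[OF \<alpha>] t X)
  also have "\<dots> = h p * Y p (\<lambda>q. \<alpha> q (X q)) + \<alpha> p (X p) * Y p h"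
    by (intro tangent_mult[OF t[OF Y p]] one_form_Cinf[OF \<alpha>] X h)
  finally have 1: "Y p (\<lambda>q. \<alpha> q (tscale (h q) (X q))) = h p * Y p (\<lambda>q. \<alpha> q (X q)) + \<alpha> p (X p) * Y p h" .
  have b: "bracket X Y p \<in> tangent A p" by (intro t bracket_vfields[OF M] X Y p)
  have "\<alpha> p (bracket (\<lambda>q. tscale (h q) (X q)) Y p) = h p * \<alpha> p (bracket X Y p) - Y p h * \<alpha> p (X p)"
    unfolding bracket_scale[OF M X h Y p]
    using one_form_add[OF \<alpha> p tangent_tscale[OF b] tangent_tscale[OF t[OF X p]]]
      one_form_scale[OF \<alpha> p b] one_form_scale[OF \<alpha> p t[OF X p]] by simp
  then show ?thesis unfolding d1_def 1 by (simp add: tscale_def algebra_simps)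
qed

text \<open>The second derivatives combine in pairs to derivatives along brackets, which cancel
  against the derivative terms of \<open>d1 \<alpha>\<close> on the brackets; what is left is
  \<open>\<alpha>\<close> applied to the Jacobi identity.\<close>

lemma d2_d1:
  assumes M: "smooth_manifold A" and \<alpha>: "one_form A \<alpha>" and X: "X \<in> vfields A" and Y: "Y \<in> vfields A" and Z: "Z \<in> vfields A" and p: "p \<in> mcarrier A"
  shows "d2 (d1 \<alpha>) X Y Z p = 0"
proof -
  note t = vfields_tangent and b = bracket_vfields[OF M]
  have e: "X p (d1 \<alpha> Y Z) = X p (\<lambda>q. Y q (\<lambda>q. \<alpha> q (Z q))) - X p (\<lambda>q. Z q (\<lambda>q. \<alpha> q (Y q))) - X p (\<lambda>q. \<alpha> q (bracket Y Z q))"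
    if X: "X \<in> vfields A" and Y: "Y \<in> vfields A" and Z: "Z \<in> vfields A" for X Y Z
  proof -
    note c = vfields_Cinf[OF _ one_form_Cinf[OF \<alpha>]]
    show ?thesis unfolding d1_def[abs_def]
      using tangent_diff[OF t[OF X p] Cinf_diff[OF c[OF Y Z] c[OF Z Y]] one_form_Cinf[OF \<alpha> b[OF Y Z]]]
        tangent_diff[OF t[OF X p] c[OF Y Z] c[OF Z Y]] by simp
  qed
  have "\<alpha> p (bracket (bracket X Z) Y p) = \<alpha> p (bracket (bracket X Y) Z p) + \<alpha> p (bracket (bracket Y Z) X p)"
    unfolding Jacobi[OF M X Y Z p]
    by (intro one_form_add[OF \<alpha> p] t b X Y Z p)
  then show ?thesis unfolding d2_def e[OF X Y Z] e[OF Y X Z] e[OF Z X Y]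
    by (simp add: d1_def bracket_def)
qed

lemma lists_2: "Xs \<in> lists S \<Longrightarrow> length Xs = 2 \<Longrightarrow> \<exists>X\<in>S. \<exists>Y\<in>S. Xs = [X, Y]"
  by (auto simp: length_Suc_conv numeral_2_eq_2)

lemma diff_form_d1:
  assumes M: "smooth_manifold A" and \<alpha>: "one_form A \<alpha>"
  shows "diff_form A 2 (ext_deriv (form_of \<alpha>))"
  unfolding diff_form_def
proof (intro ballI impI)
  fix Xs assume "Xs \<in> lists (vfields A)" "length Xs = 2"
  then obtain X Y where XY: "X \<in> vfields A" "Y \<in> vfields A" "Xs = [X, Y]"
    by (metis lists_2)
  note e = ext_deriv_one_form[of _ A _ _ \<alpha>]
  have two: "i < 2 \<longleftrightarrow> i = 0 \<or> i = Suc 0" for i :: nat by auto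
  have "ext_deriv (form_of \<alpha>) Xs \<in> CinfC A"
    unfolding CinfC_def
  proof (intro CollectI conjI)
    show "(\<lambda>p. Re (ext_deriv (form_of \<alpha>) Xs p)) \<in> Cinf A"
      by (rule Cinf_cong[OF M d1_Cinf[OF M \<alpha> XY(1,2)]]) (simp add: e XY)
    show "(\<lambda>p. Im (ext_deriv (form_of \<alpha>) Xs p)) \<in> Cinf A"
      by (rule Cinf_cong[OF M Cinf_const[of 0]]) (simp add: e XY)
  qed
  moreover have "ext_deriv (form_of \<alpha>) (Xs[i := (\<lambda>q. tadd (Z q) (Z' q))]) p =
      ext_deriv (form_of \<alpha>) (Xs[i := Z]) p + ext_deriv (form_of \<alpha>) (Xs[i := Z']) p"
    if "i < 2" and Z: "Z \<in> vfields A" "Z' \<in> vfields A" and p: "p \<in> mcarrier A" for i Z Z' p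
  proof -
    have "d1 \<alpha> X (\<lambda>q. tadd (Z q) (Z' q)) p = d1 \<alpha> X Z p + d1 \<alpha> X Z' p"
      using d1_add[OF M \<alpha> Z XY(1) p] d1_skew[OF M \<alpha> XY(1) _ p] vfields_add[OF Z] Z by simp
    then show ?thesis
      using that(1) d1_add[OF M \<alpha> Z XY(2) p] XY(1,2) vfields_add[OF Z] Z p
      unfolding two XY(3) by (auto simp: e)
  qed
  moreover have "ext_deriv (form_of \<alpha>) (Xs[i := (\<lambda>q. tscale (f q) ((Xs ! i) q))]) p =
      complex_of_real (f p) * ext_deriv (form_of \<alpha>) Xs p"
    if "i < 2" and f: "f \<in> Cinf A" and p: "p \<in> mcarrier A" for i f p
  proof -
    note s = vfields_scale[OF XY(1) f] vfields_scale[OF XY(2) f]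
    have "d1 \<alpha> X (\<lambda>q. tscale (f q) (Y q)) p = f p * d1 \<alpha> X Y p"
      using d1_scale[OF M \<alpha> XY(2) f XY(1) p] d1_skew[OF M \<alpha> XY(1) _ p] s XY by simp
    then show ?thesis
      using that(1) d1_scale[OF M \<alpha> XY(1) f XY(2) p] XY(1,2) s p
      unfolding two XY(3) by (auto simp: e)
  qed
  moreover have "ext_deriv (form_of \<alpha>) Xs p = 0"
    if "j < 2" "i < j" "Xs ! i = Xs ! j" and p: "p \<in> mcarrier A" for i j p
    using that d1_skew[OF M \<alpha> XY(1,1) p] XY unfolding two by (auto simp: e)
  ultimately show "ext_deriv (form_of \<alpha>) Xs \<in> CinfC A \<and>
    (\<forall>i<2. \<forall>X\<in>vfields A. \<forall>Y\<in>vfields A. \<forall>p\<in>mcarrier A.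
       ext_deriv (form_of \<alpha>) (Xs[i := (\<lambda>q. tadd (X q) (Y q))]) p =
       ext_deriv (form_of \<alpha>) (Xs[i := X]) p + ext_deriv (form_of \<alpha>) (Xs[i := Y]) p) \<and>
    (\<forall>i<2. \<forall>f\<in>Cinf A. \<forall>p\<in>mcarrier A.
       ext_deriv (form_of \<alpha>) (Xs[i := (\<lambda>q. tscale (f q) ((Xs ! i) q))]) p =
       complex_of_real (f p) * ext_deriv (form_of \<alpha>) Xs p) \<and>
    (\<forall>j<2. \<forall>i<j. Xs ! i = Xs ! j \<longrightarrow> (\<forall>p\<in>mcarrier A. ext_deriv (form_of \<alpha>) Xs p = 0))"
    by blast
qed

lemma endo_field_vfields: "endo_field A J \<Longrightarrow> X \<in> vfields A \<Longrightarrow> (\<lambda>q. J q (X q)) \<in> vfields A"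
  unfolding endo_field_def by blast

text \<open>Forms are functions on arbitrary lists and points, unconstrained outside genuine vector
  fields and the carrier, so equality with the zero function would be too strong. Both
  \<open>antiholo_part\<close> and \<open>ext_deriv\<close> preserve this weaker notion.\<close>

definition vanishes :: "('a, 'e::euclidean_space) atlas \<Rightarrow> nat \<Rightarrow> 'a form \<Rightarrow> bool" where
  "vanishes A k \<omega> \<longleftrightarrow> (\<forall>Xs\<in>lists (vfields A). length Xs = k \<longrightarrow> (\<forall>p\<in>mcarrier A. \<omega> Xs p = 0))"

lemma vanishesD:
  "vanishes A k \<omega> \<Longrightarrow> set Xs \<subseteq> vfields A \<Longrightarrow> length Xs = k \<Longrightarrow> p \<in> mcarrier A \<Longrightarrow> \<omega> Xs p = 0"
  unfolding vanishes_def by (auto simp: lists_eq_set)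

lemma vanishes_antiholo_part:
  assumes J: "endo_field A J" and \<omega>: "vanishes A k \<omega>"
  shows "vanishes A k (antiholo_part J \<omega>)"
  unfolding vanishes_def antiholo_part_def
proof (intro ballI impI sum.neutral)
  fix Xs p S assume "Xs \<in> lists (vfields A)" "length Xs = k" and p: "p \<in> mcarrier A"
  then have sub: "set Xs \<subseteq> vfields A" and k: "length Xs = k" by (auto simp: lists_eq_set)
  have x: "Xs ! i \<in> vfields A" if "i < length Xs" for i using that sub by (meson nth_mem subsetD)
  have "\<omega> (map (\<lambda>i. if i \<in> S then \<lambda>q. J q ((Xs ! i) q) else Xs ! i) [0..<length Xs]) p = 0"
    by (rule vanishesD[OF \<omega> _ _ p]) (use endo_field_vfields[OF J x] x k in auto)
  then show "\<i> ^ card S / 2 ^ length Xs *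
    \<omega> (map (\<lambda>i. if i \<in> S then \<lambda>q. J q ((Xs ! i) q) else Xs ! i) [0..<length Xs]) p = 0" by simp
qed

text \<open>The derivative terms differentiate a function known to be 0 on the carrier only, which
  suffices for a derivation. The bracket terms are again values on vector fields, of the right
  number since two arguments are removed and one is added.\<close>

lemma vanishes_ext_deriv:
  assumes M: "smooth_manifold A" and \<omega>: "vanishes A k \<omega>"
  shows "vanishes A (Suc k) (ext_deriv \<omega>)"
  unfolding vanishes_def
proof (intro ballI impI)
  fix Xs p assume Xs: "Xs \<in> lists (vfields A)" "length Xs = Suc k" and p: "p \<in> mcarrier A"
  have sub: "set Xs \<subseteq> vfields A" using Xs by (auto simp: lists_eq_set)
  have del: "set (del i Ys) \<subseteq> set Ys" "i < length Ys \<Longrightarrow> length (del i Ys) = length Ys - 1" for i and Ys :: "'a vfield list"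
    unfolding del_def by (auto dest: in_set_takeD in_set_dropD)
  have "dirderiv (Xs ! i) (\<omega> (del i Xs)) p = 0" if i: "i < length Xs" for i
  proof -
    have X: "Xs ! i \<in> vfields A" using sub i by auto
    have "set (del i Xs) \<subseteq> vfields A" using del(1) sub by (rule order_trans)
    moreover have "length (del i Xs) = k" using del(2)[OF i] Xs(2) by simp
    ultimately have z: "\<omega> (del i Xs) q = 0" if "q \<in> mcarrier A" for q
      using vanishesD[OF \<omega>] that by blast
    have "dirderiv (Xs ! i) (\<omega> (del i Xs)) p = dirderiv (Xs ! i) (\<lambda>q. complex_of_real 0) p"
      by (rule dirderiv_cong[OF M X p]) (simp add: z)
    then show ?thesis
      using tangent_const[OF vfields_tangent[OF X p]] by (simp add: dirderiv_def complex_eq_iff)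
  qed
  moreover have "\<omega> (bracket (Xs ! i) (Xs ! j) # del i (del j Xs)) p = 0" if ij: "j < length Xs" "i < j" for i j
  proof (rule vanishesD[OF \<omega> _ _ p])
    have "bracket (Xs ! i) (Xs ! j) \<in> vfields A" using sub ij by (intro bracket_vfields[OF M]) auto
    then show "set (bracket (Xs ! i) (Xs ! j) # del i (del j Xs)) \<subseteq> vfields A"
      using order_trans[OF del(1) order_trans[OF del(1) sub]] by simp
    show "length (bracket (Xs ! i) (Xs ! j) # del i (del j Xs)) = k"
      using del(2)[of i "del j Xs"] del(2)[of j Xs] ij Xs(2) by simp
  qed
  ultimately show "ext_deriv \<omega> Xs p = 0" unfolding ext_deriv_def by simp
qed

lemma vanishes_basic_0q_form:
  assumes M: "smooth_manifold A" and J: "endo_field A J" and v0: "vanishes A k \<omega>"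
  shows "basic_0q_form A F J k \<omega>"
proof -
  have u: "set (Xs[i := X]) \<subseteq> vfields A" if "set Xs \<subseteq> vfields A" "X \<in> vfields A" for Xs i X
    using that set_update_subset_insert[of Xs i X] by blast
  have s: "(\<lambda>q. tscale (f q) ((Xs ! i) q)) \<in> vfields A" if "set Xs \<subseteq> vfields A" "i < length Xs" "f \<in> Cinf A" for Xs i f
    using that by (intro vfields_scale) auto
  have j: "(\<lambda>q. J q ((Xs ! i) q)) \<in> vfields A" if "set Xs \<subseteq> vfields A" "i < length Xs" for Xs i
    using that by (intro endo_field_vfields[OF J]) auto
  note v = vanishesD[OF v0]
  have c: "\<omega> Xs \<in> CinfC A" if "set Xs \<subseteq> vfields A" "length Xs = k" for Xs
    unfolding CinfC_def using v[OF that]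
    by (auto intro: Cinf_cong[OF M Cinf_const[of 0]])
  have "diff_form A k \<omega>"
    unfolding diff_form_def
  proof (intro ballI impI conjI allI)
    fix Xs assume "Xs \<in> lists (vfields A)" and k: "length Xs = k"
    then have Xs: "set Xs \<subseteq> vfields A" "length Xs = k" by (auto simp: lists_eq_set)
    show "\<omega> Xs \<in> CinfC A" by (rule c[OF Xs])
    show "\<omega> (Xs[i := (\<lambda>q. tadd (X q) (Y q))]) p = \<omega> (Xs[i := X]) p + \<omega> (Xs[i := Y]) p"
      if "i < k" and that: "X \<in> vfields A" "Y \<in> vfields A" and p: "p \<in> mcarrier A" for i X Y p
      using v[OF u[OF Xs(1) vfields_add[OF that]] _ p] v[OF u[OF Xs(1) that(1)] _ p]
        v[OF u[OF Xs(1) that(2)] _ p] Xs(2) by simp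
    show "\<omega> (Xs[i := (\<lambda>q. tscale (f q) ((Xs ! i) q))]) p = complex_of_real (f p) * \<omega> Xs p"
      if "i < k" "f \<in> Cinf A" and p: "p \<in> mcarrier A" for i f p
      using v[OF u[OF Xs(1) s[OF Xs(1) _ that(2)]] _ p] v[OF Xs p] Xs(2) that(1) by simp
    show "\<omega> Xs p = 0" if "p \<in> mcarrier A" for p by (rule v[OF Xs that])
  qed
  then show ?thesis
    unfolding basic_0q_form_def basic_form_def
  proof (intro ballI impI conjI allI)
    fix X Ys p assume "X \<in> tangent_fields A F" "Ys \<in> lists (vfields A)" and p: "p \<in> mcarrier A"
    then have *: "set (X # Ys) \<subseteq> vfields A" by (auto simp: tangent_fields_def lists_eq_set)
    show "\<omega> (X # Ys) p = 0" if "Suc (length Ys) = k" using v[OF * _ p] that by simp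
    show "ext_deriv \<omega> (X # Ys) p = 0" if "length Ys = k"
      using vanishesD[OF vanishes_ext_deriv[OF M v0] * _ p] that by simp
  next
    fix Xs i p assume "Xs \<in> lists (vfields A)" and k: "length Xs = k" and i: "i < k" and p: "p \<in> mcarrier A"
    then have Xs: "set Xs \<subseteq> vfields A" "length Xs = k" and i': "i < length Xs" by (auto simp: lists_eq_set)
    show "\<omega> Xs p - \<i> * \<omega> (Xs[i := (\<lambda>y. J y ((Xs ! i) y))]) p = 0"
      using v[OF Xs p] v[OF u[OF Xs(1) j[OF Xs(1) i']] _ p] Xs(2) by simp
  qed
qed

text \<open>The zero form is the primitive. Both it and \<open>\<omega>\<close> qualify as basic
  forms of type \<open>(0, q)\<close> because every condition evaluates them, or their derivatives,
  on vector fields.\<close>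

lemma vanishes_zero_in_H02b:
  assumes M: "smooth_manifold A" and J: "endo_field A J" and \<omega>: "vanishes A 2 \<omega>"
  shows "zero_in_H02b A F J \<omega>"
proof -
  have 0: "vanishes A 1 (\<lambda>Xs p. 0)" by (simp add: vanishes_def)
  have d: "vanishes A (Suc k) (dbar J \<theta>)" if "vanishes A k \<theta>" for k \<theta>
    unfolding dbar_def by (rule vanishes_antiholo_part[OF J vanishes_ext_deriv[OF M that]])
  have "\<omega> [X, Y] p = dbar J (\<lambda>Xs p. 0) [X, Y] p" if "X \<in> vfields A" "Y \<in> vfields A" "p \<in> mcarrier A" for X Y p
    using vanishesD[OF d[OF 0], of "[X, Y]" p] vanishesD[OF \<omega>, of "[X, Y]" p] that by simp
  moreover have "dbar J \<omega> [X, Y, Z] p = 0" if "X \<in> vfields A" "Y \<in> vfields A" "Z \<in> vfields A" "p \<in> mcarrier A" for X Y Z p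
    using vanishesD[OF d[OF \<omega>], of "[X, Y, Z]" p] that by simp
  ultimately show ?thesis
    unfolding zero_in_H02b_def
    using vanishes_basic_0q_form[OF M J \<omega>] vanishes_basic_0q_form[OF M J 0] by blast
qed

text \<open>One term for each subset of the two positions: \<open>J\<close> in one place carries
  \<open>\<i>\<close>, in both places \<open>\<i> ^ 2 = - 1\<close>; the denominator is
  \<open>2 ^ 2\<close>.\<close>

lemma antiholo_part_2:
  "antiholo_part J \<omega> [X, Y] p = (\<omega> [X, Y] p + \<i> * \<omega> [\<lambda>q. J q (X q), Y] p
    + \<i> * \<omega> [X, \<lambda>q. J q (Y q)] p - \<omega> [\<lambda>q. J q (X q), \<lambda>q. J q (Y q)] p) / 4"
proof -
  have P: "Pow {..<length [X, Y]} = {{}, {0}, {1}, {0, 1}}"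
    by (auto simp: lessThan_Suc Pow_insert)
  have d: "{0 :: nat} \<noteq> {1}" "{0 :: nat} \<noteq> {0, 1}" "{1 :: nat} \<noteq> {0, 1}" by auto
  show ?thesis unfolding antiholo_part_def P using d
    by (simp add: power2_eq_square add_divide_distrib diff_divide_distrib upt_rec)
qed

section \<open>Metrics and flows of Killing fields\<close>

lemma metric_add_right:
  "riemannian_metric A g \<Longrightarrow> p \<in> mcarrier A \<Longrightarrow> u \<in> tangent A p \<Longrightarrow> v \<in> tangent A p \<Longrightarrow> w \<in> tangent A p \<Longrightarrow>
    g p u (tadd v w) = g p u v + g p u w"
  and metric_scale_right:
  "riemannian_metric A g \<Longrightarrow> p \<in> mcarrier A \<Longrightarrow> v \<in> tangent A p \<Longrightarrow> w \<in> tangent A p \<Longrightarrow>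
    g p v (tscale c w) = c * g p v w"
  and metric_sym:
  "riemannian_metric A g \<Longrightarrow> p \<in> mcarrier A \<Longrightarrow> v \<in> tangent A p \<Longrightarrow> w \<in> tangent A p \<Longrightarrow> g p v w = g p w v"
  and metric_pos:
  "riemannian_metric A g \<Longrightarrow> p \<in> mcarrier A \<Longrightarrow> v \<in> tangent A p \<Longrightarrow> v \<noteq> tzero \<Longrightarrow> g p v v > 0"
  and metric_Cinf:
  "riemannian_metric A g \<Longrightarrow> X \<in> vfields A \<Longrightarrow> Y \<in> vfields A \<Longrightarrow> (\<lambda>p. g p (X p) (Y p)) \<in> Cinf A"
  unfolding riemannian_metric_def by blast+

lemma metric_scale_left:
  assumes "riemannian_metric A g" "p \<in> mcarrier A" "v \<in> tangent A p" "w \<in> tangent A p"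
  shows "g p (tscale c v) w = c * g p v w"
  using metric_scale_right[OF assms(1,2,4,3), of c] metric_sym[OF assms] metric_sym[OF assms(1,2) tangent_tscale[OF assms(3)] assms(4)]
  by simp

lemma tzero_eq_tscale: "tzero = tscale 0 v"
  by (simp add: tzero_def tscale_def)

lemma metric_tzero:
  assumes "riemannian_metric A g" "p \<in> mcarrier A" "v \<in> tangent A p"
  shows "g p v tzero = 0" "g p tzero v = 0"
  using metric_scale_right[OF assms assms(3), of 0] metric_scale_left[OF assms assms(3), of 0]
  by (simp_all add: tzero_eq_tscale[of v])

text \<open>Tangency of the sum is part of the induction, since the metric is additive on tangent
  vectors only.\<close>

lemma metric_sum_right:
  assumes g: "riemannian_metric A g" "p \<in> mcarrier A" and w: "w \<in> tangent A p"
  shows "(\<And>i. i \<in> I \<Longrightarrow> X i \<in> tangent A p) \<Longrightarrow>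
    (\<lambda>f. \<Sum>i\<in>I. k i * X i f) \<in> tangent A p \<and> g p w (\<lambda>f. \<Sum>i\<in>I. k i * X i f) = (\<Sum>i\<in>I. k i * g p w (X i))"
proof (induction I rule: infinite_finite_induct)
  case (insert j I)
  let ?s = "\<lambda>f. \<Sum>i\<in>I. k i * X i f"
  have e: "(\<lambda>f. \<Sum>i\<in>insert j I. k i * X i f) = tadd (tscale (k j) (X j)) ?s"
    using insert by (simp add: tadd_def tscale_def fun_eq_iff)
  have s: "?s \<in> tangent A p" "X j \<in> tangent A p" using insert by auto
  show ?case unfolding e
    using s metric_add_right[OF g w tangent_tscale[OF s(2)] s(1)] metric_scale_right[OF g w s(2)] insert
      tangent_tadd[OF tangent_tscale[OF s(2)] s(1)]
    by simp
qed (use metric_tzero(1)[OF g w] tangent_tzero in \<open>auto simp: tzero_def\<close>)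

lemma metric_nondegenerate:
  assumes g: "riemannian_metric A g" "p \<in> mcarrier A" and uv: "u \<in> tangent A p" "v \<in> tangent A p"
    and e: "\<And>w. w \<in> tangent A p \<Longrightarrow> g p w u = g p w v"
  shows "u = v"
proof -
  let ?d = "tadd u (tscale (- 1) v)"
  have d: "?d \<in> tangent A p" by (intro tangent_tadd tangent_tscale uv)
  have "g p ?d ?d = g p ?d u - g p ?d v"
    using metric_add_right[OF g d uv(1) tangent_tscale[OF uv(2)]] metric_scale_right[OF g d uv(2)] by simp
  then have "g p ?d ?d = 0" using e[OF d] by simp
  then have "?d = tzero" using metric_pos[OF g d] by fastforce
  then show ?thesis by (simp add: tadd_def tscale_def tzero_def fun_eq_iff)
qed

text \<open>The first variation of \<open>\<Sum> u\<^sub>a w\<^sub>b G\<^sub>a\<^sub>b\<close> when the components of \<open>u, w\<close> are moved by \<open>M\<close> and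
  \<open>G\<close> by the dual action.\<close>

lemma dual_action_cancel:
  fixes M G :: "'i \<Rightarrow> 'i \<Rightarrow> real"
  shows "(\<Sum>a\<in>B. \<Sum>b\<in>B. ((\<Sum>d\<in>B. u d * M d a) * w b + u a * (\<Sum>d\<in>B. w d * M d b)) * G a b
    + u a * w b * (- (\<Sum>d\<in>B. M a d * G d b) - (\<Sum>d\<in>B. M b d * G a d))) = 0"
proof -
  \<comment> \<open>Facts \<open>1\<close> and \<open>2\<close> rename summation indices, exchanging
    \<open>d\<close> with \<open>a\<close> and \<open>d\<close> with \<open>b\<close>; they match
    the variation of the components with that of \<open>G\<close>.\<close>
  have 1: "(\<Sum>a\<in>B. \<Sum>b\<in>B. \<Sum>d\<in>B. f d a b) = (\<Sum>a\<in>B. \<Sum>b\<in>B. \<Sum>d\<in>B. f a d b)"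
    for f :: "'i \<Rightarrow> 'i \<Rightarrow> 'i \<Rightarrow> real"
  proof -
    have "(\<Sum>a\<in>B. \<Sum>b\<in>B. \<Sum>d\<in>B. f d a b) = (\<Sum>b\<in>B. \<Sum>a\<in>B. \<Sum>d\<in>B. f d a b)" by (rule sum.swap)
    also have "\<dots> = (\<Sum>b\<in>B. \<Sum>d\<in>B. \<Sum>a\<in>B. f d a b)" by (rule sum.cong[OF refl]) (rule sum.swap)
    also have "\<dots> = (\<Sum>a\<in>B. \<Sum>b\<in>B. \<Sum>d\<in>B. f a d b)" by (rule sum.swap)
    finally show ?thesis .
  qed
  have 2: "(\<Sum>a\<in>B. \<Sum>b\<in>B. \<Sum>d\<in>B. f a b d) = (\<Sum>a\<in>B. \<Sum>b\<in>B. \<Sum>d\<in>B. f a d b)"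
    for f :: "'i \<Rightarrow> 'i \<Rightarrow> 'i \<Rightarrow> real"
    by (rule sum.cong[OF refl]) (rule sum.swap)
  have "(\<Sum>a\<in>B. \<Sum>b\<in>B. \<Sum>d\<in>B. u d * M d a * w b * G a b) = (\<Sum>a\<in>B. \<Sum>b\<in>B. \<Sum>d\<in>B. u a * M a d * w b * G d b)"
    using 1[of "\<lambda>d a b. u d * M d a * w b * G a b"] .
  moreover have "(\<Sum>a\<in>B. \<Sum>b\<in>B. \<Sum>d\<in>B. u a * w d * M d b * G a b) = (\<Sum>a\<in>B. \<Sum>b\<in>B. \<Sum>d\<in>B. u a * w b * M b d * G a d)"
    using 2[of "\<lambda>a b d. u a * w d * M d b * G a b"] .
  ultimately show ?thesis
    by (simp add: distrib_right distrib_left right_diff_distrib sum.distrib sum_subtractf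
        sum_distrib_left sum_distrib_right sum_negf mult.assoc mult.left_commute mult.commute)
qed

section \<open>Flows and the transport of tangent vectors\<close>

lemma is_flow_Cinf:
  "is_flow A X \<phi> \<Longrightarrow> f \<in> Cinf A \<Longrightarrow> (\<lambda>z. f (\<phi> (snd z) (fst z))) \<in> Cinf (cyl A UNIV)"
  unfolding is_flow_def cyl_def line_atlas_def case_prod_beta' by blast

lemma is_flow_mcarrier: "is_flow A X \<phi> \<Longrightarrow> p \<in> mcarrier A \<Longrightarrow> \<phi> t p \<in> mcarrier A"
  unfolding is_flow_def by blast

lemma is_flow_derivative:
  "is_flow A X \<phi> \<Longrightarrow> f \<in> Cinf A \<Longrightarrow> p \<in> mcarrier A \<Longrightarrow>
    ((\<lambda>s. f (\<phi> s p)) has_real_derivative X (\<phi> t p) f) (at t)"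
  unfolding is_flow_def by blast

lemma is_flow_slice:
  assumes "smooth_manifold A" "is_flow A X \<phi>" "f \<in> Cinf A"
  shows "(\<lambda>q. f (\<phi> t q)) \<in> Cinf A"
  using Cinf_slice[OF assms(1) open_UNIV is_flow_Cinf[OF assms(2,3)]] by simp

lemma is_flow_pushforward:
  assumes M: "smooth_manifold A" and \<phi>: "is_flow A X \<phi>" and v: "v \<in> tangent A p"
  shows "pushforward A (\<phi> t) v \<in> tangent A (\<phi> t p)"
  unfolding tangent_def pushforward_def comp_def
  using tangent_add[OF v is_flow_slice[OF M \<phi>] is_flow_slice[OF M \<phi>]]
    tangent_mult[OF v is_flow_slice[OF M \<phi>] is_flow_slice[OF M \<phi>]]
    tangent_scale[OF v is_flow_slice[OF M \<phi>]]
  by (auto simp: Cinf_add Cinf_mult Cinf_scale)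

text \<open>The pushforward evaluates the fixed \<open>v\<close> on \<open>f\<close> composed with
  the flow at time \<open>s\<close>. The time derivative passes under \<open>v\<close>, and the flow
  equation turns it into the pullback of the derivative of \<open>f\<close> along
  \<open>X\<close>.\<close>

lemma pushforward_flow_derivative:
  assumes M: "smooth_manifold A" and X: "X \<in> vfields A" and \<phi>: "is_flow A X \<phi>"
    and p: "p \<in> mcarrier A" and v: "v \<in> tangent A p" and f: "f \<in> Cinf A"
  shows "((\<lambda>s. pushforward A (\<phi> s) v f) has_real_derivative pushforward A (\<phi> t) v (\<lambda>q. X q f)) (at t)"
proof -
  let ?F = "\<lambda>z. f (\<phi> (snd z) (fst z))"
  have F: "?F \<in> Cinf (cyl A UNIV)" by (rule is_flow_Cinf[OF \<phi> f])
  have "dt ?F (q, t) = X (\<phi> t q) f" if "q \<in> mcarrier A" for q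
    using dt_has_derivative[OF M open_UNIV F that UNIV_I, of t] is_flow_derivative[OF \<phi> f that, of t]
    by (simp add: DERIV_unique)
  then have "v (\<lambda>q. dt ?F (q, t)) = v (\<lambda>q. X (\<phi> t q) f)"
    by (rule tangent_cong[OF M p v])
  then have "((\<lambda>s. v (\<lambda>q. f (\<phi> s q))) has_real_derivative v (\<lambda>q. X (\<phi> t q) f)) (at t)"
    using tangent_dt_commute[OF M open_UNIV p v F UNIV_I, of t] by simp
  then show ?thesis using f vfields_Cinf[OF X f] by (simp add: pushforward_def comp_def)
qed

text \<open>The equation \<open>L_\<xi> g = 0\<close>, expressed by the Leibniz rule on pairs of
  vector fields.\<close>

definition Killing_field :: "('a, 'e::euclidean_space) atlas \<Rightarrow> ('a \<Rightarrow> 'a tvec \<Rightarrow> 'a tvec \<Rightarrow> real) \<Rightarrow> 'a vfield \<Rightarrow> bool" where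
  "Killing_field A g \<xi> \<longleftrightarrow> \<xi> \<in> vfields A \<and> (\<forall>X\<in>vfields A. \<forall>Y\<in>vfields A. \<forall>p\<in>mcarrier A.
     \<xi> p (\<lambda>q. g q (X q) (Y q)) = g p (bracket \<xi> X p) (Y p) + g p (X p) (bracket \<xi> Y p))"

text \<open>The Killing equation cannot be applied directly to vectors transported by the flow. In a
  frame near \<open>q0 = \<phi> t p\<close> their components change by the coordinate derivative of
  \<open>\<xi>\<close>, while the Killing equation on frame fields makes the Gram matrix
  \<open>G\<close> change by the dual action; by \<open>dual_action_cancel\<close> the two changes
  add up to zero.\<close>

lemma flow_variation:
  fixes A :: "('a::{t2_space,second_countable_topology}, 'e::euclidean_space) atlas"
  assumes M: "smooth_manifold A" and g: "riemannian_metric A g" and K: "Killing_field A g \<xi>"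
    and \<phi>: "is_flow A \<xi> \<phi>" and p: "p \<in> mcarrier A" and v: "v \<in> tangent A p" and w: "w \<in> tangent A p"
  shows "((\<lambda>s. g (\<phi> s p) (pushforward A (\<phi> s) v) (pushforward A (\<phi> s) w)) has_real_derivative 0) (at t)"
proof -
  have \<xi>: "\<xi> \<in> vfields A" using K by (simp add: Killing_field_def)
  let ?P = "\<lambda>s. pushforward A (\<phi> s)"
  define q0 where "q0 = \<phi> t p"
  have q0: "q0 \<in> mcarrier A" unfolding q0_def by (rule is_flow_mcarrier[OF \<phi> p])
  obtain U x where U: "(U, x) \<in> A" "q0 \<in> U" using q0 by (rule mcarrier_E)
  obtain W c D where W: "open W" "q0 \<in> W" "W \<subseteq> U"
    "\<forall>b. c b \<in> Cinf A" "\<forall>b. D b \<in> vfields A"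
    "\<forall>q\<in>W. \<forall>v\<in>tangent A q. \<forall>f. v f = (\<Sum>b\<in>(Basis :: 'e set). v (c b) * D b q f)"
    "\<forall>q\<in>W. \<forall>b\<in>(Basis :: 'e set). \<forall>b'\<in>Basis. D b q (c b') = (if b = b' then 1 else 0)"
    by (rule chart_frame[OF M U]) (rule that; assumption)
  have WM: "q \<in> mcarrier A" if "q \<in> W" for q using that W(3) mcarrier_I[OF U(1)] by auto
  define G where "G a b q = g q (D a q) (D b q)" for a b q
  have G: "G a b \<in> Cinf A" for a b
    using metric_Cinf[OF g] W(5) by (simp add: G_def[abs_def])
  have Dt: "D b q \<in> tangent A q" if "q \<in> mcarrier A" for b q
    by (rule vfields_tangent[OF W(5)[rule_format] that])
  have expand: "g q u u' = (\<Sum>a\<in>Basis. \<Sum>b\<in>Basis. u (c a) * u' (c b) * G a b q)"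
    if q: "q \<in> W" and u: "u \<in> tangent A q" "u' \<in> tangent A q" for q u u'
  proof -
    have e: "u = (\<lambda>f. \<Sum>b\<in>(Basis :: 'e set). u (c b) * D b q f)" if "u \<in> tangent A q" for u
      using W(6) q that by (simp add: fun_eq_iff)
    have r: "g q y u = (\<Sum>b\<in>(Basis :: 'e set). u (c b) * g q y (D b q))"
      if y: "y \<in> tangent A q" and u: "u \<in> tangent A q" for y u
      using metric_sum_right[OF g WM[OF q] y, of Basis "\<lambda>b. D b q" "\<lambda>b. u (c b)"] Dt[OF WM[OF q]] e[OF u]
      by simp
    have "g q u u' = (\<Sum>a\<in>(Basis :: 'e set). u (c a) * g q u' (D a q))"
      using r[OF u(2,1)] metric_sym[OF g WM[OF q] u] by simp
    also have "\<dots> = (\<Sum>a\<in>Basis. \<Sum>b\<in>Basis. u (c a) * u' (c b) * G a b q)"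
      using r[OF Dt[OF WM[OF q]] u(2)] metric_sym[OF g WM[OF q] u(2) Dt[OF WM[OF q]]]
      by (simp add: G_def sum_distrib_left mult.assoc)
    finally show ?thesis .
  qed
  define u u' where "u = ?P t v" and "u' = ?P t w"
  have u: "u \<in> tangent A q0" "u' \<in> tangent A q0"
    unfolding u_def u'_def q0_def by (rule is_flow_pushforward[OF M \<phi>] v w)+
  \<comment> \<open>The Jacobian matrix at \<open>q0\<close> of the components of
    \<open>\<xi>\<close>.\<close>
  define N where "N a d = D a q0 (\<lambda>q. \<xi> q (c d))" for a d
  have uN: "y (\<lambda>q. \<xi> q (c a)) = (\<Sum>d\<in>Basis. y (c d) * N d a)" if "y \<in> tangent A q0" for y a
    using W(2,6) that by (simp add: N_def)
  \<comment> \<open>Only one half of the bracket survives: \<open>D a\<close> applied to a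
    coordinate is constant near \<open>q0\<close>, so \<open>\<xi>\<close> kills it.\<close>
  have br: "bracket \<xi> (D a) q0 (c d) = - N a d" if "a \<in> Basis" "d \<in> Basis" for a d
  proof -
    have "\<xi> q0 (\<lambda>q. D a q (c d)) = \<xi> q0 (\<lambda>q. if a = d then 1 else 0)"
      by (rule tangent_local[OF M q0 vfields_tangent[OF \<xi> q0] _ Cinf_const W(1,2)])
        (use W(7) that vfields_Cinf[OF W(5)[rule_format] W(4)[rule_format]] in auto)
    also have "\<dots> = 0" by (rule tangent_const[OF vfields_tangent[OF \<xi> q0]])
    finally show ?thesis by (simp add: bracket_def N_def)
  qed
  have brt: "bracket \<xi> (D a) q0 \<in> tangent A q0" for a
    by (rule vfields_tangent[OF bracket_vfields[OF M \<xi> W(5)[rule_format]] q0])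
  \<comment> \<open>Components of a frame field are Kronecker deltas, which collapses one of the two
    sums in \<open>expand\<close>.\<close>
  have Dc: "(\<Sum>d\<in>Basis. \<Sum>e\<in>Basis. k d * D b q0 (c e) * G d e q0) = (\<Sum>d\<in>Basis. k d * G d b q0)"
    "(\<Sum>d\<in>Basis. \<Sum>e\<in>Basis. D b q0 (c d) * k e * G d e q0) = (\<Sum>d\<in>Basis. k d * G b d q0)"
    if b: "b \<in> Basis" for b k
  proof -
    have d: "D b q0 (c e) = (if b = e then 1 else 0)" if "e \<in> Basis" for e
      using W(2,7) b that by simp
    have 1: "(\<Sum>e\<in>(Basis :: 'e set). D b q0 (c e) * h e) = h b" for h
    proof -
      have "(\<Sum>e\<in>(Basis :: 'e set). D b q0 (c e) * h e) = (\<Sum>e\<in>Basis. if b = e then h e else 0)"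
        by (intro sum.cong refl) (simp add: d)
      then show ?thesis using b by simp
    qed
    have "(\<Sum>e\<in>(Basis :: 'e set). k d * D b q0 (c e) * G d e q0) = k d * G d b q0" for d
      using 1[of "\<lambda>e. k d * G d e q0"] by (simp add: mult.left_commute mult.commute)
    then show "(\<Sum>d\<in>Basis. \<Sum>e\<in>Basis. k d * D b q0 (c e) * G d e q0) = (\<Sum>d\<in>Basis. k d * G d b q0)"
      by simp
    have "(\<Sum>d\<in>(Basis :: 'e set). D b q0 (c d) * k e * G d e q0) = k e * G b e q0" for e
      using 1[of "\<lambda>d. k e * G d e q0"] by (simp add: mult.assoc)
    then show "(\<Sum>d\<in>Basis. \<Sum>e\<in>Basis. D b q0 (c d) * k e * G d e q0) = (\<Sum>d\<in>Basis. k d * G b d q0)"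
      by (subst sum.swap) simp
  qed
  have \<xi>G: "\<xi> q0 (G a b) = - (\<Sum>d\<in>Basis. N a d * G d b q0) - (\<Sum>d\<in>Basis. N b d * G a d q0)"
    if ab: "a \<in> Basis" "b \<in> Basis" for a b
  proof -
    have "\<xi> q0 (G a b) = g q0 (bracket \<xi> (D a) q0) (D b q0) + g q0 (D a q0) (bracket \<xi> (D b) q0)"
      using K W(5) q0 by (simp add: Killing_field_def G_def[abs_def])
    also have "g q0 (bracket \<xi> (D a) q0) (D b q0) = (\<Sum>d\<in>Basis. bracket \<xi> (D a) q0 (c d) * G d b q0)"
      using expand[OF W(2) brt Dt[OF q0]] Dc(1)[OF ab(2)] by simp
    also have "g q0 (D a q0) (bracket \<xi> (D b) q0) = (\<Sum>d\<in>Basis. bracket \<xi> (D b) q0 (c d) * G a d q0)"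
      using expand[OF W(2) Dt[OF q0] brt] Dc(2)[OF ab(1)] by simp
    finally show ?thesis using ab by (simp add: br sum_negf)
  qed
  \<comment> \<open>\<open>is_flow\<close> describes the curve only through smooth functions, so an
    open set of times at which it lies in \<open>W\<close> is cut out by a bump function.\<close>
  obtain \<rho> where \<rho>: "\<rho> \<in> Cinf A" "\<rho> q0 = 1" "\<And>q. q \<notin> W \<Longrightarrow> \<rho> q = 0"
    using bump[OF M q0 W(1,2)] by metis
  define T where "T = {s. \<rho> (\<phi> s p) \<noteq> 0}"
  have "continuous_on UNIV (\<lambda>s. \<rho> (\<phi> s p))"
    using is_flow_derivative[OF \<phi> \<rho>(1) p] by (auto intro!: continuous_at_imp_continuous_on DERIV_isCont)
  then have T: "open T" unfolding T_def by (intro open_Collect_neq continuous_on_const)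
  have tT: "t \<in> T" using \<rho>(2) by (simp add: T_def q0_def)
  have TW: "\<phi> s p \<in> W" if "s \<in> T" for s using that \<rho>(3) by (auto simp: T_def)
  have Pd: "((\<lambda>s. ?P s y f) has_real_derivative ?P t y (\<lambda>q. \<xi> q f)) (at t)" if "y \<in> tangent A p" "f \<in> Cinf A" for y f
    by (rule pushforward_flow_derivative[OF M \<xi> \<phi> p that])
  have "((\<lambda>s. \<Sum>a\<in>Basis. \<Sum>b\<in>Basis. ?P s v (c a) * ?P s w (c b) * G a b (\<phi> s p)) has_real_derivative
      (\<Sum>a\<in>Basis. \<Sum>b\<in>Basis. (u (\<lambda>q. \<xi> q (c a)) * u' (c b) + u' (\<lambda>q. \<xi> q (c b)) * u (c a)) * G a b q0
        + \<xi> q0 (G a b) * (u (c a) * u' (c b)))) (at t)"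
    unfolding u_def u'_def q0_def
    by (intro DERIV_sum DERIV_mult Pd v w is_flow_derivative[OF \<phi> _ p] G) (use W(4) in auto)
  also have "(\<Sum>a\<in>Basis. \<Sum>b\<in>Basis. (u (\<lambda>q. \<xi> q (c a)) * u' (c b) + u' (\<lambda>q. \<xi> q (c b)) * u (c a)) * G a b q0
        + \<xi> q0 (G a b) * (u (c a) * u' (c b))) =
      (\<Sum>a\<in>Basis. \<Sum>b\<in>Basis. ((\<Sum>d\<in>Basis. u (c d) * N d a) * u' (c b) + u (c a) * (\<Sum>d\<in>Basis. u' (c d) * N d b)) * G a b q0
        + u (c a) * u' (c b) * (- (\<Sum>d\<in>Basis. N a d * G d b q0) - (\<Sum>d\<in>Basis. N b d * G a d q0)))"
    by (intro sum.cong refl) (simp only: uN[OF u(1)] uN[OF u(2)] \<xi>G mult.commute)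
  also have "\<dots> = 0" by (rule dual_action_cancel)
  finally have "((\<lambda>s. \<Sum>a\<in>Basis. \<Sum>b\<in>Basis. ?P s v (c a) * ?P s w (c b) * G a b (\<phi> s p)) has_real_derivative 0) (at t)" .
  then show ?thesis
    by (rule has_field_derivative_transform_within_open[OF _ T tT])
      (rule expand[symmetric, OF TW is_flow_pushforward[OF M \<phi> v] is_flow_pushforward[OF M \<phi> w]])
qed

lemma Killing_flow_isometry:
  assumes M: "smooth_manifold A" and g: "riemannian_metric A g" and K: "Killing_field A g \<xi>"
    and \<phi>: "is_flow A \<xi> \<phi>" and p: "p \<in> mcarrier A" and v: "v \<in> tangent A p" and w: "w \<in> tangent A p"
  shows "g (\<phi> t p) (pushforward A (\<phi> t) v) (pushforward A (\<phi> t) w) = g p v w"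
proof -
  have "g (\<phi> t p) (pushforward A (\<phi> t) v) (pushforward A (\<phi> t) w) =
      g (\<phi> 0 p) (pushforward A (\<phi> 0) v) (pushforward A (\<phi> 0) w)"
    by (rule DERIV_isconst_all[OF allI[OF flow_variation[OF M g K \<phi> p v w]]])
  \<comment> \<open>At time 0 the flow map is the identity on the carrier only;
    \<open>tangent_cong\<close> and the convention for non-smooth functions do the rest.\<close>
  also have "pushforward A (\<phi> 0) v = v" if v: "v \<in> tangent A p" for v
  proof
    fix f
    have "v (f \<circ> \<phi> 0) = v f"
      by (rule tangent_cong[OF M p v]) (use \<phi> in \<open>simp add: is_flow_def\<close>)
    then show "pushforward A (\<phi> 0) v f = v f" using tangent_notin[OF v] by (simp add: pushforward_def)
  qed
  ultimately show ?thesis using v w p \<phi> by (simp add: is_flow_def)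
qed

section \<open>The cone\<close>

lemma bracket_cong:
  assumes M: "smooth_manifold A" and X: "X \<in> vfields A" "X' \<in> vfields A" and Y: "Y \<in> vfields A" and p: "p \<in> mcarrier A"
    and e: "\<And>q. q \<in> mcarrier A \<Longrightarrow> X q = X' q"
  shows "bracket X Y p = bracket X' Y p"
  unfolding bracket_def using tangent_cong[OF M p vfields_tangent[OF Y p], of "\<lambda>q. X q _" "\<lambda>q. X' q _"] e p
  by (simp add: fun_eq_iff)

abbreviation pos :: "real set" where "pos \<equiv> {0<..}"

lemma cone_atlas_cyl: "cone_atlas A = cyl A pos"
  by (simp add: cone_atlas_def cyl_def half_line_atlas_def)

text \<open>The field \<open>X\<close> on each slice of constant \<open>r\<close>. The value 0 off
  \<open>Cinf\<close>, here and in \<open>Euler\<close>, is what membership in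
  \<open>tangent\<close> demands.\<close>

definition lift :: "('a, 'e::euclidean_space) atlas \<Rightarrow> 'a vfield \<Rightarrow> ('a \<times> real) vfield" where
  "lift A X z f = (if f \<in> Cinf (cyl A pos) then X (fst z) (\<lambda>q. f (q, snd z)) else 0)"

definition Euler :: "('a, 'e::euclidean_space) atlas \<Rightarrow> ('a \<times> real) vfield" where
  "Euler A z f = (if f \<in> Cinf (cyl A pos) then snd z * dt f z else 0)"

lemma lift_vfields:
  assumes M: "smooth_manifold A" and X: "X \<in> vfields A"
  shows "lift A X \<in> vfields (cyl A pos)"
proof -
  have "lift A X (p, r) \<in> tangent (cyl A pos) (p, r)" if p: "p \<in> mcarrier A" and r: "r \<in> pos" for p r
  proof -
    note s = Cinf_slice[OF M open_greaterThan _ r]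
    note t = vfields_tangent[OF X p]
    show ?thesis
      unfolding tangent_def lift_def
      using tangent_add[OF t s s] tangent_mult[OF t s s] tangent_scale[OF t s]
      by (auto simp: Cinf_add Cinf_mult Cinf_scale)
  qed
  moreover have "(\<lambda>z. lift A X z f) \<in> Cinf (cyl A pos)" if "f \<in> Cinf (cyl A pos)" for f
    using Cinf_lift[OF M open_greaterThan X that] that by (simp add: lift_def)
  ultimately show ?thesis unfolding vfields_def by (auto simp: mcarrier_cyl)
qed

lemma Euler_vfields:
  assumes M: "smooth_manifold A"
  shows "Euler A \<in> vfields (cyl A pos)"
proof -
  have "Euler A (p, r) \<in> tangent (cyl A pos) (p, r)" if p: "p \<in> mcarrier A" and r: "r \<in> pos" for p r
  proof -
    note d = dt_has_derivative[OF M open_greaterThan _ p r]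
    have 1: "dt (\<lambda>q. f q + h q) (p, r) = dt f (p, r) + dt h (p, r)"
      and 2: "dt (\<lambda>q. f q * h q) (p, r) = f (p, r) * dt h (p, r) + h (p, r) * dt f (p, r)"
      if "f \<in> Cinf (cyl A pos)" "h \<in> Cinf (cyl A pos)" for f h
      using DERIV_imp_deriv[OF DERIV_add[OF d[OF that(1)] d[OF that(2)]]]
        DERIV_imp_deriv[OF DERIV_mult[OF d[OF that(1)] d[OF that(2)]]]
      by (simp_all add: dt_def mult.commute)
    have 3: "dt (\<lambda>q. c * f q) (p, r) = c * dt f (p, r)" if "f \<in> Cinf (cyl A pos)" for c f
      using DERIV_imp_deriv[OF DERIV_cmult[OF d[OF that], of c]] by (simp add: dt_def)
    show ?thesis
      unfolding tangent_def Euler_def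
      by (auto simp: Cinf_add Cinf_mult Cinf_scale 1 2 3 algebra_simps)
  qed
  moreover have "(\<lambda>z. Euler A z f) \<in> Cinf (cyl A pos)" if "f \<in> Cinf (cyl A pos)" for f
    using Cinf_mult[OF Cinf_snd[OF M open_greaterThan] Cinf_dt[OF M open_greaterThan that]] that
    by (simp add: Euler_def)
  ultimately show ?thesis unfolding vfields_def by (auto simp: mcarrier_cyl)
qed

lemma pushforward_lift:
  assumes M: "smooth_manifold A" and X: "X \<in> vfields A" and p: "p \<in> mcarrier A"
  shows "pushforward A fst (lift A X (p, r)) = X p"
  using tangent_notin[OF vfields_tangent[OF X p]] Cinf_fst[OF M open_greaterThan]
  by (auto simp: pushforward_def lift_def comp_def fun_eq_iff)

lemma pushforward_Euler: "pushforward A fst (Euler A z) = tzero"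
  by (auto simp: pushforward_def Euler_def comp_def fun_eq_iff tzero_def dt_def)

lemma lift_snd:
  assumes M: "smooth_manifold A" and X: "X \<in> vfields A" and p: "p \<in> mcarrier A"
  shows "lift A X (p, r) snd = 0"
  using tangent_const[OF vfields_tangent[OF X p]] by (simp add: lift_def)

lemma Euler_snd: "smooth_manifold A \<Longrightarrow> Euler A z snd = snd z"
  using Cinf_snd[of A pos] by (simp add: Euler_def dt_def)

lemma bracket_lift:
  assumes M: "smooth_manifold A" and X: "X \<in> vfields A" and Y: "Y \<in> vfields A" and z: "z \<in> mcarrier (cyl A pos)"
  shows "bracket (lift A X) (lift A Y) z = lift A (bracket X Y) z"
proof (rule tangent_eqI)
  note C = smooth_manifold_cyl[OF M open_greaterThan]
  show "bracket (lift A X) (lift A Y) z \<in> tangent (cyl A pos) z"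
    by (intro vfields_tangent[OF _ z] bracket_vfields[OF C] lift_vfields[OF M] X Y)
  show "lift A (bracket X Y) z \<in> tangent (cyl A pos) z"
    by (intro vfields_tangent[OF _ z] bracket_vfields[OF M] lift_vfields[OF M] X Y)
  fix f assume f: "f \<in> Cinf (cyl A pos)"
  note v = vfields_Cinf[OF lift_vfields[OF M X] f] vfields_Cinf[OF lift_vfields[OF M Y] f]
  show "bracket (lift A X) (lift A Y) z f = lift A (bracket X Y) z f"
    using f v by (simp add: bracket_def lift_def)
qed

text \<open>A lift differentiates within a slice and treats \<open>r\<close> as a constant, so the
  claim is that \<open>X\<close> commutes with \<open>d/dr\<close>, which is
  \<open>tangent_dt_commute\<close>. Lifts are thus invariant under dilations of the cone.\<close>

lemma bracket_Euler_lift: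
  assumes M: "smooth_manifold A" and X: "X \<in> vfields A" and z: "z \<in> mcarrier (cyl A pos)"
  shows "bracket (Euler A) (lift A X) z = tzero"
proof (rule tangent_eqI)
  note C = smooth_manifold_cyl[OF M open_greaterThan]
  show "bracket (Euler A) (lift A X) z \<in> tangent (cyl A pos) z"
    by (intro vfields_tangent[OF _ z] bracket_vfields[OF C] lift_vfields[OF M] Euler_vfields[OF M] X)
  show "tzero \<in> tangent (cyl A pos) z" by (rule tangent_tzero)
  obtain p r where pr: "z = (p, r)" "p \<in> mcarrier A" "r \<in> pos" using z by (auto simp: mcarrier_cyl)
  fix f assume f: "f \<in> Cinf (cyl A pos)"
  note v = vfields_Cinf[OF lift_vfields[OF M X] f] vfields_Cinf[OF Euler_vfields[OF M] f]
  note t = vfields_tangent[OF X pr(2)]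
  have "dt (\<lambda>z. lift A X z f) (p, r) = X p (\<lambda>q. dt f (q, r))"
    using DERIV_imp_deriv[OF tangent_dt_commute[OF M open_greaterThan pr(2) t f pr(3)]] f
    by (simp add: dt_def lift_def)
  moreover have "X p (\<lambda>q. r * dt f (q, r)) = r * X p (\<lambda>q. dt f (q, r))"
    by (rule tangent_scale[OF t Cinf_slice[OF M open_greaterThan Cinf_dt[OF M open_greaterThan f] pr(3)]])
  ultimately show "bracket (Euler A) (lift A X) z f = tzero f"
    using v f by (simp add: bracket_def pr Euler_def[of A "(p, r)"] lift_def[of A X "(p, r)"] tzero_def)
      (simp add: Euler_def)
qed

text \<open>Lifts and the Euler field span every tangent space of the cone, so tensors can be
  compared on them alone. The divisor \<open>r\<close> appears because the Euler field takes the
  value \<open>r\<close> on \<open>snd\<close>.\<close>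

lemma cone_tangent_split:
  assumes M: "smooth_manifold A" and z: "(p, r) \<in> mcarrier (cyl A pos)" and v: "v \<in> tangent (cyl A pos) (p, r)"
  obtains X where "X \<in> vfields A" "v = tadd (lift A X (p, r)) (tscale (v snd / r) (Euler A (p, r)))"
proof -
  have p: "p \<in> mcarrier A" "r \<in> pos" using z by (auto simp: mcarrier_cyl)
  obtain X where X: "X \<in> vfields A" "X p = pushforward A fst v"
    using tangent_extend[OF M p(1) pushforward_fst_tangent[OF M open_greaterThan v]] by metis
  have "v = tadd (lift A X (p, r)) (tscale (v snd / r) (Euler A (p, r)))"
  proof (rule tangent_eqI[OF v])
    show "tadd (lift A X (p, r)) (tscale (v snd / r) (Euler A (p, r))) \<in> tangent (cyl A pos) (p, r)"
      by (intro tangent_tadd tangent_tscale vfields_tangent[OF _ z] lift_vfields[OF M] Euler_vfields[OF M] X)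
    fix f assume "f \<in> Cinf (cyl A pos)"
    then show "v f = tadd (lift A X (p, r)) (tscale (v snd / r) (Euler A (p, r))) f"
      using tangent_cyl_split[OF M open_greaterThan p v] X(2) p(2)
      by (simp add: tadd_def tscale_def lift_def Euler_def)
  qed
  then show ?thesis using that X by blast
qed

text \<open>Here \<open>I\<close> is any complex structure of the kind whose existence
  \<open>sasakian\<close> asserts.\<close>

locale sasakian_cone =
  fixes A :: "('a::{t2_space,second_countable_topology}, 'e::euclidean_space) atlas"
    and g :: "'a \<Rightarrow> 'a tvec \<Rightarrow> 'a tvec \<Rightarrow> real" and \<eta> :: "'a \<Rightarrow> 'a tvec \<Rightarrow> real"
    and \<xi> :: "'a vfield" and I :: "'a \<times> real \<Rightarrow> ('a \<times> real) tvec \<Rightarrow> ('a \<times> real) tvec"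
  assumes M: "smooth_manifold A" and g: "riemannian_metric A g" and \<eta>: "one_form A \<eta>"
    and reeb: "reeb_field A \<eta> \<xi>"
    and kaehler: "kaehler (cone_atlas A) (cone_metric A g) I (ext_deriv (form_of (cone_form A \<eta>)))"
begin

abbreviation "C \<equiv> cyl A pos"
abbreviation "gC \<equiv> cone_metric A g"
abbreviation "\<alpha> \<equiv> cone_form A \<eta>"
abbreviation "L \<equiv> lift A"
abbreviation "E \<equiv> Euler A"

text \<open>The Kaehler form as a tensor on single tangent vectors, whereas \<open>ext_deriv\<close>
  accepts fields; the Kaehler condition identifies the two.\<close>

definition \<omega> :: "'a \<times> real \<Rightarrow> ('a \<times> real) tvec \<Rightarrow> ('a \<times> real) tvec \<Rightarrow> real" where
  "\<omega> z u v = gC z u (I z v)"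

lemma C: "smooth_manifold C" by (rule smooth_manifold_cyl[OF M open_greaterThan])

lemma \<xi>: "\<xi> \<in> vfields A" using reeb by (simp add: reeb_field_def)

lemma gC: "riemannian_metric C gC"
  and endo: "endo_field C I"
  and II: "z \<in> mcarrier C \<Longrightarrow> v \<in> tangent C z \<Longrightarrow> I z (I z v) = tscale (- 1) v"
  and nij: "X \<in> vfields C \<Longrightarrow> Y \<in> vfields C \<Longrightarrow> z \<in> mcarrier C \<Longrightarrow> nijenhuis I X Y z = tzero"
  and gC_I: "z \<in> mcarrier C \<Longrightarrow> v \<in> tangent C z \<Longrightarrow> w \<in> tangent C z \<Longrightarrow> gC z (I z v) (I z w) = gC z v w"
  and kf: "X \<in> vfields C \<Longrightarrow> Y \<in> vfields C \<Longrightarrow> z \<in> mcarrier C \<Longrightarrow>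
    ext_deriv (form_of \<alpha>) [X, Y] z = complex_of_real (\<omega> z (X z) (Y z))"
  and closed: "X \<in> vfields C \<Longrightarrow> Y \<in> vfields C \<Longrightarrow> Z \<in> vfields C \<Longrightarrow> z \<in> mcarrier C \<Longrightarrow>
    ext_deriv (ext_deriv (form_of \<alpha>)) [X, Y, Z] z = 0"
  using kaehler unfolding kaehler_def complex_structure_def cone_atlas_cyl \<omega>_def by blast+

lemma I_tangent: "z \<in> mcarrier C \<Longrightarrow> v \<in> tangent C z \<Longrightarrow> I z v \<in> tangent C z"
  and I_scale: "z \<in> mcarrier C \<Longrightarrow> v \<in> tangent C z \<Longrightarrow> I z (tscale c v) = tscale c (I z v)"
  using endo unfolding endo_field_def by blast+

lemma I_tzero: "z \<in> mcarrier C \<Longrightarrow> I z tzero = tzero"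
  using I_scale[OF _ tangent_tzero, of z 0] by (simp add: tzero_eq_tscale[of tzero, symmetric])
    (simp add: tscale_def tzero_def)

lemma L: "X \<in> vfields A \<Longrightarrow> L X \<in> vfields C" and E: "E \<in> vfields C"
  by (simp_all add: lift_vfields[OF M] Euler_vfields[OF M])

lemma omega_d1:
  assumes "X \<in> vfields C" "Y \<in> vfields C" "z \<in> mcarrier C"
  shows "\<omega> z (X z) (Y z) = d1 \<alpha> X Y z"
  using kf[OF assms] ext_deriv_one_form[OF assms, of \<alpha>] by simp

text \<open>Since \<open>I\<close> is isometric, it can be applied to both arguments; the claim then
  follows because \<open>I\<close> squares to -1 and the metric is symmetric.\<close>

lemma omega_skew:
  assumes z: "z \<in> mcarrier C" and u: "u \<in> tangent C z" and v: "v \<in> tangent C z"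
  shows "\<omega> z u v = - \<omega> z v u"
proof -
  have "\<omega> z u v = gC z (I z u) (I z (I z v))"
    unfolding \<omega>_def by (rule gC_I[OF z u I_tangent[OF z v], symmetric])
  also have "\<dots> = - gC z (I z u) v"
    using metric_scale_right[OF gC z I_tangent[OF z u] v] by (simp add: II[OF z v])
  also have "\<dots> = - \<omega> z v u"
    using metric_sym[OF gC z I_tangent[OF z u] v] by (simp add: \<omega>_def)
  finally show ?thesis .
qed

lemma omega_Cinf: "X \<in> vfields C \<Longrightarrow> Y \<in> vfields C \<Longrightarrow> (\<lambda>z. \<omega> z (X z) (Y z)) \<in> Cinf C"
  unfolding \<omega>_def by (intro metric_Cinf[OF gC] endo_field_vfields[OF endo])

lemma closed_omega:
  assumes "X \<in> vfields C" "Y \<in> vfields C" "Z \<in> vfields C" "z \<in> mcarrier C"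
  shows "d2 (\<lambda>X Y z. \<omega> z (X z) (Y z)) X Y Z z = 0"
  using ext_deriv_two_form[OF C, of "ext_deriv (form_of \<alpha>)" "\<lambda>X Y z. \<omega> z (X z) (Y z)", OF kf assms]
    closed[OF assms] by simp

lemma gC_Euler: "gC (p, r) v (E (p, r)) = r * v snd" if "p \<in> mcarrier A" "r \<in> pos" "v \<in> tangent C (p, r)"
  using metric_tzero(1)[OF g that(1) pushforward_fst_tangent[OF M open_greaterThan that(3)]]
  by (simp add: cone_metric_def pushforward_Euler Euler_snd[OF M])

lemma gC_lift: "gC (p, r) v (L X (p, r)) = r\<^sup>2 * g p (pushforward A fst v) (X p)"
  if "p \<in> mcarrier A" "X \<in> vfields A"
  using that by (simp add: cone_metric_def pushforward_lift[OF M] lift_snd[OF M])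

text \<open>Along lifts \<open>r\<close> is constant, so \<open>r^2\<close> factors out of
  \<open>d(r^2 \<eta>)\<close>.\<close>

lemma omega_lift_lift:
  assumes X: "X \<in> vfields A" and Y: "Y \<in> vfields A" and p: "p \<in> mcarrier A" and r: "r \<in> pos"
  shows "\<omega> (p, r) (L X (p, r)) (L Y (p, r)) = r\<^sup>2 * d1 \<eta> X Y p"
proof -
  have z: "(p, r) \<in> mcarrier C" using p r by (simp add: mcarrier_cyl)
  have e: "L X (p, r) (\<lambda>z. \<alpha> z (L Y z)) = r\<^sup>2 * X p (\<lambda>q. \<eta> q (Y q))" if X: "X \<in> vfields A" and Y: "Y \<in> vfields A" for X Y
  proof -
    let ?h = "\<lambda>z. (snd z * snd z) * \<eta> (fst z) (Y (fst z))"
    note c = one_form_Cinf[OF \<eta> Y]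
    have h: "?h \<in> Cinf C"
      by (intro Cinf_mult Cinf_snd[OF M open_greaterThan] Cinf_fst[OF M open_greaterThan c])
    have "L X (p, r) (\<lambda>z. \<alpha> z (L Y z)) = L X (p, r) ?h"
      by (rule tangent_cong[OF C z vfields_tangent[OF L[OF X] z]])
        (auto simp: cone_form_def mcarrier_cyl pushforward_lift[OF M Y] power2_eq_square)
    also have "\<dots> = X p (\<lambda>q. r\<^sup>2 * \<eta> q (Y q))" using h by (simp add: lift_def power2_eq_square)
    also have "\<dots> = r\<^sup>2 * X p (\<lambda>q. \<eta> q (Y q))"
      by (rule tangent_scale[OF vfields_tangent[OF X p] c])
    finally show ?thesis .
  qed
  show ?thesis
    unfolding omega_d1[OF L[OF X] L[OF Y] z] d1_def e[OF X Y] e[OF Y X] bracket_lift[OF M X Y z]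
    by (simp add: cone_form_def pushforward_lift[OF M bracket_vfields[OF M X Y] p] algebra_simps)
qed

lemma \<eta>_tzero: "p \<in> mcarrier A \<Longrightarrow> \<eta> p tzero = 0"
  using one_form_scale[OF \<eta> _ tangent_tzero, of p 0] by (simp add: tzero_def tscale_def)

lemma \<alpha>_Euler: "z \<in> mcarrier C \<Longrightarrow> \<alpha> z (E z) = 0"
  by (auto simp: cone_form_def pushforward_Euler \<eta>_tzero mcarrier_cyl)

text \<open>Only the term differentiated by \<open>E\<close> survives, since \<open>\<alpha>\<close>
  vanishes on \<open>E\<close> and \<open>E\<close> commutes with lifts; the factor
  \<open>2 * r^2\<close> is \<open>E\<close> applied to \<open>r^2\<close>.\<close>

lemma omega_Euler_lift:
  assumes X: "X \<in> vfields A" and p: "p \<in> mcarrier A" and r: "r \<in> pos"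
  shows "\<omega> (p, r) (E (p, r)) (L X (p, r)) = 2 * r\<^sup>2 * \<eta> p (X p)"
proof -
  have z: "(p, r) \<in> mcarrier C" using p r by (simp add: mcarrier_cyl)
  let ?h = "\<lambda>z. (snd z * snd z) * \<eta> (fst z) (X (fst z))"
  have h: "?h \<in> Cinf C"
    by (intro Cinf_mult Cinf_snd[OF M open_greaterThan] Cinf_fst[OF M open_greaterThan one_form_Cinf[OF \<eta> X]])
  have "E (p, r) (\<lambda>z. \<alpha> z (L X z)) = E (p, r) ?h"
    by (rule tangent_cong[OF C z vfields_tangent[OF E z]])
      (auto simp: cone_form_def mcarrier_cyl pushforward_lift[OF M X] power2_eq_square)
  also have "\<dots> = r * (2 * r * \<eta> p (X p))"
  proof -
    have "((\<lambda>s. s * s * \<eta> p (X p)) has_real_derivative 2 * r * \<eta> p (X p)) (at r)"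
      by (auto intro!: derivative_eq_intros)
    then show ?thesis using h by (simp add: Euler_def dt_def DERIV_imp_deriv)
  qed
  finally have 1: "E (p, r) (\<lambda>z. \<alpha> z (L X z)) = 2 * r\<^sup>2 * \<eta> p (X p)" by (simp add: power2_eq_square)
  have "L X (p, r) (\<lambda>z. \<alpha> z (E z)) = L X (p, r) (\<lambda>z. 0)"
    by (rule tangent_cong[OF C z vfields_tangent[OF L[OF X] z]]) (rule \<alpha>_Euler)
  also have "\<dots> = 0" by (rule tangent_const[OF vfields_tangent[OF L[OF X] z]])
  finally have 2: "L X (p, r) (\<lambda>z. \<alpha> z (E z)) = 0" .
  have "pushforward A fst (tzero :: ('a \<times> real) tvec) = tzero" by (simp add: pushforward_def tzero_def fun_eq_iff)
  then have 3: "\<alpha> (p, r) tzero = 0" using \<eta>_tzero[OF p] by (simp add: cone_form_def)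
  show ?thesis
    unfolding omega_d1[OF E L[OF X] z] d1_def 1 2 bracket_Euler_lift[OF M X z] 3 by simp
qed

lemma cone_eqI:
  assumes z: "z \<in> mcarrier C" and uv: "u \<in> tangent C z" "v \<in> tangent C z"
    and l: "\<And>X. X \<in> vfields A \<Longrightarrow> gC z (L X z) u = gC z (L X z) v" and e: "gC z (E z) u = gC z (E z) v"
  shows "u = v"
proof (rule metric_nondegenerate[OF gC z uv])
  fix w assume w: "w \<in> tangent C z"
  obtain X where X: "X \<in> vfields A" "w = tadd (L X z) (tscale (w snd / snd z) (E z))"
    using cone_tangent_split[OF M, of "fst z" "snd z" w] z w by auto
  have t: "L X z \<in> tangent C z" "E z \<in> tangent C z" 
    by (rule vfields_tangent[OF L[OF X(1)] z], rule vfields_tangent[OF E z])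
  have "gC z y w = gC z (L X z) y + w snd / snd z * gC z (E z) y" if y: "y \<in> tangent C z" for y
    by (subst X(2))
      (simp add: metric_add_right[OF gC z y t(1) tangent_tscale[OF t(2)]]
        metric_scale_right[OF gC z y t(2)] metric_sym[OF gC z y] t)
  then show "gC z w u = gC z w v"
    using l[OF X(1)] e uv metric_sym[OF gC z w] by simp
qed

lemma d1_reeb: "X \<in> vfields A \<Longrightarrow> p \<in> mcarrier A \<Longrightarrow> d1 \<eta> \<xi> X p = 0"
  using reeb ext_deriv_one_form[OF \<xi>, of X p \<eta>] by (simp add: reeb_field_def)

lemma reeb_1: "p \<in> mcarrier A \<Longrightarrow> \<eta> p (\<xi> p) = 1"
  using reeb by (simp add: reeb_field_def)

text \<open>Both sides are paired with the spanning fields. Against a lift, the left side is a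
  multiple of \<open>d\<eta>\<close> with the Reeb field, hence 0, and lifts are orthogonal to
  \<open>E\<close>; against \<open>E\<close>, both sides give \<open>2 * r^2\<close>.\<close>

lemma I_reeb:
  assumes z: "z \<in> mcarrier C"
  shows "I z (L \<xi> z) = tscale 2 (E z)"
proof -
  obtain p r where pr: "z = (p, r)" "p \<in> mcarrier A" "r \<in> pos" using z by (auto simp: mcarrier_cyl)
  note t = vfields_tangent[OF L z] vfields_tangent[OF E z]
  show ?thesis
  proof (rule cone_eqI[OF z])
    show "I z (L \<xi> z) \<in> tangent C z" by (intro I_tangent z t \<xi>)
    show "tscale 2 (E z) \<in> tangent C z" by (intro tangent_tscale t)
    fix X assume X: "X \<in> vfields A"
    have "gC z (L X z) (I z (L \<xi> z)) = 0"
      using omega_lift_lift[OF X \<xi> pr(2,3)] d1_skew[OF M \<eta> \<xi> X pr(2)] d1_reeb[OF X pr(2)]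
      by (simp add: \<omega>_def pr)
    moreover have "gC z (L X z) (tscale 2 (E z)) = 0"
      using metric_scale_right[OF gC z t(1)[OF X] t(2)] gC_Euler[OF pr(2,3)] t(1)[OF X] lift_snd[OF M X pr(2)]
      by (simp add: pr)
    ultimately show "gC z (L X z) (I z (L \<xi> z)) = gC z (L X z) (tscale 2 (E z))" by simp
  next
    have "gC z (E z) (I z (L \<xi> z)) = 2 * r\<^sup>2"
      using omega_Euler_lift[OF \<xi> pr(2,3)] reeb_1[OF pr(2)] by (simp add: \<omega>_def pr)
    moreover have "gC z (E z) (tscale 2 (E z)) = 2 * r\<^sup>2"
      using metric_scale_right[OF gC z t(2,2)] gC_Euler[OF pr(2,3)] t(2) Euler_snd[OF M, of "(p, r)"]
      by (simp add: pr power2_eq_square)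
    ultimately show "gC z (E z) (I z (L \<xi> z)) = gC z (E z) (tscale 2 (E z))" by simp
  qed
qed

lemma I_Euler:
  assumes z: "z \<in> mcarrier C"
  shows "I z (E z) = tscale (- 1 / 2) (L \<xi> z)"
proof -
  note t = vfields_tangent[OF L[OF \<xi>] z] vfields_tangent[OF E z]
  have "tscale 2 (I z (E z)) = tscale (- 1) (L \<xi> z)"
    using II[OF z t(1)] I_scale[OF z t(2)] by (simp add: I_reeb[OF z])
  then show ?thesis by (simp add: tscale_def fun_eq_iff field_simps)
qed

lemma omega_Euler_gC:
  assumes z: "z \<in> mcarrier C" and v: "v \<in> tangent C z"
  shows "\<omega> z (E z) v = gC z v (L \<xi> z) / 2"
  using omega_skew[OF z vfields_tangent[OF E z] v] metric_scale_right[OF gC z v vfields_tangent[OF L[OF \<xi>] z]]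
  by (simp add: \<omega>_def I_Euler[OF z])

text \<open>Two evaluations of the Kaehler form on \<open>E\<close> and a lift are compared at
  \<open>r = 1\<close>: the exterior derivative gives \<open>2 * \<eta>\<close>, while
  \<open>I E = - \<xi> / 2\<close> gives half of \<open>g\<close> with \<open>\<xi>\<close>. Hence
  the 4.\<close>

lemma g_reeb:
  assumes p: "p \<in> mcarrier A" and v: "v \<in> tangent A p"
  shows "g p v (\<xi> p) = 4 * \<eta> p v"
proof -
  obtain X where X: "X \<in> vfields A" "X p = v" using tangent_extend[OF M p v] by metis
  have z: "(p, 1) \<in> mcarrier C" using p by (simp add: mcarrier_cyl)
  have "2 * \<eta> p v = gC (p, 1) (L X (p, 1)) (L \<xi> (p, 1)) / 2"
    using omega_Euler_lift[OF X(1) p, of 1] omega_Euler_gC[OF z vfields_tangent[OF L[OF X(1)] z]] X by simp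
  then show ?thesis using gC_lift[OF p \<xi>] by (simp add: pushforward_lift[OF M X(1) p] X(2))
qed

text \<open>As a one-form, \<open>\<iota>_\<xi> \<omega> = - d(r^2)\<close>. Being exact, it drops
  out of Cartan's formula.\<close>

lemma omega_reeb:
  assumes z: "z \<in> mcarrier C" and v: "v \<in> tangent C z"
  shows "\<omega> z (L \<xi> z) v = (- 2 * snd z) * v snd"
proof -
  obtain p r where pr: "z = (p, r)" "p \<in> mcarrier A" "r \<in> pos" using z by (auto simp: mcarrier_cyl)
  have "\<omega> z (L \<xi> z) v = - gC z v (tscale 2 (E z))"
    using omega_skew[OF z vfields_tangent[OF L[OF \<xi>] z] v] by (simp add: \<omega>_def I_reeb[OF z])
  also have "\<dots> = - 2 * (r * v snd)"
    using metric_scale_right[OF gC z v vfields_tangent[OF E z]] gC_Euler[OF pr(2,3)] v by (simp add: pr)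
  finally show ?thesis by (simp add: pr)
qed

text \<open>That is, \<open>\<iota>_E \<omega> = 2 \<alpha>\<close>, whose exterior derivative is
  twice the Kaehler form; this is the source of the degree of homogeneity.\<close>

lemma omega_Euler:
  assumes z: "z \<in> mcarrier C" and v: "v \<in> tangent C z"
  shows "\<omega> z (E z) v = 2 * \<alpha> z v"
proof -
  obtain p r where pr: "z = (p, r)" "p \<in> mcarrier A" "r \<in> pos" using z by (auto simp: mcarrier_cyl)
  have "pushforward A fst v \<in> tangent A p"
    using pushforward_fst_tangent[OF M open_greaterThan] v pr by blast
  then show ?thesis
    using omega_Euler_gC[OF z v] gC_lift[OF pr(2) \<xi>] g_reeb[OF pr(2)] by (simp add: pr cone_form_def)
qed

text \<open>In the expansion of \<open>d\<omega> (\<xi>, X, Z) = 0\<close> the three terms with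
  \<open>\<omega>\<close> evaluated on \<open>\<xi>\<close> make up, up to sign, the exterior
  derivative of an exact one-form and cancel. The rest is the Lie derivative.\<close>

lemma Lie_reeb_omega:
  assumes X: "X \<in> vfields C" and Z: "Z \<in> vfields C" and z: "z \<in> mcarrier C"
  shows "L \<xi> z (\<lambda>z. \<omega> z (X z) (Z z)) = \<omega> z (bracket (L \<xi>) X z) (Z z) + \<omega> z (X z) (bracket (L \<xi>) Z z)"
proof -
  note t = vfields_tangent and b = bracket_vfields[OF C]
  note R = L[OF \<xi>] and s = Cinf_snd[OF M open_greaterThan]
  have d: "X z (\<lambda>z. \<omega> z (L \<xi> z) (Z z)) = - 2 * (snd z * X z (\<lambda>z. Z z snd) + Z z snd * X z snd)"
    if X: "X \<in> vfields C" and Z: "Z \<in> vfields C" for X Z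
  proof -
    note c = vfields_Cinf[OF Z s]
    have "X z (\<lambda>z. \<omega> z (L \<xi> z) (Z z)) = X z (\<lambda>z. - 2 * (snd z * Z z snd))"
      by (rule tangent_cong[OF C z t[OF X z]]) (simp add: omega_reeb t Z)
    also have "\<dots> = - 2 * X z (\<lambda>z. snd z * Z z snd)" by (rule tangent_scale[OF t[OF X z] Cinf_mult[OF s c]])
    finally show ?thesis using tangent_mult[OF t[OF X z] s c] by simp
  qed
  have "\<omega> z (bracket X Z z) (L \<xi> z) = 2 * snd z * (X z (\<lambda>z. Z z snd) - Z z (\<lambda>z. X z snd))"
    using omega_skew[OF z t[OF b[OF X Z] z] t[OF R z]] omega_reeb[OF z t[OF b[OF X Z] z]]
    by (simp add: bracket_def)
  moreover have "\<omega> z (bracket (L \<xi>) Z z) (X z) = - \<omega> z (X z) (bracket (L \<xi>) Z z)"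
    by (intro omega_skew z t X b R Z)
  ultimately show ?thesis
    using closed_omega[OF R X Z z] unfolding d2_def d[OF X Z] d[OF Z X]
    by (simp add: algebra_simps)
qed

text \<open>As for the Reeb field, but the three terms with \<open>\<omega>\<close> evaluated on
  \<open>E\<close> now make up \<open>- 2 d\<alpha>\<close>, which is
  \<open>- 2 \<omega>\<close>.\<close>

lemma Lie_Euler_omega:
  assumes X: "X \<in> vfields C" and Z: "Z \<in> vfields C" and z: "z \<in> mcarrier C"
  shows "E z (\<lambda>z. \<omega> z (X z) (Z z)) =
    2 * \<omega> z (X z) (Z z) + \<omega> z (bracket E X z) (Z z) + \<omega> z (X z) (bracket E Z z)"
proof -
  note t = vfields_tangent and b = bracket_vfields[OF C]
  have d: "X z (\<lambda>z. \<omega> z (E z) (Z z)) = 2 * X z (\<lambda>z. \<alpha> z (Z z))"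
    if X: "X \<in> vfields C" and Z: "Z \<in> vfields C" for X Z
  proof -
    have "X z (\<lambda>z. \<alpha> z (Z z)) = X z (\<lambda>z. (1 / 2) * \<omega> z (E z) (Z z))"
      by (rule tangent_cong[OF C z t[OF X z]]) (simp add: omega_Euler t Z)
    also have "\<dots> = (1 / 2) * X z (\<lambda>z. \<omega> z (E z) (Z z))"
      by (rule tangent_scale[OF t[OF X z] omega_Cinf[OF E Z]])
    finally show ?thesis by simp
  qed
  have "\<omega> z (bracket X Z z) (E z) = - 2 * \<alpha> z (bracket X Z z)"
    using omega_skew[OF z t[OF b[OF X Z] z] t[OF E z]] omega_Euler[OF z t[OF b[OF X Z] z]] by simp
  moreover have "\<omega> z (bracket E Z z) (X z) = - \<omega> z (X z) (bracket E Z z)"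
    by (intro omega_skew z t X b E Z)
  ultimately show ?thesis
    using closed_omega[OF E X Z z] omega_d1[OF X Z z] unfolding d2_def d[OF X Z] d[OF Z X]
    by (simp add: d1_def)
qed

lemma omega_I:
  assumes "z \<in> mcarrier C" "u \<in> tangent C z" "v \<in> tangent C z"
  shows "\<omega> z u (I z v) = - gC z u v"
  unfolding \<omega>_def II[OF assms(1,3)] using metric_scale_right[OF gC assms, of "- 1"] by simp

text \<open>The function \<open>\<omega> (L Y, I (L X)) = - r^2 g(Y, X)\<close> is homogeneous of
  degree 2, so \<open>E\<close> doubles it. In \<open>Lie_Euler_omega\<close> this balances the
  factor 2 on the right, and \<open>E\<close> commutes with \<open>L Y\<close>; what remains is
  \<open>\<omega> (L Y, [E, I (L X)]) = 0\<close>.\<close>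

lemma bracket_Euler_I_lift:
  assumes X: "X \<in> vfields A" and z: "z \<in> mcarrier C"
  shows "bracket E (\<lambda>z. I z (L X z)) z = tzero"
proof -
  let ?Z = "\<lambda>z. I z (L X z)"
  have Z: "?Z \<in> vfields C" by (rule endo_field_vfields[OF endo L[OF X]])
  note t = vfields_tangent
  have bt: "bracket E ?Z z \<in> tangent C z" by (intro t[OF bracket_vfields[OF C]] E Z z)
  obtain p r where pr: "z = (p, r)" "p \<in> mcarrier A" "r \<in> pos" using z by (auto simp: mcarrier_cyl)
  have l: "\<omega> z (L Y z) (bracket E ?Z z) = 0" if Y: "Y \<in> vfields A" for Y
  proof -
    let ?h = "\<lambda>z. (- 1 * (snd z * snd z)) * g (fst z) (Y (fst z)) (X (fst z))"
    have h: "?h \<in> Cinf C"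
      by (intro Cinf_mult Cinf_const Cinf_snd[OF M open_greaterThan] Cinf_fst[OF M open_greaterThan metric_Cinf[OF g Y X]])
    have e: "\<omega> z (L Y z) (?Z z) = ?h z" if "z \<in> mcarrier C" for z
      using omega_I[OF that t[OF L[OF Y] that] t[OF L[OF X] that]] that gC_lift[OF _ X]
      by (auto simp: mcarrier_cyl pushforward_lift[OF M Y] power2_eq_square)
    have "E z (\<lambda>z. \<omega> z (L Y z) (?Z z)) = E z ?h"
      by (rule tangent_cong[OF C z t[OF E z]]) (rule e)
    also have "\<dots> = 2 * ?h z"
    proof -
      have "((\<lambda>s. (- 1 * (s * s)) * g p (Y p) (X p)) has_real_derivative (- 2 * r) * g p (Y p) (X p)) (at r)"
        by (auto intro!: derivative_eq_intros)
      then show ?thesis using h by (simp add: Euler_def dt_def DERIV_imp_deriv pr)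
    qed
    finally have "E z (\<lambda>z. \<omega> z (L Y z) (?Z z)) = 2 * \<omega> z (L Y z) (?Z z)" using e[OF z] by simp
    moreover have "\<omega> z tzero (?Z z) = 0"
      unfolding \<omega>_def by (intro metric_tzero(2)[OF gC z] I_tangent z t Z)
    ultimately show ?thesis
      using Lie_Euler_omega[OF L[OF Y] Z z] by (simp add: bracket_Euler_lift[OF M Y z])
  qed
  \<comment> \<open>The same test against \<open>E\<close>: here
    \<open>\<omega> (E, I (L X))\<close> is identically zero, because lifts are orthogonal to
    \<open>E\<close>.\<close>
  have e: "\<omega> z (E z) (bracket E ?Z z) = 0"
  proof -
    have 0: "\<omega> z (E z) (?Z z) = 0" if z: "z \<in> mcarrier C" for z
    proof -
      have "gC z (E z) (L X z) = gC z (L X z) (E z)"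
        by (intro metric_sym[OF gC z] t z E L X)
      moreover have "gC z (L X z) (E z) = 0"
        using gC_Euler[of "fst z" "snd z" "L X z"] lift_snd[OF M X, of "fst z" "snd z"] z t[OF L[OF X] z]
        by (auto simp: mcarrier_cyl)
      ultimately show ?thesis using omega_I[OF z t[OF E z] t[OF L[OF X] z]] by simp
    qed
    have "E z (\<lambda>z. \<omega> z (E z) (?Z z)) = E z (\<lambda>z. 0)"
      by (rule tangent_cong[OF C z t[OF E z]]) (rule 0)
    also have "\<dots> = 0" by (rule tangent_const[OF t[OF E z]])
    finally have "E z (\<lambda>z. \<omega> z (E z) (?Z z)) = 0" .
    moreover have "bracket E E z = tzero" by (simp add: bracket_def tzero_def fun_eq_iff)
    moreover have "\<omega> z tzero (?Z z) = 0"
      unfolding \<omega>_def by (intro metric_tzero(2)[OF gC z] I_tangent z t Z)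
    ultimately show ?thesis using Lie_Euler_omega[OF E Z z] 0[OF z] by simp
  qed
  \<comment> \<open>Since \<open>\<omega> (w, v)\<close> is the metric on \<open>w\<close> and
    \<open>I v\<close>, the facts \<open>l\<close> and \<open>e\<close> say that \<open>I\<close> of
    the bracket is orthogonal to the spanning fields; applying \<open>I\<close> once more removes
    it.\<close>
  have "I z (bracket E ?Z z) = tzero"
  proof (rule cone_eqI[OF z I_tangent[OF z bt] tangent_tzero])
    show "gC z (E z) (I z (bracket E ?Z z)) = gC z (E z) tzero"
      using e metric_tzero(1)[OF gC z t[OF E z]] by (simp add: \<omega>_def)
    show "gC z (L Y z) (I z (bracket E ?Z z)) = gC z (L Y z) tzero" if "Y \<in> vfields A" for Y
      using l[OF that] metric_tzero(1)[OF gC z t[OF L[OF that] z]] by (simp add: \<omega>_def)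
  qed
  then have "tscale (- 1) (bracket E ?Z z) = tzero" using II[OF z bt] I_tzero[OF z] by simp
  then show ?thesis by (simp add: tscale_def tzero_def fun_eq_iff)
qed

text \<open>In the Nijenhuis tensor on \<open>E\<close> and \<open>L X\<close> the two terms with
  \<open>E\<close> itself in a bracket vanish; the other two contain \<open>I E\<close>, a constant
  multiple of \<open>L \<xi>\<close>, and the constant cancels.\<close>

lemma bracket_reeb_I_lift:
  assumes X: "X \<in> vfields A" and z: "z \<in> mcarrier C"
  shows "bracket (L \<xi>) (\<lambda>z. I z (L X z)) z = I z (bracket (L \<xi>) (L X) z)"
proof -
  let ?Z = "\<lambda>z. I z (L X z)"
  have Z: "?Z \<in> vfields C" by (rule endo_field_vfields[OF endo L[OF X]])
  note R = L[OF \<xi>]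
  have IE: "bracket (\<lambda>z. I z (E z)) V z = tscale (- 1 / 2) (bracket (L \<xi>) V z)" if V: "V \<in> vfields C" for V
  proof -
    have "bracket (\<lambda>z. I z (E z)) V z = bracket (\<lambda>z. tscale (- 1 / 2) (L \<xi> z)) V z"
      by (rule bracket_cong[OF C endo_field_vfields[OF endo E] vfields_scale[OF R Cinf_const] V z I_Euler])
    then show ?thesis
      using tangent_const[OF vfields_tangent[OF V z]]
      by (simp add: bracket_scale[OF C R Cinf_const V z]) (simp add: tadd_def tscale_def)
  qed
  have bt: "bracket (L \<xi>) (L X) z \<in> tangent C z"
    by (intro vfields_tangent[OF bracket_vfields[OF C]] R L X z)
  have "bracket (L \<xi>) ?Z z f = I z (bracket (L \<xi>) (L X) z) f" for f
    using fun_cong[OF nij[OF E L[OF X] z], of f]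
    unfolding nijenhuis_def IE[OF Z] IE[OF L[OF X]] bracket_Euler_lift[OF M X z]
      bracket_Euler_I_lift[OF X z] I_tzero[OF z] I_scale[OF z bt]
    by (simp add: tscale_def tzero_def)
  then show ?thesis by blast
qed

text \<open>\<open>Lie_reeb_omega\<close> is evaluated on \<open>L X\<close> and
  \<open>I (L Y)\<close>. Each of its terms comes from minus the cone metric on lifts, the last one
  thanks to \<open>bracket_reeb_I_lift\<close>, and at \<open>r = 1\<close> the cone metric on lifts
  is \<open>g\<close>.\<close>

lemma Killing: "Killing_field A g \<xi>"
  unfolding Killing_field_def
proof (intro conjI ballI \<xi>)
  fix X Y p assume X: "X \<in> vfields A" and Y: "Y \<in> vfields A" and p: "p \<in> mcarrier A"
  let ?z = "(p, 1 :: real)"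
  let ?Z = "\<lambda>z. I z (L Y z)"
  have z: "?z \<in> mcarrier C" using p by (simp add: mcarrier_cyl)
  have Z: "?Z \<in> vfields C" by (rule endo_field_vfields[OF endo L[OF Y]])
  note t = vfields_tangent and R = L[OF \<xi>] and b = bracket_vfields[OF M \<xi>]
  let ?h = "\<lambda>z. (- 1 * (snd z * snd z)) * g (fst z) (X (fst z)) (Y (fst z))"
  have h: "?h \<in> Cinf C"
    by (intro Cinf_mult Cinf_const Cinf_snd[OF M open_greaterThan] Cinf_fst[OF M open_greaterThan metric_Cinf[OF g X Y]])
  have e: "\<omega> z (L X z) (?Z z) = ?h z" if "z \<in> mcarrier C" for z
    using omega_I[OF that t[OF L[OF X] that] t[OF L[OF Y] that]] that gC_lift[OF _ Y]
    by (auto simp: mcarrier_cyl pushforward_lift[OF M X] power2_eq_square)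
  have "L \<xi> ?z (\<lambda>z. \<omega> z (L X z) (?Z z)) = L \<xi> ?z ?h"
    by (rule tangent_cong[OF C z t[OF R z]]) (rule e)
  also have "\<dots> = \<xi> p (\<lambda>q. - 1 * g q (X q) (Y q))" using h by (simp add: lift_def)
  also have "\<dots> = - 1 * \<xi> p (\<lambda>q. g q (X q) (Y q))"
    by (rule tangent_scale[OF t[OF \<xi> p] metric_Cinf[OF g X Y]])
  finally have 1: "L \<xi> ?z (\<lambda>z. \<omega> z (L X z) (?Z z)) = - \<xi> p (\<lambda>q. g q (X q) (Y q))" by simp
  have 2: "\<omega> ?z (bracket (L \<xi>) (L X) ?z) (?Z ?z) = - g p (bracket \<xi> X p) (Y p)"
    using omega_I[OF z t[OF L[OF b[OF X]] z] t[OF L[OF Y] z]] gC_lift[OF p Y]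
    by (simp add: bracket_lift[OF M \<xi> X z] pushforward_lift[OF M b[OF X] p])
  have 3: "\<omega> ?z (L X ?z) (bracket (L \<xi>) ?Z ?z) = - g p (X p) (bracket \<xi> Y p)"
    using omega_I[OF z t[OF L[OF X] z] t[OF L[OF b[OF Y]] z]] gC_lift[OF p b[OF Y]]
    by (simp add: bracket_reeb_I_lift[OF Y z] bracket_lift[OF M \<xi> Y z] pushforward_lift[OF M X p])
  show "\<xi> p (\<lambda>q. g q (X q) (Y q)) = g p (bracket \<xi> X p) (Y p) + g p (X p) (bracket \<xi> Y p)"
    using Lie_reeb_omega[OF L[OF X] Z z] unfolding 1 2 3 by simp
qed

lemma killing_pair_quarter: "killing_pair A (orbit_foliation \<xi>) (\<lambda>p v w. g p v w / 4) \<xi>"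
  unfolding killing_pair_def
proof (intro conjI ballI allI impI)
  have "(\<lambda>p. g p (X p) (Y p) / 4) \<in> Cinf A" if "X \<in> vfields A" "Y \<in> vfields A" for X Y
    using Cinf_scale[OF metric_Cinf[OF g that], of "1 / 4"] by simp
  then show "riemannian_metric A (\<lambda>p v w. g p v w / 4)"
    using g unfolding riemannian_metric_def by (simp add: add_divide_distrib)
  have "\<xi> p = tscale 1 (\<xi> p)" for p by (simp add: tscale_def)
  then show "\<xi> \<in> tangent_fields A (orbit_foliation \<xi>)"
    using \<xi> by (auto simp: tangent_fields_def orbit_foliation_def)
  fix p assume p: "p \<in> mcarrier A"
  show "\<xi> p \<noteq> tzero" using reeb_1[OF p] \<eta>_tzero[OF p] by auto
  show "g p (\<xi> p) (\<xi> p) / 4 = 1"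
    using g_reeb[OF p vfields_tangent[OF \<xi> p]] reeb_1[OF p] by simp
next
  fix \<phi> t p v w assume "is_flow A \<xi> \<phi>" "p \<in> mcarrier A" "v \<in> tangent A p" "w \<in> tangent A p"
  then show "g (\<phi> t p) (pushforward A (\<phi> t) v) (pushforward A (\<phi> t) w) / 4 = g p v w / 4"
    using Killing_flow_isometry[OF M g Killing] by simp
qed

lemma characteristic_quarter:
  assumes "p \<in> mcarrier A" "v \<in> tangent A p"
  shows "characteristic_form (\<lambda>p v w. g p v w / 4) \<xi> p v = \<eta> p v"
  using g_reeb[OF assms] metric_sym[OF g assms vfields_tangent[OF \<xi> assms(1)]]
  by (simp add: characteristic_form_def)

end

section \<open>The basic Euler class\<close>

text \<open>The characteristic form equals \<open>\<eta>\<close> on tangent vectors over the carrier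
  only; this carries the agreement through the exterior derivative.\<close>

lemma d1_cong_form:
  assumes M: "smooth_manifold A" and X: "X \<in> vfields A" and Y: "Y \<in> vfields A" and p: "p \<in> mcarrier A"
    and e: "\<And>q v. q \<in> mcarrier A \<Longrightarrow> v \<in> tangent A q \<Longrightarrow> \<alpha> q v = \<beta> q v"
  shows "d1 \<alpha> X Y p = d1 \<beta> X Y p"
proof -
  note t = vfields_tangent
  have "X p (\<lambda>q. \<alpha> q (Y q)) = X p (\<lambda>q. \<beta> q (Y q))"
    by (rule tangent_cong[OF M p t[OF X p]]) (intro e t Y)
  moreover have "Y p (\<lambda>q. \<alpha> q (X q)) = Y p (\<lambda>q. \<beta> q (X q))"
    by (rule tangent_cong[OF M p t[OF Y p]]) (intro e t X)
  ultimately show ?thesis unfolding d1_def using e[OF p t[OF bracket_vfields[OF M X Y] p]] by simp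
qed

lemma d1_cong_left:
  assumes M: "smooth_manifold A" and X: "X \<in> vfields A" "X' \<in> vfields A" and Y: "Y \<in> vfields A" and p: "p \<in> mcarrier A"
    and e: "\<And>q. q \<in> mcarrier A \<Longrightarrow> X q = X' q"
  shows "d1 \<alpha> X Y p = d1 \<alpha> X' Y p"
  using tangent_cong[OF M p vfields_tangent[OF Y p], of "\<lambda>q. \<alpha> q (X q)" "\<lambda>q. \<alpha> q (X' q)"]
    bracket_cong[OF M X Y p e] e p by (simp add: d1_def)

lemma one_form_cong:
  assumes M: "smooth_manifold A" and \<alpha>: "one_form A \<alpha>"
    and e: "\<And>q v. q \<in> mcarrier A \<Longrightarrow> v \<in> tangent A q \<Longrightarrow> \<beta> q v = \<alpha> q v"
  shows "one_form A \<beta>"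
  unfolding one_form_def
proof (intro conjI ballI allI)
  show "(\<lambda>p. \<beta> p (X p)) \<in> Cinf A" if X: "X \<in> vfields A" for X
    by (rule Cinf_cong[OF M one_form_Cinf[OF \<alpha> X]]) (simp add: e vfields_tangent[OF X])
qed (simp_all add: e tangent_tadd tangent_tscale one_form_add[OF \<alpha>] one_form_scale[OF \<alpha>])

lemma transverse_metric_sym:
  assumes g: "riemannian_metric A g" and p: "p \<in> mcarrier A" and \<xi>: "\<xi> p \<in> tangent A p"
    and u: "u \<in> tangent A p" and v: "v \<in> tangent A p"
  shows "transverse_metric g \<eta> \<xi> p u v = transverse_metric g \<eta> \<xi> p v u"
  unfolding transverse_metric_def horizontal_def
  by (intro metric_sym[OF g p] tangent_tadd tangent_tscale u v \<xi>)

text \<open>\<open>J\<close> squares to -1 only modulo the leaf direction, so \<open>w\<close> is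
  \<open>- v\<close> plus a multiple \<open>c\<close> of \<open>\<xi>\<close>. Applying
  \<open>\<eta>\<close> identifies \<open>c\<close>, and the horizontal projection removes that
  part.\<close>

lemma transverse_metric_JJ:
  assumes g: "riemannian_metric A g" and \<eta>: "one_form A \<eta>" and p: "p \<in> mcarrier A"
    and \<xi>: "\<xi> p \<in> tangent A p" "\<eta> p (\<xi> p) = 1"
    and u: "u \<in> tangent A p" and v: "v \<in> tangent A p" and w: "w \<in> tangent A p"
    and JJ: "tadd w v \<in> orbit_foliation \<xi> p"
  shows "transverse_metric g \<eta> \<xi> p u w = - transverse_metric g \<eta> \<xi> p u v"
proof -
  obtain c where c: "tadd w v = tscale c (\<xi> p)" using JJ by (auto simp: orbit_foliation_def)
  then have wc: "w f = c * \<xi> p f - v f" for f by (simp add: tadd_def tscale_def fun_eq_iff eq_diff_eq)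
  have "\<eta> p w + \<eta> p v = c"
    using one_form_add[OF \<eta> p w v] one_form_scale[OF \<eta> p \<xi>(1)] \<xi>(2) by (simp add: c)
  then have ew: "\<eta> p w = c - \<eta> p v" by simp
  have "horizontal \<eta> \<xi> p w = tscale (- 1) (horizontal \<eta> \<xi> p v)"
    unfolding horizontal_def tadd_def tscale_def wc ew by (simp add: algebra_simps)
  moreover have "horizontal \<eta> \<xi> p y \<in> tangent A p" if "y \<in> tangent A p" for y
    unfolding horizontal_def by (intro tangent_tadd tangent_tscale that \<xi>)
  ultimately show ?thesis
    using metric_scale_right[OF g p, of "horizontal \<eta> \<xi> p u" "horizontal \<eta> \<xi> p v" "- 1"] u v
    by (simp add: transverse_metric_def)
qed

text \<open>With \<open>T\<close> the transverse metric, \<open>d\<eta> (J X, Y) = T (X, Y)\<close>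
  and \<open>d\<eta> (X, J Y) = - T (X, Y)\<close>, so the two imaginary terms of
  \<open>antiholo_part_2\<close> cancel; the two real ones cancel by \<open>J\<close>-invariance.
  The form \<open>\<omega>\<close> stands for the derivative of a one-form that agrees with
  \<open>\<eta>\<close> on tangent vectors.\<close>

lemma d_eta_degree_11:
  assumes M: "smooth_manifold A" and g: "riemannian_metric A g" and \<eta>: "one_form A \<eta>"
    and R: "reeb_field A \<eta> \<xi>" and J: "underlying_transverse_complex A g \<eta> \<xi> J"
    and \<omega>: "\<And>X Y p. X \<in> vfields A \<Longrightarrow> Y \<in> vfields A \<Longrightarrow> p \<in> mcarrier A \<Longrightarrow> \<omega> [X, Y] p = complex_of_real (d1 \<eta> X Y p)"
  shows "vanishes A 2 (antiholo_part J \<omega>)"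
  unfolding vanishes_def
proof (intro ballI impI)
  fix Xs p assume "Xs \<in> lists (vfields A)" "length Xs = 2" and p: "p \<in> mcarrier A"
  then obtain X Y where X: "X \<in> vfields A" and Y: "Y \<in> vfields A" and Xs: "Xs = [X, Y]"
    by (metis lists_2)
  have \<xi>: "\<xi> p \<in> tangent A p" "\<eta> p (\<xi> p) = 1"
    using R vfields_tangent[OF _ p] p by (auto simp: reeb_field_def)
  have tac: "transverse_almost_complex A (orbit_foliation \<xi>) J"
    using J by (simp add: underlying_transverse_complex_def)
  have endo: "endo_field A J" using tac by (simp add: transverse_almost_complex_def)
  have JX: "(\<lambda>q. J q (X q)) \<in> vfields A" and JY: "(\<lambda>q. J q (Y q)) \<in> vfields A"
    by (rule endo_field_vfields[OF endo X], rule endo_field_vfields[OF endo Y])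
  let ?T = "transverse_metric g \<eta> \<xi> p"
  have d: "d1 \<eta> X Y p = ?T (X p) (J p (Y p))" if "X \<in> vfields A" "Y \<in> vfields A" for X Y
    using J ext_deriv_one_form[OF that p, of \<eta>] that p
    unfolding underlying_transverse_complex_def by (metis of_real_eq_iff)
  note t = vfields_tangent[OF _ p]
  have JJ: "?T (X p) (J p (J p (Y p))) = - ?T (X p) (Y p)"
    if X: "X \<in> vfields A" and Y: "Y \<in> vfields A" for X Y
  proof (rule transverse_metric_JJ[where \<xi>=\<xi> and p=p and g=g and \<eta>=\<eta>, OF g \<eta> p \<xi> t[OF X] t[OF Y]])
    show "J p (J p (Y p)) \<in> tangent A p"
      using t[OF endo_field_vfields[OF endo endo_field_vfields[OF endo Y]]] .
    show "tadd (J p (J p (Y p))) (Y p) \<in> orbit_foliation \<xi> p"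
      using tac t[OF Y] p by (simp add: transverse_almost_complex_def)
  qed
  note sym = transverse_metric_sym[where \<xi>=\<xi> and p=p and g=g and \<eta>=\<eta>, OF g p \<xi>(1)] and skew = d1_skew[OF M \<eta> _ _ p]
  have "d1 \<eta> (\<lambda>q. J q (X q)) Y p = ?T (X p) (Y p)"
    using skew[OF Y JX] d[OF Y JX] JJ[OF Y X] sym[OF t[OF X] t[OF Y]] by simp
  moreover have "d1 \<eta> X (\<lambda>q. J q (Y q)) p = - ?T (X p) (Y p)"
    using d[OF X JY] JJ[OF X Y] by simp
  moreover have "d1 \<eta> (\<lambda>q. J q (X q)) (\<lambda>q. J q (Y q)) p = d1 \<eta> X Y p"
    using d[OF JX JY] JJ[OF JX Y] sym[OF t[OF JX] t[OF Y]] d[OF Y X] skew[OF X Y] by simp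
  ultimately show "antiholo_part J \<omega> Xs p = 0"
    unfolding Xs antiholo_part_2 using \<omega>[OF X Y p] \<omega>[OF JX Y p] \<omega>[OF X JY p] \<omega>[OF JX JY p] by simp
qed

text \<open>A field tangent to the foliation is \<open>\<xi>\<close> times the smooth function
  \<open>\<eta> (X)\<close>, so by tensoriality contraction with it reduces to contraction with
  \<open>\<xi>\<close>. The condition on the derivative is \<open>d d = 0\<close>.\<close>

lemma basic_form_d_eta:
  assumes M: "smooth_manifold A" and \<eta>: "one_form A \<eta>" and \<eta>': "one_form A \<eta>'"
    and e: "\<And>q v. q \<in> mcarrier A \<Longrightarrow> v \<in> tangent A q \<Longrightarrow> \<eta>' q v = \<eta> q v"
    and R: "reeb_field A \<eta> \<xi>"
  shows "basic_form A (orbit_foliation \<xi>) 2 (ext_deriv (form_of \<eta>'))"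
  unfolding basic_form_def
proof (intro conjI ballI impI diff_form_d1[OF M \<eta>'])
  have \<xi>: "\<xi> \<in> vfields A" and \<xi>1: "\<And>p. p \<in> mcarrier A \<Longrightarrow> \<eta> p (\<xi> p) = 1"
    using R by (auto simp: reeb_field_def)
  fix X Ys p assume XF: "X \<in> tangent_fields A (orbit_foliation \<xi>)" and Ys: "Ys \<in> lists (vfields A)" and p: "p \<in> mcarrier A"
  have X: "X \<in> vfields A" using XF by (simp add: tangent_fields_def)
  show "ext_deriv (form_of \<eta>') (X # Ys) p = 0" if "Suc (length Ys) = 2"
  proof -
    obtain Y where Y: "Y \<in> vfields A" "Ys = [Y]"
      using Ys \<open>Suc (length Ys) = 2\<close> by (auto simp: length_Suc_conv)
    have h: "(\<lambda>q. \<eta> q (X q)) \<in> Cinf A" by (rule one_form_Cinf[OF \<eta> X])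
    have "X q = tscale (\<eta> q (X q)) (\<xi> q)" if q: "q \<in> mcarrier A" for q
    proof -
      obtain c where "X q = tscale c (\<xi> q)"
        using XF q by (auto simp: tangent_fields_def orbit_foliation_def)
      then show ?thesis using one_form_scale[OF \<eta> q vfields_tangent[OF \<xi> q]] \<xi>1[OF q] by simp
    qed
    then have "d1 \<eta> X Y p = d1 \<eta> (\<lambda>q. tscale (\<eta> q (X q)) (\<xi> q)) Y p"
      by (rule d1_cong_left[OF M X vfields_scale[OF \<xi> h] Y(1) p])
    also have "\<dots> = \<eta> p (X p) * d1 \<eta> \<xi> Y p" by (rule d1_scale[OF M \<eta> \<xi> h Y(1) p])
    also have "d1 \<eta> \<xi> Y p = 0"
      using R Y(1) p ext_deriv_one_form[OF \<xi> Y(1) p, of \<eta>] by (simp add: reeb_field_def)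
    finally have "d1 \<eta> X Y p = 0" by simp
    then show ?thesis
      using ext_deriv_one_form[OF X Y(1) p] d1_cong_form[OF M X Y(1) p e] by (simp add: Y(2))
  qed
  show "ext_deriv (ext_deriv (form_of \<eta>')) (X # Ys) p = 0" if "length Ys = 2"
  proof -
    obtain Y Z where Y: "Y \<in> vfields A" "Z \<in> vfields A" "Ys = [Y, Z]"
      using Ys \<open>length Ys = 2\<close> by (metis lists_2)
    show ?thesis
      using ext_deriv_two_form[where \<omega>="ext_deriv (form_of \<eta>')" and w="d1 \<eta>'", OF M ext_deriv_one_form X Y(1,2) p] d2_d1[OF M \<eta>' X Y(1,2) p]
      by (simp add: Y(3))
  qed
qed

theorem lemma3p19:
  fixes A :: "('a::{t2_space,second_countable_topology}, 'e::euclidean_space) atlas"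
    and g :: "'a \<Rightarrow> 'a tvec \<Rightarrow> 'a tvec \<Rightarrow> real"
    and \<eta> :: "'a \<Rightarrow> 'a tvec \<Rightarrow> real"
    and \<xi> :: "'a vfield"
    and J :: "'a \<Rightarrow> 'a tvec \<Rightarrow> 'a tvec"
  assumes "smooth_manifold A" and "compact (mcarrier A)"
    and "sasakian A g \<eta>"
    and "reeb_field A \<eta> \<xi>"
    and "underlying_transverse_complex A g \<eta> \<xi> J"
  shows "basic_Euler_class_degree_11 A (orbit_foliation \<xi>) J"
proof -
  note M = assms(1)
  obtain I where "kaehler (cone_atlas A) (cone_metric A g) I (ext_deriv (form_of (cone_form A \<eta>)))"
    using assms(3) by (auto simp: sasakian_def)
  then interpret sasakian_cone A g \<eta> \<xi> I
    using assms by unfold_locales (auto simp: sasakian_def contact_form_def)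
  let ?g = "\<lambda>p v w. g p v w / 4"
  let ?\<eta> = "characteristic_form ?g \<xi>"
  note \<eta>' = one_form_cong[OF M \<eta> characteristic_quarter]
  have endo: "endo_field A J"
    using assms(5) by (simp add: underlying_transverse_complex_def transverse_almost_complex_def)
  have "vanishes A 2 (antiholo_part J (ext_deriv (form_of ?\<eta>)))"
    by (rule d_eta_degree_11[OF M g \<eta> assms(4,5)])
      (simp add: ext_deriv_one_form d1_cong_form[OF M _ _ _ characteristic_quarter])
  then have "zero_in_H02b A (orbit_foliation \<xi>) J (antiholo_part J (ext_deriv (form_of ?\<eta>)))"
    by (rule vanishes_zero_in_H02b[OF M endo])
  then show ?thesis
    unfolding basic_Euler_class_degree_11_def
    using killing_pair_quarter basic_form_d_eta[OF M \<eta> \<eta>' characteristic_quarter assms(4)] by blast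
qed

end
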